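(* Let $\overline\theta=(\overline w,\overline\alpha)\in\Theta$. Assume that the Fisher information matrix $$I(\overline\theta)=\int_{\mathscr X}\frac{\partial p(x;\overline\theta)}{\partial\theta}\left(\frac{\partial p(x;\overline\theta)}{\partial\theta}\right)^T\frac{\mu(dx)}{p(x;\overline\theta)}$$ is positive definite and that $\inf_{\theta\in\Theta,\ \|\overline\theta-\theta\|\ge a}h^2(P_{\overline\theta},P_\theta)>0$ for all $a>0$. Let $\hat P$ be a $\rho$-estimator on $\mathscr Q_{K,\delta}$ with $\delta=\frac{\overline V}{n(K-1)}\wedge\frac1K$, written $\hat P=P_{\hat\theta}$ with $\hat\theta=(\hat w,\hat\alpha)$. There exists a positive constant $C(\overline\theta)$ such that for all $\xi>0$, with probability at least $1-e^{-\xi}$, $$C(\overline\theta)\left(\|\overline w-\hat w\|^2+\sum_{k=1}^K1\wedge\|\overline\alpha_k-\hat\alpha_k\|^2\right)\le\frac1n\left[\mathbf h^2\left(\mathbf P^*,P_{\overline\theta}^{\otimes n}\right)+\overline V\log(n)+\xi\right].$$ In particular, when $\mathbf P^*=P_{\overline\theta}^{\otimes n}$, the right-hand side is $(\overline V\log(n)+\xi)/n$ (the usual parametric rate up to a logarithmic factor).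
   Context: Data. $X_1,\dots,X_n$ are independent with values in $(\mathscr X,\mathcal X)$, $\mathbf X=(X_1,\dots,X_n)$ has distribution $\mathbf P^*=P_1^*\otimes\dots\otimes P_n^*$. $h^2(Q,Q')=\frac12\int(\sqrt{dQ/d\nu}-\sqrt{dQ'/d\nu})^2d\nu$ is the squared Hellinger distance and $\mathbf h^2(\bigotimes_iQ_i,\bigotimes_iQ'_i)=\sum_ih^2(Q_i,Q'_i)$. $\|\cdot\|$ is the Euclidean norm; $a\wedge b=\min(a,b)$. The VC-index of a class of functions is the smallest integer $m\ge1$ such that no $m$-point set is shattered by the subgraphs $\{(x,t):t<f(x)\}$; the class is VC-subgraph if this is finite. Model. $K\ge2$ and $\mu$ is a $\sigma$-finite measure. For $k=1,\dots,K$, $\overline{\mathcal F}_k=\{f_k(\cdot;\alpha):\alpha\in A_k\}$ is a set of probability densities with respect to $\mu$, $A_k\subset\mathbb R^{d_k}$. $B_k\subset A_k$ is an at most countable dense subset such that $\{f_k(\cdot;\alpha)\cdot\mu:\alpha\in B_k\}$ is Hellinger-dense in $\{f_k(\cdot;\alpha)\cdot\mu:\alpha\in A_k\}$. $\Theta$ is an open convex subset of $\{w\in(0,1)^{K-1}:\sum_{k=1}^{K-1}w_k<1\}\times A_1\times\dots\times A_K$. For $\theta=(w,\alpha)\in\Theta$, $p(\cdot;\theta)=\sum_{k=1}^{K-1}w_kf_k(\cdot;\alpha_k)+(1-w_1-\dots-w_{K-1})f_K(\cdot;\alpha_K)$ and $P_\theta=p(\cdot;\theta)\cdot\mu$; $w_K:=1-w_1-\dots-w_{K-1}$.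 $\mathscr Q_K=\{P_\theta:\theta\in\Theta\}$ and $\mathscr Q_{K,\delta}$ is the set of $P_\theta$, $\theta=(w,\alpha)\in\Theta$, with $w_k\ge\delta$, $w_k\in\mathbb Q$ and $\alpha_k\in B_k$ for $k=1,\dots,K$; $\mathcal Q_{K,\delta}$ denotes the corresponding densities. Assumptions (standing): (a) for all $k$, $\alpha\mapsto f_k(x;\alpha)$ is continuous on $A_k$ for $\mu$-almost all $x$. (b) For all $k$ and $\alpha\in A_k$, for $\mu$-almost all $x$ the function $u\mapsto f_k(x;u)$ is differentiable at $u=\alpha$, and for all $j\in\{1,\dots,d_k\}$, $\int_{\mathscr X}\left|\frac{\partial f_k(x;\alpha)}{\partial\alpha_j}\right|^2\frac{\mu(dx)}{f_k(x;\alpha)}<\infty$. (c) The function $\theta\mapsto\frac{\partial}{\partial\theta}p^{1/2}(\cdot;\theta)$ is continuous in $L_2(\mu)$. (d) $\overline{\mathcal F}_k$ is VC-subgraph with VC-index not larger than $V_k$ for all $k$; $\overline V=V_1+\dots+V_K$. $\rho$-estimator. Let $\psi(x)=\frac{x-1}{x+1}$ on $[0,+\infty]$ ($\psi(+\infty)=1$), $\mathbf T(\mathbf X,q,q')=\sum_{i=1}^n\psi\big(\sqrt{q'(X_i)/q(X_i)}\big)$ (with $0/0=1$, $a/0=+\infty$ for $a>0$) and $\mathbf\Upsilon(\mathbf X,q)=\sup_{q'\in\mathcal Q_{K,\delta}}\mathbf T(\mathbf X,q,q')$. A $\rho$-estimator on $\mathscr Q_{K,\delta}$ is any measurable element of the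 Hellinger closure of $\{q\cdot\mu:q\in\mathcal Q_{K,\delta},\ \mathbf\Upsilon(\mathbf X,q)<\inf_{q'\in\mathcal Q_{K,\delta}}\mathbf\Upsilon(\mathbf X,q')+8.24\}$.
   Formalization: The theorem is stated for n ≥ 2: for n = 1 the claim fails, since log(n) = 0 and every element of the class is then a ρ-estimator, so a constant estimator different from the true parameter violates the bound as ξ tends to 0. *)

theory Defs
  imports "HOL-Probability.Probability"
begin

section \<open>Squared Hellinger distance\<close>

definition sum_of_measures :: "'a measure \<Rightarrow> 'a measure \<Rightarrow> 'a measure" where
  "sum_of_measures P Q = measure_of (space P) (sets P) (\<lambda>E. emeasure P E + emeasure Q E)"

text \<open>
  The integral does not depend on the choice of the dominating measure; the definition takes
  the sum of the two measures, so that no common dominating measure has to be supplied.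
  Lemma \<open>hellinger_sq_density\<close> below is the formula for an arbitrary dominating measure.
\<close>

definition hellinger_sq :: "'a measure \<Rightarrow> 'a measure \<Rightarrow> real" where
  "hellinger_sq P Q =
     (let \<nu> = sum_of_measures P Q in
      1 / 2 * (\<integral>x. (sqrt (enn2real (RN_deriv \<nu> P x)) - sqrt (enn2real (RN_deriv \<nu> Q x)))\<^sup>2 \<partial>\<nu>))"

text \<open>Closure taken in the space of all probability measures on \<open>M\<close>.\<close>

definition hellinger_closure :: "'a measure \<Rightarrow> 'a measure set \<Rightarrow> 'a measure set" where
  "hellinger_closure M S =
     {P \<in> space (prob_algebra M). \<forall>\<epsilon>>0. \<exists>Q\<in>S. hellinger_sq P Q < \<epsilon>}"

lemma sum_of_measures_density:
  assumes [measurable]: "f \<in> borel_measurable \<nu>" "g \<in> borel_measurable \<nu>"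
  shows "sum_of_measures (density \<nu> f) (density \<nu> g) = density \<nu> (\<lambda>x. f x + g x)"
proof -
  have eq: "emeasure (density \<nu> f) E + emeasure (density \<nu> g) E
            = emeasure (density \<nu> (\<lambda>x. f x + g x)) E" if "E \<in> sets \<nu>" for E
    using that by (simp add: emeasure_density nn_integral_add[symmetric] distrib_right)
  have "sum_of_measures (density \<nu> f) (density \<nu> g)
        = measure_of (space \<nu>) (sets \<nu>) (emeasure (density \<nu> (\<lambda>x. f x + g x)))"
    unfolding sum_of_measures_def
    by (simp, rule measure_of_eq[OF sets.space_closed])
       (simp add: eq sets.sigma_sets_eq)
  also have "\<dots> = density \<nu> (\<lambda>x. f x + g x)"
    using measure_of_of_measure[of "density \<nu> (\<lambda>x. f x + g x)"] by simp
  finally show ?thesis .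
qed

lemma hellinger_sq_density:
  fixes f g :: "'a \<Rightarrow> real"
  assumes "sigma_finite_measure \<nu>"
    and [measurable]: "f \<in> borel_measurable \<nu>" "g \<in> borel_measurable \<nu>"
    and nonneg: "\<And>x. f x \<ge> 0" "\<And>x. g x \<ge> 0"
  shows "hellinger_sq (density \<nu> f) (density \<nu> g) = 1 / 2 * (\<integral>x. (sqrt (f x) - sqrt (g x))\<^sup>2 \<partial>\<nu>)"
proof -
  interpret sigma_finite_measure \<nu> by fact
  define s where "s x = f x + g x" for x
  have [measurable]: "s \<in> borel_measurable \<nu>" unfolding s_def by measurable
  have s: "sum_of_measures (density \<nu> f) (density \<nu> g) = density \<nu> (\<lambda>x. ennreal (s x))"
    using nonneg by (simp add: sum_of_measures_density s_def ennreal_plus[symmetric] del: ennreal_plus)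
  have sf: "sigma_finite_measure (density \<nu> (\<lambda>x. ennreal (s x)))"
    by (subst sigma_finite_iff_density_finite) auto
  have key: "AE x in \<nu>. s x * enn2real (RN_deriv (density \<nu> s) (density \<nu> h) x) = h x"
    if [measurable]: "h \<in> borel_measurable \<nu>" and h: "\<And>x. 0 \<le> h x" "\<And>x. h x \<le> s x" for h
  proof -
    define r where "r = RN_deriv (density \<nu> s) (density \<nu> h)"
    have [measurable]: "r \<in> borel_measurable \<nu>"
      using borel_measurable_RN_deriv[of "density \<nu> s" "density \<nu> h"] by (simp add: r_def)
    have ac: "absolutely_continuous (density \<nu> s) (density \<nu> h)"
      unfolding absolutely_continuous_def
    proof
      fix E assume "E \<in> null_sets (density \<nu> s)"
      then have E: "E \<in> sets \<nu>" "AE x\<in>E in \<nu>. ennreal (s x) = 0"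
        by (auto simp: null_sets_density_iff)
      have "AE x\<in>E in \<nu>. ennreal (h x) = 0"
        using E(2) by eventually_elim (use h in \<open>auto simp: ennreal_eq_0_iff intro: order_trans\<close>)
      with E show "E \<in> null_sets (density \<nu> h)"
        by (auto simp: null_sets_density_iff)
    qed
    have "density (density \<nu> s) r = density \<nu> h"
      unfolding r_def by (rule sigma_finite_measure.density_RN_deriv[OF sf ac]) simp
    then have "density \<nu> (\<lambda>x. ennreal (s x) * r x) = density \<nu> h"
      by (subst (asm) density_density_eq) auto
    then have "AE x in \<nu>. ennreal (s x) * r x = ennreal (h x)"
      by (subst (asm) density_unique_iff) auto
    then show ?thesis
    proof eventually_elim
      case (elim x)
      then have "enn2real (ennreal (s x) * r x) = h x" using h by simp
      then show ?case
        using h[of x] order_trans[OF h(1) h(2), of x] by (simp add: enn2real_mult r_def)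
    qed
  qed
  have kf: "AE x in \<nu>. s x * enn2real (RN_deriv (density \<nu> s) (density \<nu> f) x) = f x"
    by (rule key) (use nonneg in \<open>auto simp: s_def\<close>)
  have kg: "AE x in \<nu>. s x * enn2real (RN_deriv (density \<nu> s) (density \<nu> g) x) = g x"
    by (rule key) (use nonneg in \<open>auto simp: s_def\<close>)
  have "(\<integral>x. (sqrt (enn2real (RN_deriv (density \<nu> s) (density \<nu> f) x))
            - sqrt (enn2real (RN_deriv (density \<nu> s) (density \<nu> g) x)))\<^sup>2 \<partial>density \<nu> s)
      = (\<integral>x. s x * (sqrt (enn2real (RN_deriv (density \<nu> s) (density \<nu> f) x))
            - sqrt (enn2real (RN_deriv (density \<nu> s) (density \<nu> g) x)))\<^sup>2 \<partial>\<nu>)"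
    using borel_measurable_RN_deriv[of "density \<nu> s" "density \<nu> f"]
      borel_measurable_RN_deriv[of "density \<nu> s" "density \<nu> g"] nonneg
    by (subst integral_real_density) (auto simp: s_def)
  also have "\<dots> = (\<integral>x. (sqrt (f x) - sqrt (g x))\<^sup>2 \<partial>\<nu>)"
  proof (rule integral_cong_AE)
    show "AE x in \<nu>. s x * (sqrt (enn2real (RN_deriv (density \<nu> s) (density \<nu> f) x))
            - sqrt (enn2real (RN_deriv (density \<nu> s) (density \<nu> g) x)))\<^sup>2 = (sqrt (f x) - sqrt (g x))\<^sup>2"
      using kf kg
    proof eventually_elim
      case (elim x)
      define a where "a = enn2real (RN_deriv (density \<nu> s) (density \<nu> f) x)"
      define c where "c = enn2real (RN_deriv (density \<nu> s) (density \<nu> g) x)"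
      have e: "s x * a = f x" "s x * c = g x"
        using elim by (simp_all add: a_def c_def)
      have "s x \<ge> 0" using nonneg by (simp add: s_def)
      then have "s x * (sqrt a - sqrt c)\<^sup>2 = (sqrt (s x) * (sqrt a - sqrt c))\<^sup>2"
        by (simp add: power_mult_distrib)
      also have "\<dots> = (sqrt (s x * a) - sqrt (s x * c))\<^sup>2"
        by (simp add: real_sqrt_mult right_diff_distrib)
      finally show ?case using e by (simp add: a_def c_def)
    qed
  qed (use borel_measurable_RN_deriv[of "density \<nu> s" "density \<nu> f"]
      borel_measurable_RN_deriv[of "density \<nu> s" "density \<nu> g"] in auto)
  finally show ?thesis
    by (simp add: hellinger_sq_def s Let_def)
qed


section \<open>VC-subgraph classes\<close>

definition shatters :: "'b set set \<Rightarrow> 'b set \<Rightarrow> bool" where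
  "shatters \<C> S \<longleftrightarrow> (\<forall>T\<subseteq>S. \<exists>C\<in>\<C>. S \<inter> C = T)"

definition subgraph :: "('a \<Rightarrow> real) \<Rightarrow> ('a \<times> real) set" where
  "subgraph f = {(x, t). t < f x}"

definition no_shattered_points :: "'a set \<Rightarrow> ('a \<Rightarrow> real) set \<Rightarrow> nat \<Rightarrow> bool" where
  "no_shattered_points X F m \<longleftrightarrow>
     m \<ge> 1 \<and> \<not> (\<exists>S. S \<subseteq> X \<times> UNIV \<and> card S = m \<and> shatters (subgraph ` F) S)"

definition VC_subgraph :: "'a set \<Rightarrow> ('a \<Rightarrow> real) set \<Rightarrow> bool" where
  "VC_subgraph X F \<longleftrightarrow> (\<exists>m. no_shattered_points X F m)"

definition VC_index :: "'a set \<Rightarrow> ('a \<Rightarrow> real) set \<Rightarrow> nat" where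
  "VC_index X F = (LEAST m. no_shattered_points X F m)"


section \<open>\<open>\<rho>\<close>-estimators\<close>

definition rho_psi :: "ereal \<Rightarrow> real" where
  "rho_psi r = (if r = \<infinity> then 1 else (real_of_ereal r - 1) / (real_of_ereal r + 1))"

definition sqrt_ratio :: "real \<Rightarrow> real \<Rightarrow> ereal" where
  "sqrt_ratio a b = (if b = 0 then (if a = 0 then 1 else \<infinity>) else ereal (sqrt (a / b)))"

definition rho_T :: "nat \<Rightarrow> (nat \<Rightarrow> 'a) \<Rightarrow> ('a \<Rightarrow> real) \<Rightarrow> ('a \<Rightarrow> real) \<Rightarrow> real" where
  "rho_T n x q q' = (\<Sum>i=1..n. rho_psi (sqrt_ratio (q' (x i)) (q (x i))))"

definition rho_Upsilon ::
    "('a \<Rightarrow> real) set \<Rightarrow> nat \<Rightarrow> (nat \<Rightarrow> 'a) \<Rightarrow> ('a \<Rightarrow> real) \<Rightarrow> real" where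
  "rho_Upsilon \<Q> n x q = (SUP q'\<in>\<Q>. rho_T n x q q')"

text \<open>
  The model is given by a class \<open>\<Q>\<close> of densities with respect to \<open>\<mu>\<close>.  An estimator is a function
  of the observation \<open>x = (x 1, \<dots>, x n)\<close>, i.e. of a point of the product space, and it is
  measurable with respect to the sigma-algebra of the space of probability measures.
\<close>

definition rho_estimator ::
    "'a measure \<Rightarrow> ('a \<Rightarrow> real) set \<Rightarrow> nat \<Rightarrow> ((nat \<Rightarrow> 'a) \<Rightarrow> 'a measure) \<Rightarrow> bool" where
  "rho_estimator \<mu> \<Q> n Phat \<longleftrightarrow>
     Phat \<in> PiM {1..n} (\<lambda>_. \<mu>) \<rightarrow>\<^sub>M prob_algebra \<mu> \<and>
     (\<forall>x\<in>space (PiM {1..n} (\<lambda>_. \<mu>)).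
        Phat x \<in> hellinger_closure \<mu>
          {density \<mu> (\<lambda>y. ennreal (q y)) | q.
             q \<in> \<Q> \<and> rho_Upsilon \<Q> n x q < (INF q'\<in>\<Q>. rho_Upsilon \<Q> n x q') + 8.24})"


section \<open>Finite mixture models\<close>

text \<open>
  The \<open>K \<ge> 2\<close> components are indexed by \<open>'w option\<close>, where \<open>None\<close> is the last component, whose
  weight is determined by the other \<open>K - 1\<close> ones; so \<open>K - 1 = CARD('w)\<close>.  All
  \<open>d\<^sub>1 + \<dots> + d\<^sub>K\<close> coordinates of \<open>\<alpha> = (\<alpha>\<^sub>1, \<dots>, \<alpha>\<^sub>K)\<close> are indexed by \<open>'j\<close>, and \<open>b j\<close> is the component
  that coordinate \<open>j\<close> belongs to.  Thus \<open>d\<^sub>k\<close> is the number of \<open>j\<close> with \<open>b j = k\<close>, and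
  \<open>\<real>\<close>-to-the-\<open>d\<^sub>k\<close> is identified with the coordinate subspace \<open>block b k\<close>.  A parameter
  \<open>\<theta> = (w, \<alpha>)\<close> is one Euclidean vector with index type \<open>'w + 'j\<close>.
\<close>

definition block :: "('j::finite \<Rightarrow> 'w option) \<Rightarrow> 'w option \<Rightarrow> (real ^ 'j) set" where
  "block b k = {u. \<forall>j. b j \<noteq> k \<longrightarrow> u $ j = 0}"

definition free_weights :: "real ^ ('w::finite + 'j::finite) \<Rightarrow> real ^ 'w" where
  "free_weights \<theta> = (\<chi> k. \<theta> $ Inl k)"

definition weight :: "real ^ ('w::finite + 'j::finite) \<Rightarrow> 'w option \<Rightarrow> real" where
  "weight \<theta> k = (case k of Some l \<Rightarrow> \<theta> $ Inl l | None \<Rightarrow> 1 - (\<Sum>l\<in>UNIV. \<theta> $ Inl l))"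

definition component ::
    "('j::finite \<Rightarrow> 'w option) \<Rightarrow> 'w option \<Rightarrow> real ^ ('w::finite + 'j) \<Rightarrow> real ^ 'j" where
  "component b k \<theta> = (\<chi> j. if b j = k then \<theta> $ Inr j else 0)"

definition mix_density ::
    "('j::finite \<Rightarrow> 'w option) \<Rightarrow> ('w option \<Rightarrow> real ^ 'j \<Rightarrow> 'a \<Rightarrow> real)
       \<Rightarrow> real ^ ('w::finite + 'j) \<Rightarrow> 'a \<Rightarrow> real" where
  "mix_density b f \<theta> x = (\<Sum>k\<in>UNIV. weight \<theta> k * f k (component b k \<theta>) x)"

definition mix_measure ::
    "'a measure \<Rightarrow> ('j::finite \<Rightarrow> 'w option) \<Rightarrow> ('w option \<Rightarrow> real ^ 'j \<Rightarrow> 'a \<Rightarrow> real)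
       \<Rightarrow> real ^ ('w::finite + 'j) \<Rightarrow> 'a measure" where
  "mix_measure \<mu> b f \<theta> = density \<mu> (\<lambda>x. ennreal (mix_density b f \<theta> x))"

definition mix_subclass ::
    "('j::finite \<Rightarrow> 'w option) \<Rightarrow> ('w option \<Rightarrow> real ^ 'j \<Rightarrow> 'a \<Rightarrow> real)
       \<Rightarrow> ('w option \<Rightarrow> (real ^ 'j) set) \<Rightarrow> (real ^ ('w::finite + 'j)) set
       \<Rightarrow> real \<Rightarrow> ('a \<Rightarrow> real) set" where
  "mix_subclass b f B \<Theta> \<delta> =
     {mix_density b f \<theta> | \<theta>.
        \<theta> \<in> \<Theta> \<and> (\<forall>k. \<delta> \<le> weight \<theta> k \<and> weight \<theta> k \<in> \<rat> \<and> component b k \<theta> \<in> B k)}"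

definition pderiv_at :: "(real ^ 'p \<Rightarrow> real) \<Rightarrow> real ^ 'p \<Rightarrow> 'p::finite \<Rightarrow> real" where
  "pderiv_at F \<theta> i = frechet_derivative F (at \<theta>) (axis i 1)"

text \<open>
  Derivatives in \<open>\<theta>\<close> exist only for almost all \<open>x\<close>, so they are integrated with respect to the
  completion of \<open>\<mu>\<close>: their values on the exceptional null set are then irrelevant.
\<close>

definition Fisher_information ::
    "'a measure \<Rightarrow> (real ^ 'p \<Rightarrow> 'a \<Rightarrow> real) \<Rightarrow> real ^ 'p \<Rightarrow> real ^ 'p ^ 'p::finite" where
  "Fisher_information \<mu> p \<theta> =
     (\<chi> i j. \<integral>x. pderiv_at (\<lambda>\<theta>. p \<theta> x) \<theta> i * pderiv_at (\<lambda>\<theta>. p \<theta> x) \<theta> j / p \<theta> x \<partial>completion \<mu>)"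

definition positive_definite :: "real ^ 'p ^ 'p::finite \<Rightarrow> bool" where
  "positive_definite I \<longleftrightarrow> transpose I = I \<and> (\<forall>v. v \<noteq> 0 \<longrightarrow> v \<bullet> (I *v v) > 0)"

text \<open>
  Where the density vanishes its square root is minimal, so that the only possible value of the
  derivative is \<open>0\<close>; the square root need not be differentiable there.
\<close>

definition sqrt_density_deriv ::
    "(real ^ 'p \<Rightarrow> 'a \<Rightarrow> real) \<Rightarrow> 'p::finite \<Rightarrow> real ^ 'p \<Rightarrow> 'a \<Rightarrow> real" where
  "sqrt_density_deriv p i \<theta> x =
     (if p \<theta> x = 0 then 0 else pderiv_at (\<lambda>\<theta>. sqrt (p \<theta> x)) \<theta> i)"

definition L2_continuous_on ::
    "'a measure \<Rightarrow> 't::topological_space set \<Rightarrow> ('t \<Rightarrow> 'a \<Rightarrow> real) \<Rightarrow> bool" where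
  "L2_continuous_on M S g \<longleftrightarrow>
     (\<forall>\<theta>\<in>S. g \<theta> \<in> borel_measurable M \<and> (\<integral>\<^sup>+x. ennreal ((g \<theta> x)\<^sup>2) \<partial>M) < \<infinity>) \<and>
     (\<forall>\<theta>\<in>S. ((\<lambda>\<eta>. \<integral>\<^sup>+x. ennreal ((g \<eta> x - g \<theta> x)\<^sup>2) \<partial>M) \<longlongrightarrow> 0) (at \<theta> within S))"

text \<open>
  In \<open>differentiable\<close> the derivative is taken within \<open>A k\<close>, outside of which \<open>f k\<close> has no meaning.
  \<open>D x\<close> is the differential of \<open>u \<mapsto> f k u x\<close> at \<open>\<alpha>\<close> and \<open>D x (axis j 1)\<close> the partial derivative
  in direction \<open>j\<close>; at points of the interior of \<open>A k\<close> relative to \<open>block b k\<close> it is unique.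
  The quotient is formed in \<open>ennreal\<close>, so that \<open>0 / 0 = 0\<close> and \<open>a / 0 = \<infinity>\<close> for \<open>a > 0\<close>.
\<close>

locale mixture_model = sigma_finite_measure \<mu>
  for \<mu> :: "'a measure" +
  fixes b :: "'j::finite \<Rightarrow> 'w::finite option"
    and f :: "'w option \<Rightarrow> real ^ 'j \<Rightarrow> 'a \<Rightarrow> real"
    and A B :: "'w option \<Rightarrow> (real ^ 'j) set"
    and V :: "'w option \<Rightarrow> nat"
    and \<Theta> :: "(real ^ ('w + 'j)) set"
  assumes A_subset: "\<And>k. A k \<subseteq> block b k"
    and density_measurable: "\<And>k \<alpha>. \<alpha> \<in> A k \<Longrightarrow> f k \<alpha> \<in> borel_measurable \<mu>"
    and density_nonneg: "\<And>k \<alpha> x. \<alpha> \<in> A k \<Longrightarrow> x \<in> space \<mu> \<Longrightarrow> 0 \<le> f k \<alpha> x"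
    and density_integral: "\<And>k \<alpha>. \<alpha> \<in> A k \<Longrightarrow> (\<integral>\<^sup>+x. ennreal (f k \<alpha> x) \<partial>\<mu>) = 1"
    and B_subset: "\<And>k. B k \<subseteq> A k"
    and B_countable: "\<And>k. countable (B k)"
    and B_dense: "\<And>k. A k \<subseteq> closure (B k)"
    and B_hellinger_dense:
      "\<And>k. (\<lambda>\<alpha>. density \<mu> (\<lambda>x. ennreal (f k \<alpha> x))) ` A k
             \<subseteq> hellinger_closure \<mu> ((\<lambda>\<alpha>. density \<mu> (\<lambda>x. ennreal (f k \<alpha> x))) ` B k)"
    and \<Theta>_open: "open \<Theta>"
    and \<Theta>_convex: "convex \<Theta>"
    and \<Theta>_subset:
      "\<Theta> \<subseteq> {\<theta>. (\<forall>k. free_weights \<theta> $ k \<in> {0<..<1}) \<and> (\<Sum>k\<in>UNIV. free_weights \<theta> $ k) < 1 \<and>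
                (\<forall>k. component b k \<theta> \<in> A k)}"
    and continuous: "\<And>k. AE x in \<mu>. continuous_on (A k) (\<lambda>\<alpha>. f k \<alpha> x)"
    and differentiable:
      "\<And>k \<alpha>. \<alpha> \<in> A k \<Longrightarrow>
         \<exists>D. (AE x in \<mu>. ((\<lambda>u. f k u x) has_derivative D x) (at \<alpha> within A k)) \<and>
             (\<forall>j. b j = k \<longrightarrow>
                (\<integral>\<^sup>+x. ennreal (\<bar>D x (axis j 1)\<bar>\<^sup>2) / ennreal (f k \<alpha> x) \<partial>completion \<mu>) < \<infinity>)"
    and sqrt_density_C1:
      "\<And>i. L2_continuous_on (completion \<mu>) \<Theta> (sqrt_density_deriv (mix_density b f) i)"
    and VC: "\<And>k. VC_subgraph (space \<mu>) (f k ` A k)"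
    and VC_bound: "\<And>k. VC_index (space \<mu>) (f k ` A k) \<le> V k"

end

theory Submission
  imports Defs
begin

text \<open>
  The proof has a statistical and a geometric half, which meet in the Hellinger distance.

  \<^emph>\<open>Statistics: the \<open>\<rho>\<close>-estimator has small Hellinger risk\<close> (\<open>rho_estimator_hellinger_risk\<close>).
  Fix one member \<open>q\<^sub>0\<close> of the countable class, close to the target \<open>P\<^bsub>\<theta>bar\<^esub>\<close>.  Since \<open>\<psi>(1/r) = - \<psi>(r)\<close>,
  the statistic \<open>T\<close> is antisymmetric, and near-minimality of \<open>\<Upsilon>\<close> at the selected density can be
  exploited through the process \<open>q \<mapsto> T(X, q\<^sub>0, q)\<close> alone (\<open>rho_selection_bound\<close>).
  In mean, \<open>\<psi>(sqrt(q/q\<^sub>0))\<close> is at most a multiple of \<open>h\<^sup>2(P, q\<^sub>0)\<close> minus a multiple of \<open>h\<^sup>2(P, q)\<close>,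
  and its second moment is bounded by the same two distances (\<open>psi_ratio_expectation\<close>).  Hence it
  suffices to bound the fluctuations of the process, uniformly in \<open>q\<close>, by a small multiple of the
  second moments plus a term of order \<open>V log n + \<xi>\<close>.

  Such a bound follows from an exponential symmetrization (\<open>exp_moment_symmetrization\<close>): compare the
  sample with a ghost sample, exchange the two at random in each coordinate, and observe that given
  the \<open>2 n\<close> points only the number of distinguishable functions matters, since the signs average
  out against the second moments for each single function.  That number is polynomial in \<open>n\<close>
  (\<open>ex_mixture_code\<close>).  As \<open>q\<^sub>0\<close> is fixed, \<open>\<psi>(sqrt(q/q\<^sub>0))\<close> at a point \<open>x\<close> is known up to \<open>O(1/n)\<close> once
  the weights are known approximately and each component \<open>f\<^sub>k(x)\<close> has been compared with
  polynomially many multiples of \<open>q\<^sub>0(x)\<close>; the VC hypothesis and the Sauer--Shelah bound count the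
  possible outcomes of these comparisons.  The weights are at least \<open>\<delta>\<close>, of order \<open>1/n\<close>, so a component that
  exceeds the largest multiple already forces \<open>\<psi>\<close> to be close to \<open>1\<close>.

  \<^emph>\<open>Geometry: the Hellinger distance dominates the parametric loss\<close> (\<open>hellinger_lower_bound\<close>).  Away
  from \<open>\<theta>bar\<close> this is the identifiability hypothesis, because the loss is bounded.  If it failed
  near \<open>\<theta>bar\<close>, then along some sequence with limiting direction \<open>v\<close> the difference quotients of
  \<open>sqrt p\<close> would tend to \<open>0\<close> in \<open>L\<^sub>2(\<mu>)\<close>.  Where the density is positive they converge almost
  everywhere to the derivative in direction \<open>v\<close>, so by Fatou's lemma that derivative vanishes there and \<open>v\<close> is in the kernel of the Fisher
  information matrix.

  The constant may depend on \<open>\<theta>bar\<close>.  For small \<open>n\<close> boundedness of the loss is enough; for large \<open>n\<close>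
  the weights of \<open>\<theta>bar\<close> exceed \<open>\<delta>\<close>, and continuity of the densities in the parameter provides
  \<open>q\<^sub>0\<close> (\<open>mix_params_dense\<close>).
\<close>

section \<open>The Sauer--Shelah bound\<close>

lemma shattered_subset:
  assumes "shatters C S" "T \<subseteq> S" shows "shatters C T"
  unfolding shatters_def
proof (intro allI impI)
  fix U assume "U \<subseteq> T"
  then obtain A where "A \<in> C" "S \<inter> A = U"
    using assms unfolding shatters_def by (meson order_trans)
  then show "\<exists>A\<in>C. T \<inter> A = U" using \<open>U \<subseteq> T\<close> assms(2) by blast
qed

text \<open>
  Pajor's form of the Sauer--Shelah lemma, which is the form that passes through an induction on the
  ground set: split \<open>F\<close> by membership of one point \<open>x\<close>.  The sets shattered by the union of the two
  halves avoid \<open>x\<close>; those shattered by the intersection remain shattered when \<open>x\<close> is added.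
\<close>

lemma card_le_card_shattered:
  assumes "finite S" "F \<subseteq> Pow S"
  shows "card F \<le> card {T. T \<subseteq> S \<and> shatters F T}"
  using assms
proof (induction S arbitrary: F rule: finite_induct)
  case empty
  show ?case
  proof (cases "F = {}")
    case False
    then have F: "F = {{}}" using empty by auto
    then have "{T. T \<subseteq> {} \<and> shatters F T} = {{}}" by (auto simp: shatters_def)
    with F show ?thesis by simp
  qed simp
next
  case (insert x S)
  define F0 where "F0 = {A \<in> F. x \<notin> A}"
  define F1 where "F1 = (\<lambda>A. A - {x}) ` {A \<in> F. x \<in> A}"
  have fF: "finite F" using insert.prems insert.hyps by (meson finite.insertI finite_Pow_iff finite_subset)
  have fin: "finite F0" "finite F1" using fF by (auto simp: F0_def F1_def)
  have inj: "inj_on (\<lambda>A. A - {x}) {A \<in> F. x \<in> A}" by (auto simp: inj_on_def)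
  have "F = F0 \<union> {A \<in> F. x \<in> A}" by (auto simp: F0_def)
  then have "card F = card F0 + card {A \<in> F. x \<in> A}"
    using fF by (subst card_Un_disjoint[symmetric]) (auto simp: F0_def)
  also have "card {A \<in> F. x \<in> A} = card F1" by (simp add: F1_def card_image[OF inj])
  also have "card F0 + card F1 = card (F0 \<union> F1) + card (F0 \<inter> F1)"
    by (rule card_Un_Int[OF fin])
  finally have cF: "card F = card (F0 \<union> F1) + card (F0 \<inter> F1)" .
  have sub: "F0 \<union> F1 \<subseteq> Pow S" "F0 \<inter> F1 \<subseteq> Pow S" using insert.prems by (auto simp: F0_def F1_def)
  let ?U = "{T. T \<subseteq> S \<and> shatters (F0 \<union> F1) T}"
  let ?I = "{T. T \<subseteq> S \<and> shatters (F0 \<inter> F1) T}"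
  let ?R = "{T. T \<subseteq> insert x S \<and> shatters F T}"
  have finR: "finite ?R" using insert.hyps by (auto intro: finite_subset[of _ "Pow (insert x S)"])
  have finI: "finite ?I" "finite ?U" using insert.hyps by (auto intro: finite_subset[of _ "Pow S"])
  have "?U \<subseteq> ?R"
  proof safe
    fix T assume T: "T \<subseteq> S" "shatters (F0 \<union> F1) T"
    show "shatters F T" unfolding shatters_def
    proof (intro allI impI)
      fix V assume "V \<subseteq> T"
      then obtain A where A: "A \<in> F0 \<union> F1" "T \<inter> A = V" using T unfolding shatters_def by blast
      then have "A \<in> F \<or> (\<exists>B\<in>F. A = B - {x})" by (auto simp: F0_def F1_def)
      moreover have "x \<notin> T" using T insert.hyps by blast
      ultimately show "\<exists>A\<in>F. T \<inter> A = V" using A(2) by blast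
    qed
  qed auto
  moreover have "insert x ` ?I \<subseteq> ?R"
  proof safe
    fix T assume T: "T \<subseteq> S" "shatters (F0 \<inter> F1) T"
    have xT: "x \<notin> T" using T insert.hyps by blast
    show "shatters F (insert x T)" unfolding shatters_def
    proof (intro allI impI)
      fix V assume V: "V \<subseteq> insert x T"
      then have "V - {x} \<subseteq> T" by blast
      then obtain A where A: "A \<in> F0" "A \<in> F1" "T \<inter> A = V - {x}"
        using T unfolding shatters_def by blast
      then obtain B where B: "B \<in> F" "x \<in> B" "A = B - {x}" by (auto simp: F1_def)
      have A0: "A \<in> F" "x \<notin> A" using A by (auto simp: F0_def)
      show "\<exists>A\<in>F. insert x T \<inter> A = V"
      proof (cases "x \<in> V")
        case True
        then have "insert x T \<inter> B = V" using A(3) B xT by auto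
        with B show ?thesis by blast
      next
        case False
        then have "insert x T \<inter> A = V" using A(3) A0 by auto
        with A0 show ?thesis by blast
      qed
    qed
  qed (auto)
  ultimately have "?U \<union> insert x ` ?I \<subseteq> ?R" by blast
  then have "card (?U \<union> insert x ` ?I) \<le> card ?R" by (rule card_mono[OF finR])
  moreover have "card (?U \<union> insert x ` ?I) = card ?U + card (insert x ` ?I)"
    using insert.hyps by (intro card_Un_disjoint) (use finI in auto)
  moreover have "card (insert x ` ?I) = card ?I"
    by (rule card_image) (use insert.hyps in \<open>auto simp: inj_on_def\<close>)
  ultimately show ?case
    using cF insert.IH[OF sub(1)] insert.IH[OF sub(2)] by linarith
qed

text \<open>
  A crude substitute for the usual binomial sum; only its polynomial order in \<open>card S\<close> matters.
\<close>

lemma card_subsets_less: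
  assumes "finite S"
  shows "card {T. T \<subseteq> S \<and> card T < m} \<le> (card S + 1) ^ m"
proof (cases "S = {}")
  case True
  then have "{T. T \<subseteq> S \<and> card T < m} \<subseteq> {{}}" by auto
  then have "card {T. T \<subseteq> S \<and> card T < m} \<le> card {{}::'a set}" by (intro card_mono) auto
  then show ?thesis using True by simp
next
  case False
  then have c1: "1 \<le> card S" using assms by (simp add: Suc_leI card_gt_0_iff)
  show ?thesis
  proof (induction m)
    case 0 show ?case by simp
  next
    case (Suc m)
    have "{T. T \<subseteq> S \<and> card T < Suc m} = {T. T \<subseteq> S \<and> card T < m} \<union> {T. T \<subseteq> S \<and> card T = m}" by auto
    then have "card {T. T \<subseteq> S \<and> card T < Suc m}
        \<le> card {T. T \<subseteq> S \<and> card T < m} + card {T. T \<subseteq> S \<and> card T = m}"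
      by (simp add: card_Un_le)
    also have "card {T. T \<subseteq> S \<and> card T = m} = card S choose m" by (rule n_subsets[OF assms])
    also have "\<dots> \<le> card S * (card S + 1) ^ m"
    proof (cases "m = 0 \<or> card S < m")
      case False
      then have "card S choose m \<le> card S ^ m" by (intro binomial_le_pow) auto
      also have "\<dots> = card S * card S ^ (m - 1)" using False by (cases m) auto
      also have "\<dots> \<le> card S * (card S + 1) ^ m"
        using False by (intro mult_left_mono
            order_trans[OF power_mono[of "card S" "card S + 1"] power_increasing]) auto
      finally show ?thesis .
    qed (use c1 in \<open>auto simp: binomial_eq_0\<close>)
    finally show ?case using Suc by simp
  qed
qed

lemma card_traces_le:
  assumes "finite S" "\<And>T. T \<subseteq> S \<Longrightarrow> card T = m \<Longrightarrow> \<not> shatters C T"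
  shows "card ((\<lambda>A. S \<inter> A) ` C) \<le> (card S + 1) ^ m"
proof -
  let ?F = "(\<lambda>A. S \<inter> A) ` C"
  have small: "card T < m" if T: "T \<subseteq> S" "shatters ?F T" for T
  proof (rule ccontr)
    assume "\<not> card T < m"
    then obtain U where U: "U \<subseteq> T" "card U = m" using obtain_subset_with_card_n[of m T] by auto
    have "shatters C T" unfolding shatters_def
    proof (intro allI impI)
      fix V assume "V \<subseteq> T"
      then obtain A where A: "A \<in> C" "T \<inter> (S \<inter> A) = V" using T(2) unfolding shatters_def by blast
      then have "T \<inter> A = V" using T(1) by blast
      with A show "\<exists>A\<in>C. T \<inter> A = V" by blast
    qed
    then have "shatters C U" using U(1) by (rule shattered_subset)
    then show False using assms(2)[of U] U T(1) by blast
  qed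
  have "card ?F \<le> card {T. T \<subseteq> S \<and> shatters ?F T}"
    by (rule card_le_card_shattered[OF assms(1)]) auto
  also have "\<dots> \<le> card {T. T \<subseteq> S \<and> card T < m}"
    by (rule card_mono) (use assms(1) small in auto)
  also have "\<dots> \<le> (card S + 1) ^ m" by (rule card_subsets_less[OF assms(1)])
  finally show ?thesis .
qed

text \<open>
  The VC index enters the proof only through this count: the outcomes of the comparisons \<open>t < g x\<close>,
  for \<open>(x, t)\<close> in \<open>S\<close>, are the traces of the subgraph of \<open>g\<close> on \<open>S\<close>.
\<close>

lemma card_subgraph_traces_le:
  assumes "VC_subgraph X F" "VC_index X F \<le> v" "finite S" "S \<subseteq> X \<times> UNIV"
  shows "card ((\<lambda>f. S \<inter> subgraph f) ` F) \<le> (card S + 1) ^ v"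
proof -
  have "no_shattered_points X F (VC_index X F)"
    using assms(1) unfolding VC_subgraph_def VC_index_def by (auto intro: LeastI)
  then have "card ((\<lambda>A. S \<inter> A) ` subgraph ` F) \<le> (card S + 1) ^ VC_index X F"
    by (intro card_traces_le[OF assms(3)]) (use assms(4) in \<open>auto simp: no_shattered_points_def\<close>)
  also have "\<dots> \<le> (card S + 1) ^ v" using assms(2) by (intro power_increasing) auto
  finally show ?thesis by (simp add: image_image)
qed

lemma VC_index_pos: "VC_subgraph X F \<Longrightarrow> 1 \<le> VC_index X F"
  unfolding VC_subgraph_def VC_index_def
  by (metis (mono_tags, lifting) LeastI no_shattered_points_def)

section \<open>Uniform deviations by symmetrization\<close>

text \<open>
  Hoeffding's lemma for a fair sign.
\<close>

lemma exp_add_exp_minus_le: "exp y + exp (- y) \<le> 2 * exp (y\<^sup>2 / 2)" for y :: real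
proof -
  have *: "exp y + exp (- y) \<le> 2 * exp (y\<^sup>2 / 2)" if "0 \<le> y" for y :: real
  proof -
    have "- (2 * y) * (1/2) + ln (1 + (1/2) * (exp (2 * y) - 1)) \<le> (2 * y)\<^sup>2 / 8"
      by (rule Hoeffdings_lemma_aux) (use that in auto)
    then have "ln (1 + (1/2) * (exp (2 * y) - 1)) \<le> y + y\<^sup>2 / 2" by (simp add: power2_eq_square)
    moreover have pos: "1 + (1/2) * (exp (2 * y) - 1) > 0"
    proof -
      have e: "1 + (1/2) * (exp (2 * y) - 1) = (1 + exp (2 * y)) / 2" by (simp add: field_simps)
      show ?thesis unfolding e by (simp add: add_pos_pos)
    qed
    ultimately have "1 + (1/2) * (exp (2 * y) - 1) \<le> exp (y + y\<^sup>2 / 2)"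
      by (metis exp_le_cancel_iff exp_ln)
    moreover have "1 + a \<le> 2 * b" if "1 + (1/2) * (a - 1) \<le> b" for a b :: real
      using that by (simp add: field_simps)
    ultimately have "1 + exp (2 * y) \<le> 2 * (exp y * exp (y\<^sup>2 / 2))" unfolding exp_add by blast
    moreover have "1 + exp (2 * y) = exp y * (exp y + exp (- y))"
      by (simp add: distrib_left flip: exp_add) 
    ultimately have "exp y * (exp y + exp (- y)) \<le> exp y * (2 * exp (y\<^sup>2 / 2))" by simp
    then show ?thesis using mult_le_cancel_left_pos[OF exp_gt_zero] by blast
  qed
  show ?thesis using *[of y] *[of "- y"] by (cases "0 \<le> y") (auto simp: add.commute)
qed

text \<open>
  The subset \<open>T\<close> encodes a choice of signs.  The sum over \<open>T\<close> factorizes over the coordinates, and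
  in each of them \<open>cosh (c (u - v))\<close> is at most \<open>exp (c\<^sup>2 (u\<^sup>2 + v\<^sup>2))\<close>: the quadratic penalty pays
  exactly for the randomized signs.
\<close>

lemma sum_signs_exp_le:
  fixes c :: real and u v :: "nat \<Rightarrow> real"
  assumes "finite I" "0 \<le> c" "c \<le> 1"
  shows "(\<Sum>T\<in>Pow I. exp (c * (\<Sum>i\<in>I. (if i \<in> T then v i - u i else u i - v i) - c * ((u i)\<^sup>2 + (v i)\<^sup>2))))
     \<le> 2 ^ card I"
proof -
  let ?d = "\<lambda>i. c * (u i - v i)" and ?e = "\<lambda>i. exp (- (c\<^sup>2 * ((u i)\<^sup>2 + (v i)\<^sup>2)))"
  have "(\<Sum>T\<in>Pow I. exp (c * (\<Sum>i\<in>I. (if i \<in> T then v i - u i else u i - v i) - c * ((u i)\<^sup>2 + (v i)\<^sup>2))))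
      = (\<Sum>T\<in>Pow I. (\<Prod>i\<in>T. exp (- ?d i) * ?e i) * (\<Prod>i\<in>I - T. exp (?d i) * ?e i))"
  proof (rule sum.cong[OF refl])
    fix T assume T: "T \<in> Pow I"
    have "exp (c * (\<Sum>i\<in>I. (if i \<in> T then v i - u i else u i - v i) - c * ((u i)\<^sup>2 + (v i)\<^sup>2)))
       = (\<Prod>i\<in>I. if i \<in> T then exp (- ?d i) * ?e i else exp (?d i) * ?e i)"
      unfolding sum_distrib_left exp_sum[OF assms(1)]
      by (rule prod.cong[OF refl]) (auto simp: power2_eq_square algebra_simps simp flip: exp_add)
    also have "\<dots> = (\<Prod>i\<in>T. exp (- ?d i) * ?e i) * (\<Prod>i\<in>I - T. exp (?d i) * ?e i)"
    proof -
      have "I \<inter> {x. x \<in> T} = T" "I \<inter> - {x. x \<in> T} = I - T" using T by auto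
      then show ?thesis by (simp only: prod.If_cases[OF assms(1)])
    qed
    finally show "exp (c * (\<Sum>i\<in>I. (if i \<in> T then v i - u i else u i - v i) - c * ((u i)\<^sup>2 + (v i)\<^sup>2)))
      = (\<Prod>i\<in>T. exp (- ?d i) * ?e i) * (\<Prod>i\<in>I - T. exp (?d i) * ?e i)" .
  qed
  also have "\<dots> = (\<Prod>i\<in>I. exp (- ?d i) * ?e i + exp (?d i) * ?e i)"
    by (rule prod_add[OF assms(1), symmetric])
  also have "\<dots> \<le> (\<Prod>i\<in>I. 2)"
  proof (rule prod_mono, safe)
    fix i assume "i \<in> I"
    show "0 \<le> exp (- ?d i) * ?e i + exp (?d i) * ?e i" by simp
    have "(u i - v i)\<^sup>2 \<le> 2 * ((u i)\<^sup>2 + (v i)\<^sup>2)"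
      using zero_le_power2[of "u i + v i"] by (simp add: power2_eq_square algebra_simps)
    then have "c\<^sup>2 * (u i - v i)\<^sup>2 \<le> c\<^sup>2 * (2 * ((u i)\<^sup>2 + (v i)\<^sup>2))"
      by (rule mult_left_mono) simp
    then have le: "(?d i)\<^sup>2 / 2 \<le> c\<^sup>2 * ((u i)\<^sup>2 + (v i)\<^sup>2)"
      unfolding power_mult_distrib by linarith
    have "exp (- ?d i) * ?e i + exp (?d i) * ?e i = (exp (?d i) + exp (- ?d i)) * ?e i"
      by (simp add: distrib_right)
    also have "\<dots> \<le> 2 * exp ((?d i)\<^sup>2 / 2) * ?e i"
      by (intro mult_right_mono exp_add_exp_minus_le) simp
    also have "\<dots> = 2 * exp ((?d i)\<^sup>2 / 2 - c\<^sup>2 * ((u i)\<^sup>2 + (v i)\<^sup>2))"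
      by (simp only: diff_conv_add_uminus exp_add mult.assoc)
    also have "\<dots> \<le> 2" using le by simp
    finally show "exp (- ?d i) * ?e i + exp (?d i) * ?e i \<le> 2" .
  qed
  finally show ?thesis by simp
qed

text \<open>core\<close>
text \<open>
  Coordinate \<open>n + i\<close> is the ghost copy of coordinate \<open>i\<close>; exchanging some of the pairs is a permutation
  of the coordinates that respects the factors of the product measure.
\<close>

lemma nn_integral_PiM_swap:
  fixes M :: "nat \<Rightarrow> 'a measure" and F :: "(nat \<Rightarrow> 'a) \<Rightarrow> ennreal"
  assumes M: "\<And>i. prob_space (M i)" and Mn: "\<And>i. i \<in> {1..n} \<Longrightarrow> M (n + i) = M i"
    and T: "T \<subseteq> {1..n}"
    and F[measurable]: "F \<in> borel_measurable (PiM {1..2*n} M)"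
  defines "\<tau> \<equiv> \<lambda>k. if k \<in> T then n + k else if k > n \<and> k - n \<in> T then k - n else k"
  shows "(\<integral>\<^sup>+z. F (\<lambda>k\<in>{1..2*n}. z (\<tau> k)) \<partial>PiM {1..2*n} M) = (\<integral>\<^sup>+z. F z \<partial>PiM {1..2*n} M)"
    and "(\<lambda>z. \<lambda>k\<in>{1..2*n}. z (\<tau> k)) \<in> PiM {1..2*n} M \<rightarrow>\<^sub>M PiM {1..2*n} M"
proof -
  have inv: "\<tau> (\<tau> k) = k" if "k \<in> {1..2*n}" for k
    using that T unfolding \<tau>_def by auto
  have range: "\<tau> k \<in> {1..2*n}" if "k \<in> {1..2*n}" for k
    using that T unfolding \<tau>_def by auto
  have inj: "inj_on \<tau> {1..2*n}" by (rule inj_on_inverseI[of _ \<tau>]) (rule inv)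
  have M\<tau>: "M (\<tau> k) = M k" if k: "k \<in> {1..2*n}" for k
  proof -
    have "M (n + k) = M k" if "k \<in> T" using that T by (intro Mn) auto
    moreover have "M (k - n) = M k" if "k > n" "k - n \<in> T" using Mn[of "k - n"] that T by auto
    ultimately show ?thesis unfolding \<tau>_def by auto
  qed
  have eq: "PiM {1..2*n} (\<lambda>k. M (\<tau> k)) = PiM {1..2*n} M"
    by (rule PiM_cong[OF refl]) (rule M\<tau>)
  have d: "distr (PiM {1..2*n} M) (PiM {1..2*n} M) (\<lambda>z. \<lambda>k\<in>{1..2*n}. z (\<tau> k)) = PiM {1..2*n} M"
    using distr_PiM_reindex[where M=M, OF M inj, of "{1..2*n}"] range unfolding eq by blast
  show meas: "(\<lambda>z. \<lambda>k\<in>{1..2*n}. z (\<tau> k)) \<in> PiM {1..2*n} M \<rightarrow>\<^sub>M PiM {1..2*n} M"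
    by (rule measurable_restrict)
       (metis M\<tau> range measurable_component_singleton)
  show "(\<integral>\<^sup>+z. F (\<lambda>k\<in>{1..2*n}. z (\<tau> k)) \<partial>PiM {1..2*n} M) = (\<integral>\<^sup>+z. F z \<partial>PiM {1..2*n} M)"
    using nn_integral_distr[OF meas, of F] unfolding d by (simp only: F measurable_distr_eq1)
qed

text \<open>
  The supremum is replaced by a sum over one representative for each value of \<open>code\<close>, to each
  summand of which the bound for a single function applies.  Indices of equal code are within \<open>\<eta>\<close> at
  every point, and \<open>B\<close> controls how far this moves the squares.
\<close>

lemma sum_signs_SUP_le:
  fixes u v :: "'i \<Rightarrow> nat \<Rightarrow> real" and code :: "'i \<Rightarrow> 'c"
  assumes c: "0 \<le> c" "c \<le> 1" and B: "0 \<le> B" "\<And>j i. j \<in> J \<Longrightarrow> i \<in> {1..n} \<Longrightarrow> \<bar>u j i\<bar> \<le> B \<and> \<bar>v j i\<bar> \<le> B"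
    and code: "finite (code ` J)" "card (code ` J) \<le> N"
    and close: "\<And>j j' i. j \<in> J \<Longrightarrow> j' \<in> J \<Longrightarrow> code j = code j' \<Longrightarrow> i \<in> {1..n} \<Longrightarrow>
        \<bar>u j i - u j' i\<bar> \<le> \<eta> \<and> \<bar>v j i - v j' i\<bar> \<le> \<eta>"
  shows "(\<Sum>T\<in>Pow {1..n}. SUP j\<in>J. ennreal (exp (c * (\<Sum>i=1..n. (if i \<in> T then v j i - u j i else u j i - v j i) - c * ((u j i)\<^sup>2 + (v j i)\<^sup>2)))))
     \<le> ennreal (2 ^ n * (real N * exp (c * (real n * (\<eta> * (2 + 4 * B))))))"
proof -
  define D where "D T j = (\<Sum>i=1..n. (if i \<in> T then v j i - u j i else u j i - v j i) - c * ((u j i)\<^sup>2 + (v j i)\<^sup>2))" for T j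
  define err where "err = real n * (\<eta> * (2 + 4 * B))"
  define rep where "rep y = (SOME j. j \<in> J \<and> code j = y)" for y
  define R where "R = rep ` code ` J"
  have rep: "rep (code j) \<in> J \<and> code (rep (code j)) = code j" if "j \<in> J" for j
    unfolding rep_def by (rule someI[of _ j]) (use that in auto)
  have R: "finite R" "card R \<le> N" "R \<subseteq> J"
    using code rep by (auto simp: R_def intro: order_trans[OF card_image_le])
  have Dle: "D T j \<le> D T r + err" if jr: "j \<in> J" "r \<in> J" "code j = code r" for T j r
  proof -
    have sq: "b\<^sup>2 - a\<^sup>2 \<le> \<eta> * (2 * B)" if "\<bar>a - b\<bar> \<le> \<eta>" "\<bar>a\<bar> \<le> B" "\<bar>b\<bar> \<le> B" for a b
    proof -
      have "b\<^sup>2 - a\<^sup>2 = (b - a) * (b + a)" by (simp add: power2_eq_square algebra_simps)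
      also have "\<dots> \<le> \<bar>b - a\<bar> * \<bar>b + a\<bar>" by (metis abs_ge_self abs_mult)
      also have "\<dots> \<le> \<eta> * (2 * B)" using that by (intro mult_mono) auto
      finally show ?thesis .
    qed
    have "D T j \<le> (\<Sum>i=1..n. ((if i \<in> T then v r i - u r i else u r i - v r i) - c * ((u r i)\<^sup>2 + (v r i)\<^sup>2)) + \<eta> * (2 + 4 * B))"
      unfolding D_def
    proof (rule sum_mono)
      fix i assume i: "i \<in> {1..n}"
      have cl: "\<bar>u j i - u r i\<bar> \<le> \<eta>" "\<bar>v j i - v r i\<bar> \<le> \<eta>" using close[OF jr i] by auto
      have "(u r i)\<^sup>2 - (u j i)\<^sup>2 \<le> \<eta> * (2 * B)" "(v r i)\<^sup>2 - (v j i)\<^sup>2 \<le> \<eta> * (2 * B)"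
        using sq cl B(2)[OF jr(1) i] B(2)[OF jr(2) i] by auto
      then have "((u r i)\<^sup>2 + (v r i)\<^sup>2) - ((u j i)\<^sup>2 + (v j i)\<^sup>2) \<le> \<eta> * (4 * B)" by simp
      then have "c * (((u r i)\<^sup>2 + (v r i)\<^sup>2) - ((u j i)\<^sup>2 + (v j i)\<^sup>2)) \<le> c * (\<eta> * (4 * B))"
        by (rule mult_left_mono) (rule c)
      also have "\<dots> \<le> 1 * (\<eta> * (4 * B))" using cl c B(1) by (intro mult_right_mono) auto
      finally have "- (c * ((u j i)\<^sup>2 + (v j i)\<^sup>2)) \<le> - (c * ((u r i)\<^sup>2 + (v r i)\<^sup>2)) + \<eta> * (4 * B)"
        by (simp add: algebra_simps)
      moreover have "(if i \<in> T then v j i - u j i else u j i - v j i)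
          \<le> (if i \<in> T then v r i - u r i else u r i - v r i) + 2 * \<eta>"
        using cl by auto
      ultimately show "(if i \<in> T then v j i - u j i else u j i - v j i) - c * ((u j i)\<^sup>2 + (v j i)\<^sup>2)
        \<le> ((if i \<in> T then v r i - u r i else u r i - v r i) - c * ((u r i)\<^sup>2 + (v r i)\<^sup>2)) + \<eta> * (2 + 4 * B)"
        by (simp add: algebra_simps)
    qed
    also have "\<dots> = D T r + err" by (simp add: D_def err_def sum.distrib)
    finally show ?thesis .
  qed
  have SUP: "(SUP j\<in>J. ennreal (exp (c * D T j))) \<le> (\<Sum>r\<in>R. ennreal (exp (c * D T r) * exp (c * err)))" for T
  proof (rule SUP_least)
    fix j assume j: "j \<in> J"
    have rR: "rep (code j) \<in> R" using j by (auto simp: R_def)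
    have "D T j \<le> D T (rep (code j)) + err" using rep[OF j] j by (intro Dle) auto
    then have "c * D T j \<le> c * D T (rep (code j)) + c * err"
      using mult_left_mono[OF _ c(1)] by (metis distrib_left)
    then have "ennreal (exp (c * D T j)) \<le> ennreal (exp (c * D T (rep (code j))) * exp (c * err))"
      by (intro ennreal_leI) (simp flip: exp_add)
    also have "\<dots> \<le> (\<Sum>r\<in>R. ennreal (exp (c * D T r) * exp (c * err)))"
      by (rule member_le_sum[OF rR]) (use R in auto)
    finally show "ennreal (exp (c * D T j)) \<le> (\<Sum>r\<in>R. ennreal (exp (c * D T r) * exp (c * err)))" .
  qed
  have "(\<Sum>T\<in>Pow {1..n}. SUP j\<in>J. ennreal (exp (c * D T j)))
      \<le> (\<Sum>T\<in>Pow {1..n}. \<Sum>r\<in>R. ennreal (exp (c * D T r) * exp (c * err)))"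
    by (rule sum_mono) (rule SUP)
  also have "\<dots> = ennreal (\<Sum>T\<in>Pow {1..n}. \<Sum>r\<in>R. exp (c * D T r) * exp (c * err))"
    by (simp add: sum_nonneg)
  also have "(\<Sum>T\<in>Pow {1..n}. \<Sum>r\<in>R. exp (c * D T r) * exp (c * err))
      = (\<Sum>r\<in>R. (\<Sum>T\<in>Pow {1..n}. exp (c * D T r)) * exp (c * err))"
    by (subst sum.swap) (simp add: sum_distrib_right)
  also have "ennreal \<dots> \<le> ennreal (\<Sum>r\<in>R. 2 ^ n * exp (c * err))"
  proof (intro ennreal_leI sum_mono mult_right_mono)
    fix r
    show "(\<Sum>T\<in>Pow {1..n}. exp (c * D T r)) \<le> 2 ^ n"
      unfolding D_def using sum_signs_exp_le[of "{1..n}" c "v r" "u r"] c by simp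
  qed simp
  also have "\<dots> \<le> ennreal (2 ^ n * (real N * exp (c * err)))"
    using R by (intro ennreal_leI) (simp add: mult_right_mono)
  finally show ?thesis unfolding D_def err_def .
qed

text \<open>
  Jensen's inequality for \<open>exp\<close>, in the form needed under a nonnegative integral.
\<close>

lemma (in prob_space) exp_expectation_le:
  assumes "Y \<in> borel_measurable M" "\<And>x. x \<in> space M \<Longrightarrow> \<bar>Y x\<bar> \<le> b"
  shows "ennreal (exp (expectation Y)) \<le> (\<integral>\<^sup>+x. ennreal (exp (Y x)) \<partial>M)"
proof -
  note [measurable] = assms(1)
  have iY: "integrable M Y"
    by (rule integrable_const_bound[of _ b]) (use assms in auto)
  have iE: "integrable M (\<lambda>x. exp (Y x))"
    by (rule integrable_const_bound[of _ "exp b"]) (use assms(2) in \<open>auto simp: abs_le_iff\<close>)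
  define m where "m = expectation Y"
  have "exp m = expectation (\<lambda>x. exp m * (1 + (Y x - m)))"
    using iY by (simp add: m_def prob_space)
  also have "\<dots> \<le> expectation (\<lambda>x. exp (Y x))"
  proof (rule integral_mono[OF _ iE])
    fix x
    have "exp m * (1 + (Y x - m)) \<le> exp m * exp (Y x - m)"
      by (intro mult_left_mono exp_ge_add_one_self) auto
    then show "exp m * (1 + (Y x - m)) \<le> exp (Y x)" by (simp flip: exp_add)
  qed (use iY in auto)
  finally show ?thesis
    using iE by (simp add: nn_integral_eq_integral m_def ennreal_leI)
qed

text \<open>
  The penalty \<open>c (\<phi>\<^sup>2 + E \<phi>\<^sup>2)\<close> makes the supremum exponentially integrable without any
  truncation or peeling.  By Jensen's inequality the expectations may be replaced by a ghost sample
  outside the exponential; then the integral is invariant under exchanging paired coordinates, and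
  its average over all exchanges is bounded pointwise.
\<close>

lemma exp_moment_symmetrization:
  fixes P :: "nat \<Rightarrow> 'a measure" and \<phi> :: "'i \<Rightarrow> 'a \<Rightarrow> real"
  assumes P: "\<And>i. prob_space (P i)"
    and J: "countable J"
    and meas: "\<And>j i. j \<in> J \<Longrightarrow> \<phi> j \<in> borel_measurable (P i)"
    and bounded: "\<And>j i x. j \<in> J \<Longrightarrow> x \<in> space (P i) \<Longrightarrow> \<bar>\<phi> j x\<bar> \<le> B"
    and c: "0 \<le> c" "c \<le> 1" and B: "0 \<le> B"
    and code: "\<And>z. (\<And>i. i \<in> {1..n} \<Longrightarrow> z i \<in> space (P i) \<and> z (n + i) \<in> space (P i)) \<Longrightarrow>
        \<exists>code :: 'i \<Rightarrow> 'c. finite (code ` J) \<and> card (code ` J) \<le> N \<and>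
          (\<forall>j\<in>J. \<forall>j'\<in>J. code j = code j' \<longrightarrow> (\<forall>k\<in>{1..2*n}. \<bar>\<phi> j (z k) - \<phi> j' (z k)\<bar> \<le> \<eta>))"
  shows "(\<integral>\<^sup>+x. (SUP j\<in>J. ennreal (exp (c * (\<Sum>i=1..n. \<phi> j (x i) - (\<integral>y. \<phi> j y \<partial>P i)
              - c * ((\<phi> j (x i))\<^sup>2 + (\<integral>y. (\<phi> j y)\<^sup>2 \<partial>P i)))))) \<partial>PiM {1..n} P)
      \<le> ennreal (real N * exp (c * (real n * (\<eta> * (2 + 4 * B)))))"
proof -
  define M where "M k = (if k \<le> n then P k else P (k - n))" for k
  have M: "prob_space (M k)" for k using P by (simp add: M_def)
  have Mn: "M (n + i) = M i" if "i \<in> {1..n}" for i using that by (auto simp: M_def)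
  have measM: "\<phi> j \<in> borel_measurable (M k)" if "j \<in> J" for j k using meas that by (simp add: M_def)
  have bM: "\<bar>\<phi> j x\<bar> \<le> B" if "j \<in> J" "x \<in> space (M k)" for j k x
    using bounded that by (auto simp: M_def split: if_splits)
  interpret product_prob_space M
    by (simp add: M product_prob_space_def product_prob_space_axioms_def product_sigma_finite_def
        prob_space_imp_sigma_finite)
  define I' where "I' = {n+1..2*n}"
  have un: "{1..2*n} = {1..n} \<union> I'" and dis: "{1..n} \<inter> I' = {}" by (auto simp: I'_def)
  have PiP: "PiM {1..n} P = PiM {1..n} M" by (rule PiM_cong) (auto simp: M_def)
  let ?D = "\<lambda>j z. \<Sum>i=1..n. \<phi> j (z i) - \<phi> j (z (n + i)) - c * ((\<phi> j (z i))\<^sup>2 + (\<phi> j (z (n + i)))\<^sup>2)"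
  define H where "H z = (SUP j\<in>J. ennreal (exp (c * ?D j z)))" for z
  have comp: "(\<lambda>z. \<phi> j (z k)) \<in> borel_measurable (PiM K M)" if "j \<in> J" "k \<in> K" for j k K
    using measurable_compose[OF measurable_component_singleton[OF that(2)] measM[OF that(1)]] .
  have H_meas: "H \<in> borel_measurable (PiM {1..2*n} M)"
    unfolding H_def
    by (intro borel_measurable_SUP J measurable_compose[OF _ measurable_ennreal] measurable_compose[OF _ borel_measurable_exp]
        borel_measurable_times borel_measurable_sum borel_measurable_diff borel_measurable_add borel_measurable_power comp) auto
  \<comment> \<open>The coordinates in \<open>I'\<close> form the ghost sample; integrating the exponent in \<open>H\<close> over them gives the
    exponent on the left.\<close>
  have jensen: "(SUP j\<in>J. ennreal (exp (c * (\<Sum>i=1..n. \<phi> j (x i) - (\<integral>y. \<phi> j y \<partial>P i)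
              - c * ((\<phi> j (x i))\<^sup>2 + (\<integral>y. (\<phi> j y)\<^sup>2 \<partial>P i))))))
      \<le> (\<integral>\<^sup>+y. H (merge {1..n} I' (x, y)) \<partial>PiM I' M)" if x: "x \<in> space (PiM {1..n} M)" for x
  proof (rule SUP_least)
    fix j assume j: "j \<in> J"
    interpret G: prob_space "PiM I' M" by (rule prob_space_PiM) (rule M)
    let ?Y = "\<lambda>y. c * (\<Sum>i=1..n. \<phi> j (x i) - \<phi> j (y (n + i)) - c * ((\<phi> j (x i))\<^sup>2 + (\<phi> j (y (n + i)))\<^sup>2))"
    have sp: "y k \<in> space (M k)" if "y \<in> space (PiM K M)" "k \<in> K" for y k K
      using that by (auto simp: space_PiM)
    have int: "integrable (PiM I' M) (\<lambda>y. \<phi> j (y (n + i)))" "integrable (PiM I' M) (\<lambda>y. (\<phi> j (y (n + i)))\<^sup>2)"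
      and int_eq: "(\<integral>y. \<phi> j (y (n + i)) \<partial>PiM I' M) = (\<integral>y. \<phi> j y \<partial>P i)"
        "(\<integral>y. (\<phi> j (y (n + i)))\<^sup>2 \<partial>PiM I' M) = (\<integral>y. (\<phi> j y)\<^sup>2 \<partial>P i)" if i: "i \<in> {1..n}" for i
    proof -
      have iI: "n + i \<in> I'" using i by (auto simp: I'_def)
      have Mi: "M (n + i) = P i" using i by (auto simp: M_def)
      have d: "distr (PiM I' M) (M (n + i)) (\<lambda>\<omega>. \<omega> (n + i)) = M (n + i)"
        by (rule distr_PiM_component[OF M iI])
      show "integrable (PiM I' M) (\<lambda>y. \<phi> j (y (n + i)))"
        by (rule G.integrable_const_bound[of _ B]) (use comp[OF j iI] bM[OF j sp[OF _ iI]] in auto)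
      have "\<bar>(\<phi> j (y (n + i)))\<^sup>2\<bar> \<le> B\<^sup>2" if "y \<in> space (PiM I' M)" for y
        using bM[OF j sp[OF that iI]] power_mono[of "\<bar>\<phi> j (y (n + i))\<bar>" B 2] by simp
      then show "integrable (PiM I' M) (\<lambda>y. (\<phi> j (y (n + i)))\<^sup>2)"
        by (intro G.integrable_const_bound[of _ "B\<^sup>2"] borel_measurable_power comp[OF j iI]) auto
      show "(\<integral>y. \<phi> j (y (n + i)) \<partial>PiM I' M) = (\<integral>y. \<phi> j y \<partial>P i)"
        unfolding Mi[symmetric]
        using integral_distr[OF measurable_component_singleton[where M=M, OF iI] measM[OF j]] unfolding d by (rule sym)
      show "(\<integral>y. (\<phi> j (y (n + i)))\<^sup>2 \<partial>PiM I' M) = (\<integral>y. (\<phi> j y)\<^sup>2 \<partial>P i)"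
        unfolding Mi[symmetric]
        using integral_distr[OF measurable_component_singleton[where M=M, OF iI] borel_measurable_power[OF measM[OF j], of 2]]
        unfolding d by (rule sym)
    qed
    have Ymeas: "?Y \<in> borel_measurable (PiM I' M)"
      by (intro borel_measurable_times borel_measurable_sum borel_measurable_diff borel_measurable_add
          borel_measurable_power borel_measurable_const comp[OF j]) (auto simp: I'_def)
    have Ybd: "\<bar>?Y y\<bar> \<le> c * (\<Sum>i=1..n. B + B + c * (B\<^sup>2 + B\<^sup>2))" if y: "y \<in> space (PiM I' M)" for y
    proof -
      have "\<bar>\<phi> j (x i) - \<phi> j (y (n + i)) - c * ((\<phi> j (x i))\<^sup>2 + (\<phi> j (y (n + i)))\<^sup>2)\<bar> \<le> B + B + c * (B\<^sup>2 + B\<^sup>2)"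
        if i: "i \<in> {1..n}" for i
      proof -
        have b: "\<bar>\<phi> j (x i)\<bar> \<le> B" "\<bar>\<phi> j (y (n + i))\<bar> \<le> B"
          using bM[OF j sp[OF x i]] bM[OF j sp[OF y, of "n + i"]] i by (auto simp: I'_def)
        then have "(\<phi> j (x i))\<^sup>2 \<le> B\<^sup>2" "(\<phi> j (y (n + i)))\<^sup>2 \<le> B\<^sup>2"
          using power_mono[of "\<bar>\<phi> j (x i)\<bar>" B 2] power_mono[of "\<bar>\<phi> j (y (n + i))\<bar>" B 2] by auto
        then have "c * ((\<phi> j (x i))\<^sup>2 + (\<phi> j (y (n + i)))\<^sup>2) \<le> c * (B\<^sup>2 + B\<^sup>2)"
          by (intro mult_left_mono c) auto
        moreover have "0 \<le> c * ((\<phi> j (x i))\<^sup>2 + (\<phi> j (y (n + i)))\<^sup>2)" using c by simp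
        ultimately show ?thesis using b by linarith
      qed
      then have "\<bar>\<Sum>i=1..n. \<phi> j (x i) - \<phi> j (y (n + i)) - c * ((\<phi> j (x i))\<^sup>2 + (\<phi> j (y (n + i)))\<^sup>2)\<bar>
          \<le> (\<Sum>i=1..n. B + B + c * (B\<^sup>2 + B\<^sup>2))"
        by (intro order_trans[OF sum_abs sum_mono])
      then show ?thesis
        unfolding abs_mult using c by (simp only: abs_of_nonneg mult_left_mono)
    qed
    have "(\<integral>y. ?Y y \<partial>PiM I' M) = c * (\<Sum>i=1..n. \<phi> j (x i) - (\<integral>y. \<phi> j y \<partial>P i)
              - c * ((\<phi> j (x i))\<^sup>2 + (\<integral>y. (\<phi> j y)\<^sup>2 \<partial>P i)))"
    proof -
      have "(\<integral>y. ?Y y \<partial>PiM I' M) = c * (\<Sum>i=1..n. \<integral>y. \<phi> j (x i) - \<phi> j (y (n + i)) - c * ((\<phi> j (x i))\<^sup>2 + (\<phi> j (y (n + i)))\<^sup>2) \<partial>PiM I' M)"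
        by (subst integral_mult_right_zero, subst Bochner_Integration.integral_sum) (use int in auto)
      also have "(\<Sum>i=1..n. \<integral>y. \<phi> j (x i) - \<phi> j (y (n + i)) - c * ((\<phi> j (x i))\<^sup>2 + (\<phi> j (y (n + i)))\<^sup>2) \<partial>PiM I' M)
          = (\<Sum>i=1..n. \<phi> j (x i) - (\<integral>y. \<phi> j y \<partial>P i) - c * ((\<phi> j (x i))\<^sup>2 + (\<integral>y. (\<phi> j y)\<^sup>2 \<partial>P i)))"
        by (rule sum.cong[OF refl]) (use int int_eq in \<open>simp add: G.prob_space\<close>)
      finally show ?thesis .
    qed
    then have "ennreal (exp (c * (\<Sum>i=1..n. \<phi> j (x i) - (\<integral>y. \<phi> j y \<partial>P i)
              - c * ((\<phi> j (x i))\<^sup>2 + (\<integral>y. (\<phi> j y)\<^sup>2 \<partial>P i))))) \<le> (\<integral>\<^sup>+y. ennreal (exp (?Y y)) \<partial>PiM I' M)"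
      using G.exp_expectation_le[OF Ymeas Ybd] by (simp only:)
    also have "\<dots> \<le> (\<integral>\<^sup>+y. H (merge {1..n} I' (x, y)) \<partial>PiM I' M)"
    proof (rule nn_integral_mono)
      fix y
      have "?D j (merge {1..n} I' (x, y)) = (\<Sum>i=1..n. \<phi> j (x i) - \<phi> j (y (n + i)) - c * ((\<phi> j (x i))\<^sup>2 + (\<phi> j (y (n + i)))\<^sup>2))"
        by (rule sum.cong[OF refl]) (auto simp: merge_def I'_def)
      then have "ennreal (exp (?Y y)) = ennreal (exp (c * ?D j (merge {1..n} I' (x, y))))" by simp
      also have "\<dots> \<le> H (merge {1..n} I' (x, y))" unfolding H_def by (rule SUP_upper[OF j])
      finally show "ennreal (exp (?Y y)) \<le> H (merge {1..n} I' (x, y))" .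
    qed
    finally show "ennreal (exp (c * (\<Sum>i=1..n. \<phi> j (x i) - (\<integral>y. \<phi> j y \<partial>P i)
              - c * ((\<phi> j (x i))\<^sup>2 + (\<integral>y. (\<phi> j y)\<^sup>2 \<partial>P i))))) \<le> (\<integral>\<^sup>+y. H (merge {1..n} I' (x, y)) \<partial>PiM I' M)" .
  qed
  define \<tau> where "\<tau> T k = (if k \<in> T then n + k else if k > n \<and> k - n \<in> T then k - n else k)" for T k
  let ?s = "\<lambda>T z. \<lambda>k\<in>{1..2*n}. z (\<tau> T k)"
  have swap: "(\<integral>\<^sup>+z. H (?s T z) \<partial>PiM {1..2*n} M) = (\<integral>\<^sup>+z. H z \<partial>PiM {1..2*n} M)"
    "?s T \<in> PiM {1..2*n} M \<rightarrow>\<^sub>M PiM {1..2*n} M" if "T \<in> Pow {1..n}" for T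
    using nn_integral_PiM_swap[of M n T H, OF M Mn _ H_meas] that unfolding \<tau>_def by auto
  have "2 ^ n * (\<integral>\<^sup>+z. H z \<partial>PiM {1..2*n} M) = (\<Sum>T\<in>Pow {1..n}. \<integral>\<^sup>+z. H (?s T z) \<partial>PiM {1..2*n} M)"
    using swap by (simp add: card_Pow)
  also have "\<dots> = (\<integral>\<^sup>+z. (\<Sum>T\<in>Pow {1..n}. H (?s T z)) \<partial>PiM {1..2*n} M)"
    by (rule nn_integral_sum[symmetric]) (rule measurable_compose[OF swap(2) H_meas])
  also have "\<dots> \<le> (\<integral>\<^sup>+z. ennreal (2 ^ n * (real N * exp (c * (real n * (\<eta> * (2 + 4 * B)))))) \<partial>PiM {1..2*n} M)"
  proof (rule nn_integral_mono)
    fix z assume z: "z \<in> space (PiM {1..2*n} M)"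
    have zP: "z i \<in> space (P i) \<and> z (n + i) \<in> space (P i)" if "i \<in> {1..n}" for i
    proof -
      have "z i \<in> space (M i)" "z (n + i) \<in> space (M (n + i))" using z that by (auto simp: space_PiM)
      then show ?thesis using that by (auto simp: M_def)
    qed
    from code[of z, OF zP] obtain code :: "'i \<Rightarrow> 'c" where code: "finite (code ` J)" "card (code ` J) \<le> N"
      "\<And>j j' k. j \<in> J \<Longrightarrow> j' \<in> J \<Longrightarrow> code j = code j' \<Longrightarrow> k \<in> {1..2*n} \<Longrightarrow> \<bar>\<phi> j (z k) - \<phi> j' (z k)\<bar> \<le> \<eta>"
      by blast
    have D: "?D j (?s T z) = (\<Sum>i=1..n. (if i \<in> T then \<phi> j (z (n + i)) - \<phi> j (z i) else \<phi> j (z i) - \<phi> j (z (n + i)))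
         - c * ((\<phi> j (z i))\<^sup>2 + (\<phi> j (z (n + i)))\<^sup>2))" if "T \<in> Pow {1..n}" for T j
      by (rule sum.cong[OF refl]) (use that in \<open>auto simp: \<tau>_def\<close>)
    have "(\<Sum>T\<in>Pow {1..n}. H (?s T z)) = (\<Sum>T\<in>Pow {1..n}. SUP j\<in>J. ennreal (exp (c *
       (\<Sum>i=1..n. (if i \<in> T then \<phi> j (z (n + i)) - \<phi> j (z i) else \<phi> j (z i) - \<phi> j (z (n + i)))
         - c * ((\<phi> j (z i))\<^sup>2 + (\<phi> j (z (n + i)))\<^sup>2)))))"
      unfolding H_def by (rule sum.cong[OF refl]) (simp only: D)
    also have "\<dots> \<le> ennreal (2 ^ n * (real N * exp (c * (real n * (\<eta> * (2 + 4 * B))))))"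
    proof (rule sum_signs_SUP_le[OF c B _ code(1,2), where u="\<lambda>j i. \<phi> j (z i)" and v="\<lambda>j i. \<phi> j (z (n + i))"])
      show "\<bar>\<phi> j (z i)\<bar> \<le> B \<and> \<bar>\<phi> j (z (n + i))\<bar> \<le> B" if "j \<in> J" "i \<in> {1..n}" for j i
        using bounded that zP by blast
      show "\<bar>\<phi> j (z i) - \<phi> j' (z i)\<bar> \<le> \<eta> \<and> \<bar>\<phi> j (z (n + i)) - \<phi> j' (z (n + i))\<bar> \<le> \<eta>"
        if "j \<in> J" "j' \<in> J" "code j = code j'" "i \<in> {1..n}" for j j' i
        using code(3)[OF that(1-3), of i] code(3)[OF that(1-3), of "n + i"] that(4) by auto
    qed
    finally show "(\<Sum>T\<in>Pow {1..n}. H (?s T z)) \<le> ennreal (2 ^ n * (real N * exp (c * (real n * (\<eta> * (2 + 4 * B))))))" .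
  qed
  also have "\<dots> = 2 ^ n * ennreal (real N * exp (c * (real n * (\<eta> * (2 + 4 * B)))))"
    using prob_space.emeasure_space_1[OF prob_space_PiM[of "{1..2*n}" M, OF M]]
    by (simp add: ennreal_mult' ennreal_power[symmetric])
  finally have le: "(\<integral>\<^sup>+z. H z \<partial>PiM {1..2*n} M) \<le> ennreal (real N * exp (c * (real n * (\<eta> * (2 + 4 * B)))))"
    by (subst (asm) ennreal_mult_le_mult_iff) (auto simp: power_eq_top_ennreal)
  have "(\<integral>\<^sup>+x. (SUP j\<in>J. ennreal (exp (c * (\<Sum>i=1..n. \<phi> j (x i) - (\<integral>y. \<phi> j y \<partial>P i)
              - c * ((\<phi> j (x i))\<^sup>2 + (\<integral>y. (\<phi> j y)\<^sup>2 \<partial>P i)))))) \<partial>PiM {1..n} M)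
      \<le> (\<integral>\<^sup>+x. \<integral>\<^sup>+y. H (merge {1..n} I' (x, y)) \<partial>PiM I' M \<partial>PiM {1..n} M)"
    by (rule nn_integral_mono) (rule jensen)
  also have "\<dots> = (\<integral>\<^sup>+z. H z \<partial>PiM {1..2*n} M)"
    unfolding un by (rule product_nn_integral_fold[symmetric, OF dis _ _ H_meas[unfolded un]])
      (auto simp: I'_def)
  also note le
  finally show ?thesis unfolding PiP .
qed

text \<open>
  Markov's inequality applied to the exponential moment.  The deviation is measured relative to the
  second moments of \<open>\<phi>\<close>, which is what yields the rate \<open>1/n\<close> instead of its square root.
\<close>

lemma uniform_deviation:
  fixes P :: "nat \<Rightarrow> 'a measure" and \<phi> :: "'i \<Rightarrow> 'a \<Rightarrow> real"
  assumes P: "\<And>i. prob_space (P i)"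
    and J: "countable J"
    and meas: "\<And>j i. j \<in> J \<Longrightarrow> \<phi> j \<in> borel_measurable (P i)"
    and bounded: "\<And>j i x. j \<in> J \<Longrightarrow> x \<in> space (P i) \<Longrightarrow> \<bar>\<phi> j x\<bar> \<le> B"
    and c: "0 < c" "c \<le> 1" and B: "0 \<le> B" and N: "0 < N"
    and code: "\<And>z. (\<And>i. i \<in> {1..n} \<Longrightarrow> z i \<in> space (P i) \<and> z (n + i) \<in> space (P i)) \<Longrightarrow>
        \<exists>code :: 'i \<Rightarrow> 'c. finite (code ` J) \<and> card (code ` J) \<le> N \<and>
          (\<forall>j\<in>J. \<forall>j'\<in>J. code j = code j' \<longrightarrow> (\<forall>k\<in>{1..2*n}. \<bar>\<phi> j (z k) - \<phi> j' (z k)\<bar> \<le> \<eta>))"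
  shows "\<exists>E\<in>sets (PiM {1..n} P). measure (PiM {1..n} P) E \<ge> 1 - exp (- \<xi>) \<and>
    (\<forall>x\<in>E. \<forall>j\<in>J. (\<Sum>i=1..n. \<phi> j (x i) - (\<integral>y. \<phi> j y \<partial>P i) - c * ((\<phi> j (x i))\<^sup>2 + (\<integral>y. (\<phi> j y)\<^sup>2 \<partial>P i)))
        \<le> real n * (\<eta> * (2 + 4 * B)) + (ln (real N) + \<xi>) / c)"
proof -
  interpret X: prob_space "PiM {1..n} P" by (rule prob_space_PiM) (rule P)
  let ?S = "\<lambda>j x. \<Sum>i=1..n. \<phi> j (x i) - (\<integral>y. \<phi> j y \<partial>P i) - c * ((\<phi> j (x i))\<^sup>2 + (\<integral>y. (\<phi> j y)\<^sup>2 \<partial>P i))"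
  define F where "F x = (SUP j\<in>J. ennreal (exp (c * ?S j x)))" for x
  have comp: "(\<lambda>z. \<phi> j (z k)) \<in> borel_measurable (PiM {1..n} P)" if "j \<in> J" "k \<in> {1..n}" for j k
    using measurable_compose[OF measurable_component_singleton[OF that(2)] meas[OF that(1)]] .
  have F_meas: "F \<in> borel_measurable (PiM {1..n} P)"
    unfolding F_def
    by (intro borel_measurable_SUP J measurable_compose[OF _ measurable_ennreal] measurable_compose[OF _ borel_measurable_exp]
        borel_measurable_times borel_measurable_sum borel_measurable_diff borel_measurable_add borel_measurable_power
        borel_measurable_const comp) auto
  define L where "L = c * (real n * (\<eta> * (2 + 4 * B))) + ln (real N) + \<xi>"
  have eL: "exp (- L) * (real N * exp (c * (real n * (\<eta> * (2 + 4 * B))))) = exp (- \<xi>)"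
    using N by (simp add: L_def exp_diff exp_add exp_minus field_simps)
  define E where "E = space (PiM {1..n} P) - {x \<in> space (PiM {1..n} P). 1 \<le> ennreal (exp (- L)) * F x}"
  have bad: "{x \<in> space (PiM {1..n} P). 1 \<le> ennreal (exp (- L)) * F x} \<in> sets (PiM {1..n} P)"
    using F_meas by measurable
  have E: "E \<in> sets (PiM {1..n} P)" unfolding E_def using bad by auto
  have "emeasure (PiM {1..n} P) {x \<in> space (PiM {1..n} P). 1 \<le> ennreal (exp (- L)) * F x}
      \<le> ennreal (exp (- L)) * (\<integral>\<^sup>+x. F x * indicator (space (PiM {1..n} P)) x \<partial>PiM {1..n} P)"
    by (rule nn_integral_Markov_inequality) (use F_meas in auto)
  also have "(\<integral>\<^sup>+x. F x * indicator (space (PiM {1..n} P)) x \<partial>PiM {1..n} P) = (\<integral>\<^sup>+x. F x \<partial>PiM {1..n} P)"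
    by (rule nn_integral_cong) simp
  also have "ennreal (exp (- L)) * (\<integral>\<^sup>+x. F x \<partial>PiM {1..n} P)
     \<le> ennreal (exp (- L)) * ennreal (real N * exp (c * (real n * (\<eta> * (2 + 4 * B)))))"
    unfolding F_def
    by (intro mult_left_mono exp_moment_symmetrization[OF P J meas bounded _ c(2) B code]) (use c in auto)
  also have "\<dots> = ennreal (exp (- \<xi>))" by (simp add: eL flip: ennreal_mult)
  finally have "measure (PiM {1..n} P) {x \<in> space (PiM {1..n} P). 1 \<le> ennreal (exp (- L)) * F x} \<le> exp (- \<xi>)"
    unfolding X.emeasure_eq_measure by simp
  then have "measure (PiM {1..n} P) E \<ge> 1 - exp (- \<xi>)"
    unfolding E_def using X.prob_compl[OF bad] by simp
  moreover have "?S j x \<le> real n * (\<eta> * (2 + 4 * B)) + (ln (real N) + \<xi>) / c" if x: "x \<in> E" and j: "j \<in> J" for x j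
  proof -
    have "ennreal (exp (- L)) * ennreal (exp (c * ?S j x)) \<le> ennreal (exp (- L)) * F x"
      unfolding F_def by (intro mult_left_mono SUP_upper j) auto
    also have "\<dots> < 1" using x by (auto simp: E_def not_le)
    finally have "ennreal (exp (c * ?S j x - L)) < 1"
      by (simp add: exp_diff exp_minus field_simps flip: ennreal_mult)
    then have "c * ?S j x < L" by simp
    then have "?S j x < L / c" using c by (simp add: field_simps)
    then show ?thesis using c by (simp add: L_def add_divide_distrib)
  qed
  ultimately show ?thesis using E by blast
qed

section \<open>Hellinger distance\<close>

lemma sets_sum_of_measures [simp]: "sets (sum_of_measures P Q) = sets P"
  and space_sum_of_measures [simp]: "space (sum_of_measures P Q) = space P"
  by (simp_all add: sum_of_measures_def sets.space_closed sets.sigma_sets_eq)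

lemma emeasure_sum_of_measures:
  assumes "sets Q = sets P" "E \<in> sets P"
  shows "emeasure (sum_of_measures P Q) E = emeasure P E + emeasure Q E"
proof (rule emeasure_measure_of[OF sum_of_measures_def])
  show "sets P \<subseteq> Pow (space P)" by (rule sets.space_closed)
  show "positive (sets (sum_of_measures P Q)) (\<lambda>E. emeasure P E + emeasure Q E)"
    by (simp add: positive_def)
  show "countably_additive (sets (sum_of_measures P Q)) (\<lambda>E. emeasure P E + emeasure Q E)"
  proof (rule countably_additiveI)
    fix A :: "nat \<Rightarrow> 'a set"
    assume A: "range A \<subseteq> sets (sum_of_measures P Q)" "disjoint_family A"
    then have "(\<Sum>i. emeasure P (A i) + emeasure Q (A i)) = (\<Sum>i. emeasure P (A i)) + (\<Sum>i. emeasure Q (A i))"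
      by (intro suminf_add[symmetric]) auto
    also have "\<dots> = emeasure P (\<Union>i. A i) + emeasure Q (\<Union>i. A i)"
      using A assms(1) by (simp add: suminf_emeasure)
    finally show "(\<Sum>i. emeasure P (A i) + emeasure Q (A i)) = emeasure P (\<Union>i. A i) + emeasure Q (\<Union>i. A i)" .
  qed
  show "E \<in> sets (sum_of_measures P Q)" using assms by simp
qed

lemma sigma_finite_sum_of_measures:
  assumes "sigma_finite_measure P" "finite_measure Q" "sets Q = sets P"
  shows "sigma_finite_measure (sum_of_measures P Q)"
proof -
  obtain A where A: "countable A" "A \<subseteq> sets P" "\<Union>A = space P" "\<forall>a\<in>A. emeasure P a \<noteq> \<infinity>"
    using sigma_finite_measure.sigma_finite_countable[OF assms(1)] by auto
  show ?thesis
  proof (standard, intro exI conjI)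
    show "\<forall>a\<in>A. emeasure (sum_of_measures P Q) a \<noteq> \<infinity>"
      using A assms(3) finite_measure.emeasure_finite[OF assms(2)]
      by (auto simp: emeasure_sum_of_measures subset_eq top_unique)
  qed (use A in auto)
qed

lemma ex_real_density:
  assumes "sigma_finite_measure \<nu>" "sigma_finite_measure N" "absolutely_continuous \<nu> N" "sets N = sets \<nu>"
  shows "\<exists>h::'a \<Rightarrow> real. h \<in> borel_measurable \<nu> \<and> (\<forall>x. 0 \<le> h x) \<and> N = density \<nu> (\<lambda>x. ennreal (h x))"
proof (intro exI conjI allI)
  interpret sigma_finite_measure \<nu> by fact
  let ?h = "\<lambda>x. enn2real (RN_deriv \<nu> N x)"
  show "?h \<in> borel_measurable \<nu>" by measurable
  have "density \<nu> (\<lambda>x. ennreal (?h x)) = density \<nu> (RN_deriv \<nu> N)"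
  proof (rule density_cong)
    show "AE x in \<nu>. ennreal (?h x) = RN_deriv \<nu> N x"
      using RN_deriv_finite[OF assms(2-4)] by eventually_elim (auto simp: less_top)
  qed auto
  also have "\<dots> = N" by (rule density_RN_deriv[OF assms(3,4)])
  finally show "N = density \<nu> (\<lambda>x. ennreal (?h x))" ..
qed simp

text \<open>
  The law of an observation need not have a density with respect to \<open>\<mu>\<close>.  Hellinger distances to
  members of the model are therefore computed with respect to the sum of the two measures.
\<close>

lemma obtain_dominating:
  assumes "sigma_finite_measure \<mu>" "finite_measure P" "sets P = sets \<mu>"
  obtains \<nu> and m p :: "'a \<Rightarrow> real" where "sigma_finite_measure \<nu>" "sets \<nu> = sets \<mu>"
    "m \<in> borel_measurable \<nu>" "p \<in> borel_measurable \<nu>" "\<forall>x. 0 \<le> m x" "\<forall>x. 0 \<le> p x"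
    "\<mu> = density \<nu> (\<lambda>x. ennreal (m x))" "P = density \<nu> (\<lambda>x. ennreal (p x))"
proof -
  let ?\<nu> = "sum_of_measures \<mu> P"
  have \<nu>: "sigma_finite_measure ?\<nu>" by (rule sigma_finite_sum_of_measures[OF assms])
  have "absolutely_continuous ?\<nu> \<mu>" "absolutely_continuous ?\<nu> P"
    using assms(3) by (auto simp: absolutely_continuous_def null_sets_def emeasure_sum_of_measures)
  then obtain m p :: "'a \<Rightarrow> real" where
    "m \<in> borel_measurable ?\<nu>" "\<forall>x. 0 \<le> m x" "\<mu> = density ?\<nu> (\<lambda>x. ennreal (m x))"
    "p \<in> borel_measurable ?\<nu>" "\<forall>x. 0 \<le> p x" "P = density ?\<nu> (\<lambda>x. ennreal (p x))"
    using ex_real_density[OF \<nu> assms(1)] ex_real_density[OF \<nu> finite_measure.sigma_finite_measure[OF assms(2)]]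
      assms(3) by auto
  then show thesis using \<nu> by (intro that[of ?\<nu> m p]) auto
qed

lemma sqrt_diff_sq_le: "0 \<le> a \<Longrightarrow> 0 \<le> b \<Longrightarrow> (sqrt a - sqrt b)\<^sup>2 \<le> a + b"
  by (simp add: power2_diff)

lemma integrable_sqrt_diff_sq:
  fixes f g :: "'a \<Rightarrow> real"
  assumes "integrable M f" "integrable M g" "\<And>x. 0 \<le> f x" "\<And>x. 0 \<le> g x"
  shows "integrable M (\<lambda>x. (sqrt (f x) - sqrt (g x))\<^sup>2)"
  by (rule Bochner_Integration.integrable_bound[where f="\<lambda>x. f x + g x"])
     (use assms in \<open>auto simp: sqrt_diff_sq_le\<close>)

lemma density_prob_integral:
  fixes f :: "'a \<Rightarrow> real"
  assumes "f \<in> borel_measurable \<nu>" "\<And>x. 0 \<le> f x" "prob_space (density \<nu> (\<lambda>x. ennreal (f x)))"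
  shows "integrable \<nu> f" "(\<integral>x. f x \<partial>\<nu>) = 1"
proof -
  have "(\<integral>\<^sup>+x. ennreal (f x) \<partial>\<nu>) = 1"
    using prob_space.emeasure_space_1[OF assms(3)] assms(1)
    by (simp add: emeasure_density cong: nn_integral_cong)
  then show "integrable \<nu> f" "(\<integral>x. f x \<partial>\<nu>) = 1"
    using assms by (auto simp: integrable_iff_bounded integral_eq_nn_integral)
qed

lemma obtain_common_densities:
  assumes "prob_space P" "prob_space Q" "prob_space R" "sets Q = sets P" "sets R = sets P"
  obtains \<nu> and p q r :: "'a \<Rightarrow> real" where "sigma_finite_measure \<nu>"
    "p \<in> borel_measurable \<nu>" "q \<in> borel_measurable \<nu>" "r \<in> borel_measurable \<nu>"
    "\<forall>x. 0 \<le> p x" "\<forall>x. 0 \<le> q x" "\<forall>x. 0 \<le> r x"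
    "P = density \<nu> (\<lambda>x. ennreal (p x))" "Q = density \<nu> (\<lambda>x. ennreal (q x))" "R = density \<nu> (\<lambda>x. ennreal (r x))"
proof -
  obtain \<nu>1 and p1 q1 :: "'a \<Rightarrow> real" where 1: "sigma_finite_measure \<nu>1" "sets \<nu>1 = sets P"
    "p1 \<in> borel_measurable \<nu>1" "q1 \<in> borel_measurable \<nu>1" "\<forall>x. 0 \<le> p1 x" "\<forall>x. 0 \<le> q1 x"
    "P = density \<nu>1 (\<lambda>x. ennreal (p1 x))" "Q = density \<nu>1 (\<lambda>x. ennreal (q1 x))"
    by (rule obtain_dominating[OF finite_measure.sigma_finite_measure[OF prob_space.finite_measure[OF assms(1)]]
          prob_space.finite_measure[OF assms(2)] assms(4)])
  obtain \<nu> and m r :: "'a \<Rightarrow> real" where 2: "sigma_finite_measure \<nu>" "sets \<nu> = sets \<nu>1"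
    "m \<in> borel_measurable \<nu>" "r \<in> borel_measurable \<nu>" "\<forall>x. 0 \<le> m x" "\<forall>x. 0 \<le> r x"
    "\<nu>1 = density \<nu> (\<lambda>x. ennreal (m x))" "R = density \<nu> (\<lambda>x. ennreal (r x))"
    by (rule obtain_dominating[OF 1(1) prob_space.finite_measure[OF assms(3)] assms(5)[folded 1(2)]])
  have [measurable]: "p1 \<in> borel_measurable \<nu>" "q1 \<in> borel_measurable \<nu>" "m \<in> borel_measurable \<nu>"
    using 1(3,4) 2(3) unfolding measurable_cong_sets[OF 2(2) refl] by auto
  have "density \<nu>1 (\<lambda>x. ennreal (h x)) = density \<nu> (\<lambda>x. ennreal (m x * h x))"
    if [measurable]: "h \<in> borel_measurable \<nu>" for h :: "'a \<Rightarrow> real"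
    unfolding 2(7) by (subst density_density_eq) (auto simp: ennreal_mult' 2(5))
  then have PQ: "P = density \<nu> (\<lambda>x. ennreal (m x * p1 x))" "Q = density \<nu> (\<lambda>x. ennreal (m x * q1 x))"
    unfolding 1(7,8) by simp_all
  show thesis
    by (rule that[OF 2(1) _ _ 2(4) _ _ 2(6) PQ 2(8)]) (use 1(5,6) 2(5) in auto)
qed

lemma hellinger_sq_nonneg: "0 \<le> hellinger_sq P Q"
  by (simp add: hellinger_sq_def Let_def)

lemma hellinger_sq_commute:
  assumes "prob_space P" "prob_space Q" "sets Q = sets P"
  shows "hellinger_sq P Q = hellinger_sq Q P"
proof -
  obtain \<nu> and p q r :: "'a \<Rightarrow> real" where "sigma_finite_measure \<nu>"
    "p \<in> borel_measurable \<nu>" "q \<in> borel_measurable \<nu>" "r \<in> borel_measurable \<nu>"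
    "\<forall>x. 0 \<le> p x" "\<forall>x. 0 \<le> q x" "\<forall>x. 0 \<le> r x"
    "P = density \<nu> (\<lambda>x. ennreal (p x))" "Q = density \<nu> (\<lambda>x. ennreal (q x))" "Q = density \<nu> (\<lambda>x. ennreal (r x))"
    by (rule obtain_common_densities[OF assms(1,2,2,3,3)])
  then show ?thesis by (simp add: hellinger_sq_density power2_commute)
qed

lemma hellinger_sq_triangle:
  assumes "prob_space P" "prob_space Q" "prob_space R" "sets Q = sets P" "sets R = sets P"
  shows "hellinger_sq P R \<le> 2 * hellinger_sq P Q + 2 * hellinger_sq Q R"
proof -
  obtain \<nu> and p q r :: "'a \<Rightarrow> real" where *: "sigma_finite_measure \<nu>"
    "p \<in> borel_measurable \<nu>" "q \<in> borel_measurable \<nu>" "r \<in> borel_measurable \<nu>"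
    "\<forall>x. 0 \<le> p x" "\<forall>x. 0 \<le> q x" "\<forall>x. 0 \<le> r x"
    "P = density \<nu> (\<lambda>x. ennreal (p x))" "Q = density \<nu> (\<lambda>x. ennreal (q x))" "R = density \<nu> (\<lambda>x. ennreal (r x))"
    by (rule obtain_common_densities[OF assms])
  have int: "integrable \<nu> p" "integrable \<nu> q" "integrable \<nu> r"
    using density_prob_integral(1)[OF *(2)] density_prob_integral(1)[OF *(3)] density_prob_integral(1)[OF *(4)]
      *(5-7) assms(1-3)[unfolded *(8-10)] by blast+
  have int2: "integrable \<nu> (\<lambda>x. (sqrt (p x) - sqrt (r x))\<^sup>2)" "integrable \<nu> (\<lambda>x. (sqrt (p x) - sqrt (q x))\<^sup>2)"
    "integrable \<nu> (\<lambda>x. (sqrt (q x) - sqrt (r x))\<^sup>2)"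
    using int *(5-7) by (blast intro: integrable_sqrt_diff_sq)+
  have "(\<integral>x. (sqrt (p x) - sqrt (r x))\<^sup>2 \<partial>\<nu>)
     \<le> (\<integral>x. 2 * (sqrt (p x) - sqrt (q x))\<^sup>2 + 2 * (sqrt (q x) - sqrt (r x))\<^sup>2 \<partial>\<nu>)"
  proof (rule integral_mono)
    fix x
    have "(u - w)\<^sup>2 \<le> 2 * (u - v)\<^sup>2 + 2 * (v - w)\<^sup>2" for u v w :: real
      using zero_le_power2[of "(u - v) - (v - w)"] by (simp add: power2_eq_square algebra_simps)
    then show "(sqrt (p x) - sqrt (r x))\<^sup>2 \<le> 2 * (sqrt (p x) - sqrt (q x))\<^sup>2 + 2 * (sqrt (q x) - sqrt (r x))\<^sup>2" .
  qed (use int2 in auto)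
  also have "\<dots> = 2 * (\<integral>x. (sqrt (p x) - sqrt (q x))\<^sup>2 \<partial>\<nu>) + 2 * (\<integral>x. (sqrt (q x) - sqrt (r x))\<^sup>2 \<partial>\<nu>)"
    using int2 by simp
  finally show ?thesis unfolding *(8-10) using *(1-7) by (simp add: hellinger_sq_density)
qed


section \<open>The statistic of the \<open>\<rho>\<close>-estimator\<close>

text \<open>
  \<open>\<psi>(sqrt (a / b))\<close>; with \<open>0 / 0 = 0\<close> the quotient has the prescribed values also where \<open>b\<close>, or both
  \<open>a\<close> and \<open>b\<close>, vanish.
\<close>

definition psi_ratio :: "real \<Rightarrow> real \<Rightarrow> real" where
  "psi_ratio a b = (sqrt a - sqrt b) / (sqrt a + sqrt b)"

lemma abs_psi_ratio_le: "0 \<le> a \<Longrightarrow> 0 \<le> b \<Longrightarrow> \<bar>psi_ratio a b\<bar> \<le> 1"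
  unfolding psi_ratio_def abs_divide by (rule divide_le_eq_1[THEN iffD2]) (auto simp: abs_le_iff)

lemma psi_ratio_commute: "psi_ratio b a = - psi_ratio a b"
  by (simp add: psi_ratio_def add.commute minus_divide_left)

lemma rho_psi_eq:
  assumes "0 \<le> a" "0 \<le> b"
  shows "rho_psi (sqrt_ratio a b) = psi_ratio a b"
proof (cases "b = 0")
  case False
  then have "sqrt b > 0" using assms by simp
  then have "(sqrt a / sqrt b - 1) / (sqrt a / sqrt b + 1) = (sqrt a - sqrt b) / (sqrt a + sqrt b)"
    using assms by (simp add: divide_simps add_nonneg_eq_0_iff)
  then show ?thesis using False by (simp add: rho_psi_def sqrt_ratio_def psi_ratio_def real_sqrt_divide)
qed (auto simp: rho_psi_def sqrt_ratio_def psi_ratio_def)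

text \<open>
  With \<open>s\<close>, \<open>a\<close>, \<open>b\<close> the square roots of the densities of \<open>P\<close>, \<open>Q\<close>, \<open>Q'\<close> and \<open>g\<close> the value of \<open>\<psi>\<close>, one has
  \<open>g (a + b) = b - a\<close>.  Hence \<open>g s\<^sup>2\<close> equals \<open>g (s - (a + b)/2)\<^sup>2 + (b - a) (s - (a + b)/4)\<close>.  The last term
  integrates to \<open>h\<^sup>2(P, Q) - h\<^sup>2(P, Q')\<close>, as \<open>a\<^sup>2\<close> and \<open>b\<^sup>2\<close> have the same integral; in the first,
  \<open>s - (a + b)/2\<close> is the mean of \<open>s - a\<close> and \<open>s - b\<close>, and unequal weights leave a negative multiple of
  \<open>h\<^sup>2(P, Q')\<close> over.  On the part of \<open>P\<close> that is singular to \<open>\<mu>\<close> both \<open>a\<close> and \<open>b\<close> vanish, so that the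
  identities persist there whatever the value of \<open>g\<close>.
\<close>

lemma psi_ratio_expectation:
  fixes q q' :: "'a \<Rightarrow> real"
  assumes "sigma_finite_measure \<mu>" "prob_space P" "sets P = sets \<mu>"
    and [measurable]: "q \<in> borel_measurable \<mu>" "q' \<in> borel_measurable \<mu>"
    and nonneg: "\<And>x. x \<in> space \<mu> \<Longrightarrow> 0 \<le> q x" "\<And>x. x \<in> space \<mu> \<Longrightarrow> 0 \<le> q' x"
    and prob: "prob_space (density \<mu> (\<lambda>x. ennreal (q x)))" "prob_space (density \<mu> (\<lambda>x. ennreal (q' x)))"
  defines "Q \<equiv> density \<mu> (\<lambda>x. ennreal (q x))" and "Q' \<equiv> density \<mu> (\<lambda>x. ennreal (q' x))"
  shows "(\<integral>x. psi_ratio (q' x) (q x) \<partial>P) \<le> 5/2 * hellinger_sq P Q - 1/4 * hellinger_sq P Q'"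
    and "(\<integral>x. (psi_ratio (q' x) (q x))\<^sup>2 \<partial>P) \<le> 4 * (hellinger_sq P Q + hellinger_sq P Q')"
proof -
  obtain \<nu> and m p :: "'a \<Rightarrow> real" where \<nu>: "sigma_finite_measure \<nu>" "sets \<nu> = sets \<mu>"
    "m \<in> borel_measurable \<nu>" "p \<in> borel_measurable \<nu>" "\<forall>x. 0 \<le> m x" "\<forall>x. 0 \<le> p x"
    "\<mu> = density \<nu> (\<lambda>x. ennreal (m x))" "P = density \<nu> (\<lambda>x. ennreal (p x))"
    by (rule obtain_dominating[OF assms(1) prob_space.finite_measure[OF assms(2)] assms(3)])
  define g where "g x = psi_ratio (q' x) (q x)" for x
  have [measurable]: "q \<in> borel_measurable \<nu>" "q' \<in> borel_measurable \<nu>" "m \<in> borel_measurable \<nu>" "p \<in> borel_measurable \<nu>"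
    using \<nu>(3,4) assms(4,5) unfolding measurable_cong_sets[OF \<nu>(2) refl] by auto
  have g_meas [measurable]: "g \<in> borel_measurable \<nu>" unfolding g_def psi_ratio_def by measurable
  define A where "A x = m x * max 0 (q x)" for x
  define A' where "A' x = m x * max 0 (q' x)" for x
  have [measurable]: "A \<in> borel_measurable \<nu>" "A' \<in> borel_measurable \<nu>" unfolding A_def A'_def by measurable
  have nn: "0 \<le> A x" "0 \<le> A' x" for x using \<nu>(5) by (auto simp: A_def A'_def)
  have Q: "Q = density \<nu> (\<lambda>x. ennreal (A x))"
    unfolding Q_def \<nu>(7) by (subst density_density_eq) (auto simp: A_def ennreal_mult' \<nu>(5))
  have Q': "Q' = density \<nu> (\<lambda>x. ennreal (A' x))"
    unfolding Q'_def \<nu>(7) by (subst density_density_eq) (auto simp: A'_def ennreal_mult' \<nu>(5))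
  have p: "integrable \<nu> p" "(\<integral>x. p x \<partial>\<nu>) = 1"
    using density_prob_integral[OF \<nu>(4) _ assms(2)[unfolded \<nu>(8)]] \<nu>(6) by auto
  have A: "integrable \<nu> A" "(\<integral>x. A x \<partial>\<nu>) = 1"
    using density_prob_integral[OF _ nn(1) prob(1)[folded Q_def, unfolded Q]] by auto
  have A': "integrable \<nu> A'" "(\<integral>x. A' x \<partial>\<nu>) = 1"
    using density_prob_integral[OF _ nn(2) prob(2)[folded Q'_def, unfolded Q']] by auto
  let ?s = "\<lambda>x. sqrt (p x)" and ?a = "\<lambda>x. sqrt (A x)" and ?b = "\<lambda>x. sqrt (A' x)"
  have int: "integrable \<nu> (\<lambda>x. (?s x - ?a x)\<^sup>2)" "integrable \<nu> (\<lambda>x. (?s x - ?b x)\<^sup>2)"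
    using integrable_sqrt_diff_sq p A A' nn \<nu>(6) by blast+
  have hP: "hellinger_sq P Q = 1/2 * (\<integral>x. (?s x - ?a x)\<^sup>2 \<partial>\<nu>)" "hellinger_sq P Q' = 1/2 * (\<integral>x. (?s x - ?b x)\<^sup>2 \<partial>\<nu>)"
    unfolding Q Q' \<nu>(8) using nn \<nu>(6) by (simp_all add: hellinger_sq_density[OF \<nu>(1)])
  have sp: "space \<nu> = space \<mu>" using \<nu>(2) by (rule sets_eq_imp_space_eq)
  have g: "\<bar>g x\<bar> \<le> 1" "g x * (?a x + ?b x) = ?b x - ?a x" if x: "x \<in> space \<nu>" for x
  proof -
    have q: "0 \<le> q x" "0 \<le> q' x" using nonneg x sp by auto
    then show "\<bar>g x\<bar> \<le> 1" unfolding g_def by (intro abs_psi_ratio_le)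
    show "g x * (?a x + ?b x) = ?b x - ?a x"
    proof (cases "sqrt (q x) + sqrt (q' x) = 0")
      case True
      then have "q x = 0" "q' x = 0" using q by (auto simp: add_nonneg_eq_0_iff)
      then show ?thesis by (simp add: A_def A'_def)
    next
      case False
      have "g x * (sqrt (q' x) + sqrt (q x)) = sqrt (q' x) - sqrt (q x)"
        using False by (simp add: g_def psi_ratio_def add.commute)
      then have "sqrt (m x) * (g x * (sqrt (q' x) + sqrt (q x))) = sqrt (m x) * (sqrt (q' x) - sqrt (q x))" by simp
      then show ?thesis using q by (simp add: A_def A'_def real_sqrt_mult algebra_simps)
    qed
  qed
  have gp_int: "integrable \<nu> (\<lambda>x. p x * g x)" "integrable \<nu> (\<lambda>x. p x * (g x)\<^sup>2)"
    by (rule Bochner_Integration.integrable_bound[OF p(1)],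
        use g(1) \<nu>(6) in \<open>auto simp: abs_mult abs_square_le_1 intro!: mult_left_le\<close>)+
  have sq: "(?s x)\<^sup>2 = p x" "(?a x)\<^sup>2 = A x" "(?b x)\<^sup>2 = A' x" for x using \<nu>(6) nn by auto
  have "(\<integral>x. g x \<partial>P) = (\<integral>x. p x * g x \<partial>\<nu>)"
    unfolding \<nu>(8) by (rule integral_real_density) (use \<nu>(6) in auto)
  also have "\<dots> \<le> (\<integral>x. 5/4 * (?s x - ?a x)\<^sup>2 - 1/8 * (?s x - ?b x)\<^sup>2 + 1/4 * (A' x - A x) \<partial>\<nu>)"
  proof (rule integral_mono)
    fix x assume x: "x \<in> space \<nu>"
    define s a b h where "s = ?s x" and "a = ?a x" and "b = ?b x" and "h = g x"
    have h: "\<bar>h\<bar> \<le> 1" "h * (a + b) = b - a" using g[OF x] by (auto simp: a_def b_def h_def)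
    have "h * s\<^sup>2 = h * (s - (a + b) / 2)\<^sup>2 + (h * (a + b)) * (s - (a + b) / 4)"
      by (simp add: power2_eq_square field_simps)
    also have "\<dots> \<le> (s - (a + b) / 2)\<^sup>2 + (h * (a + b)) * (s - (a + b) / 4)"
      using mult_right_mono[of h 1 "(s - (a + b) / 2)\<^sup>2"] h(1) by (simp add: abs_le_iff)
    also have "h * (a + b) = b - a" by (rule h(2))
    also have "(s - (a + b) / 2)\<^sup>2 + (b - a) * (s - (a + b) / 4)
       \<le> 5/4 * (s - a)\<^sup>2 - 1/8 * (s - b)\<^sup>2 + 1/4 * (b\<^sup>2 - a\<^sup>2)"
      using zero_le_power2[of "2 * (s - a) - (s - b)"] by (simp add: power2_eq_square field_simps)
    finally show "p x * g x \<le> 5/4 * (?s x - ?a x)\<^sup>2 - 1/8 * (?s x - ?b x)\<^sup>2 + 1/4 * (A' x - A x)"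
      unfolding s_def a_def b_def h_def sq by (simp add: mult.commute)
  qed (use int gp_int A A' in auto)
  also have "\<dots> = 5/4 * (\<integral>x. (?s x - ?a x)\<^sup>2 \<partial>\<nu>) - 1/8 * (\<integral>x. (?s x - ?b x)\<^sup>2 \<partial>\<nu>)"
    using int A A' by simp
  finally show "(\<integral>x. psi_ratio (q' x) (q x) \<partial>P) \<le> 5/2 * hellinger_sq P Q - 1/4 * hellinger_sq P Q'"
    unfolding hP g_def by simp
  have "(\<integral>x. (g x)\<^sup>2 \<partial>P) = (\<integral>x. p x * (g x)\<^sup>2 \<partial>\<nu>)"
    unfolding \<nu>(8) by (rule integral_real_density) (use \<nu>(6) in auto)
  also have "\<dots> \<le> (\<integral>x. 2 * (?s x - ?a x)\<^sup>2 + 2 * (?s x - ?b x)\<^sup>2 \<partial>\<nu>)"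
  proof (rule integral_mono)
    fix x assume x: "x \<in> space \<nu>"
    define s a b h where "s = ?s x" and "a = ?a x" and "b = ?b x" and "h = g x"
    have h: "\<bar>h\<bar> \<le> 1" "h * (a + b) = b - a" using g[OF x] by (auto simp: a_def b_def h_def)
    have h2: "h\<^sup>2 \<le> 1" using h(1) by (simp add: abs_square_le_1)
    have "h\<^sup>2 * s\<^sup>2 \<le> h\<^sup>2 * (2 * (s - (a + b) / 2)\<^sup>2 + (a + b)\<^sup>2 / 2)"
      using zero_le_power2[of "s - (a + b)"]
      by (intro mult_left_mono) (simp_all add: power2_eq_square field_simps)
    also have "\<dots> = h\<^sup>2 * (2 * (s - (a + b) / 2)\<^sup>2) + (h * (a + b))\<^sup>2 / 2"
      unfolding power_mult_distrib by (simp only: distrib_left times_divide_eq_right)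
    also have "\<dots> \<le> 2 * (s - (a + b) / 2)\<^sup>2 + (b - a)\<^sup>2 / 2"
      unfolding h(2) using h2 by (intro add_right_mono mult_left_le_one_le) auto
    also have "\<dots> \<le> 2 * (s - a)\<^sup>2 + 2 * (s - b)\<^sup>2"
      using zero_le_power2[of "(s - a) + (s - b)"] zero_le_power2[of "(s - a) - (s - b)"]
      by (simp add: power2_eq_square field_simps)
    finally show "p x * (g x)\<^sup>2 \<le> 2 * (?s x - ?a x)\<^sup>2 + 2 * (?s x - ?b x)\<^sup>2"
      unfolding s_def a_def b_def h_def sq by (simp add: mult.commute)
  qed (use int gp_int in auto)
  also have "\<dots> = 2 * (\<integral>x. (?s x - ?a x)\<^sup>2 \<partial>\<nu>) + 2 * (\<integral>x. (?s x - ?b x)\<^sup>2 \<partial>\<nu>)"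
    using int by simp
  finally show "(\<integral>x. (psi_ratio (q' x) (q x))\<^sup>2 \<partial>P) \<le> 4 * (hellinger_sq P Q + hellinger_sq P Q')"
    unfolding hP g_def by simp
qed

lemma rho_T_eq:
  assumes "\<And>i. i \<in> {1..n} \<Longrightarrow> 0 \<le> q (x i) \<and> 0 \<le> q' (x i)"
  shows "rho_T n x q q' = (\<Sum>i=1..n. psi_ratio (q' (x i)) (q (x i)))"
  unfolding rho_T_def by (rule sum.cong[OF refl]) (use assms in \<open>auto intro!: rho_psi_eq\<close>)

text \<open>
  \<open>\<Upsilon>(qb) \<le> a\<close> because all \<open>T(qb, q)\<close> are at most \<open>a\<close>; near-minimality transfers this, up to \<open>e\<close>, to
  \<open>\<Upsilon>(qh)\<close>, which is at least \<open>T(qh, qb) = - T(qb, qh) \<ge> w(qh) - a\<close>.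
\<close>

lemma rho_selection_bound:
  assumes qb: "qb \<in> \<Q>" and qh: "qh \<in> \<Q>"
    and nonneg: "\<And>q i. q \<in> \<Q> \<Longrightarrow> i \<in> {1..n} \<Longrightarrow> 0 \<le> q (x i)"
    and up: "\<And>q. q \<in> \<Q> \<Longrightarrow> rho_T n x qb q \<le> a - w q" and w: "\<And>q. q \<in> \<Q> \<Longrightarrow> 0 \<le> w q"
    and near: "rho_Upsilon \<Q> n x qh < (INF q'\<in>\<Q>. rho_Upsilon \<Q> n x q') + e"
  shows "w qh \<le> 2 * a + e"
proof -
  have T: "rho_T n x q q' = (\<Sum>i=1..n. psi_ratio (q' (x i)) (q (x i)))" if "q \<in> \<Q>" "q' \<in> \<Q>" for q q'
    by (rule rho_T_eq) (use that nonneg in auto)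
  have bound: "\<bar>rho_T n x q q'\<bar> \<le> real n" if "q \<in> \<Q>" "q' \<in> \<Q>" for q q'
  proof -
    have "\<bar>rho_T n x q q'\<bar> \<le> (\<Sum>i=1..n. \<bar>psi_ratio (q' (x i)) (q (x i))\<bar>)"
      unfolding T[OF that] by (rule sum_abs)
    also have "\<dots> \<le> (\<Sum>i=1..n. 1)"
      by (rule sum_mono) (use that nonneg in \<open>auto intro!: abs_psi_ratio_le\<close>)
    finally show ?thesis by simp
  qed
  have bdd: "bdd_above (rho_T n x q ` \<Q>)" if "q \<in> \<Q>" for q
    using bound[OF that] by (intro bdd_aboveI2[of _ _ "real n"]) (auto simp: abs_le_iff)
  have "rho_Upsilon \<Q> n x qb \<le> a"
    unfolding rho_Upsilon_def by (rule cSUP_least) (use qb up w in fastforce)+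
  moreover have "(INF q'\<in>\<Q>. rho_Upsilon \<Q> n x q') \<le> rho_Upsilon \<Q> n x qb"
  proof (rule cINF_lower[OF _ qb], rule bdd_belowI2)
    fix q assume q: "q \<in> \<Q>"
    have "- real n \<le> rho_T n x q qb" using bound[OF q qb] by (simp add: abs_le_iff)
    also have "\<dots> \<le> rho_Upsilon \<Q> n x q" unfolding rho_Upsilon_def by (rule cSUP_upper[OF qb bdd[OF q]])
    finally show "- real n \<le> rho_Upsilon \<Q> n x q" .
  qed
  moreover have "rho_T n x qh qb \<le> rho_Upsilon \<Q> n x qh"
    unfolding rho_Upsilon_def by (rule cSUP_upper[OF qb bdd[OF qh]])
  moreover have "rho_T n x qh qb = - rho_T n x qb qh"
    unfolding T[OF qh qb] T[OF qb qh] sum_negf[symmetric] by (rule sum.cong[OF refl]) (rule psi_ratio_commute)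
  ultimately show ?thesis using up[OF qh] near by linarith
qed


section \<open>Mixture densities near a parameter\<close>

lemma weight_sum: "(\<Sum>k\<in>UNIV. weight \<theta> k) = 1"
proof -
  have "(\<Sum>k\<in>UNIV. weight \<theta> k) = weight \<theta> None + (\<Sum>l\<in>UNIV. weight \<theta> (Some l))"
    by (simp add: UNIV_option_conv sum.reindex)
  then show ?thesis by (simp add: weight_def)
qed

lemma bounded_linear_component: "bounded_linear (component b k)"
  by (subst linear_conv_bounded_linear[symmetric], rule linearI)
     (simp_all add: component_def vec_eq_iff)

lemma differentiable_weight: "(\<lambda>\<theta>. weight \<theta> k) differentiable F"
proof -
  have "(\<lambda>\<theta>. \<theta> $ i) differentiable F" for i :: "'x::finite"
    and F :: "(real ^ 'x) filter"
    by (rule bounded_linear_imp_differentiable[OF bounded_linear_vec_nth])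
  then show ?thesis
    by (cases k) (auto simp: weight_def intro!: derivative_intros differentiable_sum)
qed

lemma continuous_weight: "continuous (at \<theta> within S) (\<lambda>\<theta>. weight \<theta> k)"
  by (rule differentiable_imp_continuous_within[OF differentiable_weight])

lemma directional_limit:
  fixes g :: "'v::real_normed_vector \<Rightarrow> real"
  assumes g: "(g has_derivative G) (at z)" and y: "y \<longlonglongrightarrow> z" "\<And>m. y m \<noteq> z"
    and v: "(\<lambda>m. (y m - z) /\<^sub>R norm (y m - z)) \<longlonglongrightarrow> v"
  shows "(\<lambda>m. (g (y m) - g z) / norm (y m - z)) \<longlonglongrightarrow> G v"
proof -
  interpret G: bounded_linear G using g by (rule has_derivative_bounded_linear)
  have "((\<lambda>x. ((g x - g z) - G (x - z)) /\<^sub>R norm (x - z)) \<longlongrightarrow> 0) (at z)"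
    using g by (simp add: has_derivative_at_within)
  moreover have "filterlim y (at z) sequentially"
    using y by (auto simp: filterlim_at)
  ultimately have "(\<lambda>m. ((g (y m) - g z) - G (y m - z)) /\<^sub>R norm (y m - z)) \<longlonglongrightarrow> 0"
    by (rule filterlim_compose)
  moreover have "(\<lambda>m. G ((y m - z) /\<^sub>R norm (y m - z))) \<longlonglongrightarrow> G v"
    by (rule G.tendsto[OF v])
  ultimately have "(\<lambda>m. ((g (y m) - g z) - G (y m - z)) /\<^sub>R norm (y m - z) + G ((y m - z) /\<^sub>R norm (y m - z))) \<longlonglongrightarrow> 0 + G v"
    by (rule tendsto_add)
  moreover have "((g (y m) - g z) - G (y m - z)) /\<^sub>R norm (y m - z) + G ((y m - z) /\<^sub>R norm (y m - z))
      = (g (y m) - g z) / norm (y m - z)" for m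
    unfolding G.scaleR real_scaleR_def by (simp add: divide_inverse algebra_simps)
  ultimately show ?thesis by simp
qed

text \<open>
  Measurability in \<open>x\<close> is part of the \<open>L\<^sub>2\<close>-continuity hypothesis for the partial derivatives of \<open>sqrt p\<close>;
  this carries it over to the integrands of the Fisher information, which are known almost everywhere.
\<close>

lemma measurable_completion_AE_cong:
  fixes g h :: "'a \<Rightarrow> real"
  assumes g: "g \<in> borel_measurable (completion M)" and eq: "AE x in M. g x = h x"
  shows "h \<in> borel_measurable (completion M)"
proof (rule measurableI)
  fix S :: "real set" assume S: "S \<in> sets borel"
  have "AE x in completion M. g x = h x" using eq by (rule AE_completion)
  then have "AE x in completion M. x \<in> g -` S \<inter> space (completion M) \<longleftrightarrow> x \<in> h -` S \<inter> space (completion M)"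
    by eventually_elim auto
  then show "h -` S \<inter> space (completion M) \<in> sets (completion M)"
    by (rule completion.in_sets_AE) (use measurable_sets[OF g S] in auto)
qed simp

context mixture_model begin

lemma weight_pos: "\<theta> \<in> \<Theta> \<Longrightarrow> 0 < weight \<theta> k"
  using \<Theta>_subset by (cases k) (fastforce simp: weight_def free_weights_def)+

lemma component_in_A: "\<theta> \<in> \<Theta> \<Longrightarrow> component b k \<theta> \<in> A k"
  using \<Theta>_subset by auto

lemma mix_density_measurable: "\<theta> \<in> \<Theta> \<Longrightarrow> mix_density b f \<theta> \<in> borel_measurable \<mu>"
  unfolding mix_density_def[abs_def]
  by (intro borel_measurable_sum borel_measurable_times borel_measurable_const density_measurable component_in_A)

lemma mix_density_nonneg: "\<theta> \<in> \<Theta> \<Longrightarrow> x \<in> space \<mu> \<Longrightarrow> 0 \<le> mix_density b f \<theta> x"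
  unfolding mix_density_def
  by (intro sum_nonneg mult_nonneg_nonneg density_nonneg component_in_A less_imp_le[OF weight_pos])

lemma prob_space_mix: 
  assumes "\<theta> \<in> \<Theta>" shows "prob_space (mix_measure \<mu> b f \<theta>)"
proof
  have "(\<integral>\<^sup>+x. ennreal (mix_density b f \<theta> x) \<partial>\<mu>)
      = (\<integral>\<^sup>+x. (\<Sum>k\<in>UNIV. ennreal (weight \<theta> k) * ennreal (f k (component b k \<theta>) x)) \<partial>\<mu>)"
  proof (rule nn_integral_cong)
    fix x assume "x \<in> space \<mu>"
    then show "ennreal (mix_density b f \<theta> x) = (\<Sum>k\<in>UNIV. ennreal (weight \<theta> k) * ennreal (f k (component b k \<theta>) x))"
      unfolding mix_density_def using assms weight_pos[OF assms] 
      by (subst sum_ennreal[symmetric])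
        (auto intro!: mult_nonneg_nonneg density_nonneg component_in_A sum.cong ennreal_mult simp: less_imp_le)
  qed
  also have "\<dots> = (\<Sum>k\<in>UNIV. \<integral>\<^sup>+x. ennreal (weight \<theta> k) * ennreal (f k (component b k \<theta>) x) \<partial>\<mu>)"
    by (rule nn_integral_sum) (use density_measurable[OF component_in_A[OF assms]] in measurable)
  also have "\<dots> = (\<Sum>k\<in>UNIV. ennreal (weight \<theta> k))"
  proof (rule sum.cong[OF refl])
    fix k
    have [measurable]: "f k (component b k \<theta>) \<in> borel_measurable \<mu>"
      by (rule density_measurable[OF component_in_A[OF assms]])
    show "(\<integral>\<^sup>+x. ennreal (weight \<theta> k) * ennreal (f k (component b k \<theta>) x) \<partial>\<mu>) = ennreal (weight \<theta> k)"
      by (subst nn_integral_cmult) (auto simp: density_integral component_in_A[OF assms])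
  qed
  also have "\<dots> = 1" using weight_pos[OF assms] weight_sum[of \<theta>] by (simp add: sum_ennreal less_imp_le)
  finally show "emeasure (mix_measure \<mu> b f \<theta>) (space (mix_measure \<mu> b f \<theta>)) = 1"
    using mix_density_measurable[OF assms]
    by (simp add: mix_measure_def emeasure_density cong: nn_integral_cong)
qed

lemma hellinger_mix:
  assumes "\<theta> \<in> \<Theta>" "\<eta> \<in> \<Theta>"
  shows "hellinger_sq (mix_measure \<mu> b f \<theta>) (mix_measure \<mu> b f \<eta>)
      = 1/2 * (\<integral>x. (sqrt (mix_density b f \<theta> x) - sqrt (mix_density b f \<eta> x))\<^sup>2 \<partial>\<mu>)"
    and "integrable \<mu> (\<lambda>x. (sqrt (mix_density b f \<theta> x) - sqrt (mix_density b f \<eta> x))\<^sup>2)"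
proof -
  \<comment> \<open>Outside the space of \<open>\<mu>\<close> the densities are arbitrary and may be negative.\<close>
  let ?p = "\<lambda>\<theta> x. max 0 (mix_density b f \<theta> x)"
  have [measurable]: "mix_density b f \<theta> \<in> borel_measurable \<mu>" "mix_density b f \<eta> \<in> borel_measurable \<mu>"
    using assms mix_density_measurable by auto
  have m: "mix_measure \<mu> b f \<zeta> = density \<mu> (\<lambda>x. ennreal (?p \<zeta> x))" for \<zeta>
    by (simp add: mix_measure_def)
  have eq: "(sqrt (?p \<theta> x) - sqrt (?p \<eta> x))\<^sup>2 = (sqrt (mix_density b f \<theta> x) - sqrt (mix_density b f \<eta> x))\<^sup>2"
    if "x \<in> space \<mu>" for x using mix_density_nonneg[OF _ that] assms by (simp add: max_def)
  have "hellinger_sq (mix_measure \<mu> b f \<theta>) (mix_measure \<mu> b f \<eta>) = 1/2 * (\<integral>x. (sqrt (?p \<theta> x) - sqrt (?p \<eta> x))\<^sup>2 \<partial>\<mu>)"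
    unfolding m by (rule hellinger_sq_density) (use sigma_finite_measure_axioms in auto)
  then show "hellinger_sq (mix_measure \<mu> b f \<theta>) (mix_measure \<mu> b f \<eta>)
      = 1/2 * (\<integral>x. (sqrt (mix_density b f \<theta> x) - sqrt (mix_density b f \<eta> x))\<^sup>2 \<partial>\<mu>)"
    using eq by (simp cong: Bochner_Integration.integral_cong)
  have "integrable \<mu> (?p \<zeta>)" if "\<zeta> \<in> \<Theta>" for \<zeta>
    using prob_space_mix[OF that] mix_density_measurable[OF that] unfolding m
    by (intro density_prob_integral(1)) auto
  then have "integrable \<mu> (\<lambda>x. (sqrt (?p \<theta> x) - sqrt (?p \<eta> x))\<^sup>2)"
    using assms by (intro integrable_sqrt_diff_sq) auto
  then show "integrable \<mu> (\<lambda>x. (sqrt (mix_density b f \<theta> x) - sqrt (mix_density b f \<eta> x))\<^sup>2)"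
    using eq by (simp cong: Bochner_Integration.integrable_cong)
qed

lemma mix_density_differentiable:
  assumes "\<theta> \<in> \<Theta>"
  shows "AE x in \<mu>. (\<lambda>\<eta>. mix_density b f \<eta> x) differentiable (at \<theta>)"
proof -
  have "AE x in \<mu>. (\<lambda>\<eta>. f k (component b k \<eta>) x) differentiable (at \<theta>)" for k
  proof -
    obtain D where "AE x in \<mu>. ((\<lambda>u. f k u x) has_derivative D x) (at (component b k \<theta>) within A k)"
      using differentiable[OF component_in_A[OF assms]] by blast
    then show ?thesis
    proof eventually_elim
      case (elim x)
      have "(component b k has_derivative component b k) (at \<theta> within \<Theta>)"
        by (rule bounded_linear_imp_has_derivative[OF bounded_linear_component])
      moreover have "((\<lambda>u. f k u x) has_derivative D x) (at (component b k \<theta>) within component b k ` \<Theta>)"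
        by (rule has_derivative_subset[OF elim]) (use component_in_A in auto)
      ultimately have "((\<lambda>\<eta>. f k (component b k \<eta>) x) has_derivative (\<lambda>y. D x (component b k y))) (at \<theta> within \<Theta>)"
        by (rule has_derivative_in_compose)
      then show ?case using at_within_open[OF assms \<Theta>_open] by (auto simp: differentiable_def)
    qed
  qed
  then have "AE x in \<mu>. \<forall>k\<in>UNIV. (\<lambda>\<eta>. f k (component b k \<eta>) x) differentiable (at \<theta>)"
    by (intro AE_finite_allI) auto
  then show ?thesis
    by eventually_elim (auto simp: mix_density_def intro!: differentiable_sum differentiable_mult differentiable_weight)
qed

text \<open>
  Fatou's lemma turns the smallness of the \<open>L\<^sub>2\<close> norms of the difference quotients into a statement about
  their pointwise limit.  Where the density vanishes its square root may fail to be differentiable,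
  whence the restriction to positive densities; the Fisher information does not see the other points.
\<close>

lemma vanishing_direction:
  assumes \<theta>: "\<theta> \<in> \<Theta>" and y: "\<And>m. y m \<in> \<Theta>" "\<And>m. y m \<noteq> \<theta>" "y \<longlonglongrightarrow> \<theta>"
    and v: "(\<lambda>m. (y m - \<theta>) /\<^sub>R norm (y m - \<theta>)) \<longlonglongrightarrow> v"
    and h: "(\<lambda>m. hellinger_sq (mix_measure \<mu> b f \<theta>) (mix_measure \<mu> b f (y m)) / (norm (y m - \<theta>))\<^sup>2) \<longlonglongrightarrow> 0"
  shows "AE x in \<mu>. mix_density b f \<theta> x > 0 \<longrightarrow> frechet_derivative (\<lambda>\<eta>. mix_density b f \<eta> x) (at \<theta>) v = 0"
proof -
  let ?p = "mix_density b f"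
  define u where "u m x = ((sqrt (?p (y m) x) - sqrt (?p \<theta> x)) / norm (y m - \<theta>))\<^sup>2" for m x
  have [measurable]: "?p \<theta> \<in> borel_measurable \<mu>" "?p (y m) \<in> borel_measurable \<mu>" for m
    using assms mix_density_measurable by auto
  have [measurable]: "u m \<in> borel_measurable \<mu>" for m unfolding u_def by measurable
  have int_u: "(\<integral>\<^sup>+x. ennreal (u m x) \<partial>\<mu>)
      = ennreal (2 * (hellinger_sq (mix_measure \<mu> b f \<theta>) (mix_measure \<mu> b f (y m)) / (norm (y m - \<theta>))\<^sup>2))" for m
  proof -
    have e: "u m x = (sqrt (?p \<theta> x) - sqrt (?p (y m) x))\<^sup>2 / (norm (y m - \<theta>))\<^sup>2" for x
      by (simp add: u_def power_divide power2_commute)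
    show ?thesis
      unfolding e using hellinger_mix[OF \<theta> y(1)[of m]]
      by (subst nn_integral_eq_integral) (auto simp: field_simps)
  qed
  have "(\<integral>\<^sup>+x. liminf (\<lambda>m. ennreal (u m x)) \<partial>\<mu>) \<le> liminf (\<lambda>m. \<integral>\<^sup>+x. ennreal (u m x) \<partial>\<mu>)"
    by (rule nn_integral_liminf) measurable
  also have "\<dots> = ennreal (2 * 0)"
    unfolding int_u by (intro lim_imp_Liminf tendsto_ennrealI tendsto_mult tendsto_const h) simp
  finally have "AE x in \<mu>. liminf (\<lambda>m. ennreal (u m x)) = 0"
    by (simp add: nn_integral_0_iff_AE)
  then show ?thesis using mix_density_differentiable[OF \<theta>]
  proof eventually_elim
    case (elim x)
    show ?case
    proof
      assume pos: "?p \<theta> x > 0"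
      define F where "F = frechet_derivative (\<lambda>\<eta>. ?p \<eta> x) (at \<theta>)"
      have F: "((\<lambda>\<eta>. ?p \<eta> x) has_derivative F) (at \<theta>)"
        using elim(2) by (simp add: F_def frechet_derivative_works)
      have "((\<lambda>\<eta>. sqrt (?p \<eta> x)) has_derivative (\<lambda>h. F h * (inverse (sqrt (?p \<theta> x)) / 2))) (at \<theta>)"
        using has_derivative_real_sqrt[OF pos F] by simp
      from directional_limit[OF this y(3,2) v]
      have "(\<lambda>m. ennreal (u m x)) \<longlonglongrightarrow> ennreal ((F v * (inverse (sqrt (?p \<theta> x)) / 2))\<^sup>2)"
        unfolding u_def by (intro tendsto_ennrealI tendsto_power)
      then have "liminf (\<lambda>m. ennreal (u m x)) = ennreal ((F v * (inverse (sqrt (?p \<theta> x)) / 2))\<^sup>2)"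
        by (intro lim_imp_Liminf) auto
      then have "F v * (inverse (sqrt (?p \<theta> x)) / 2) = 0" using elim(1) by simp
      then show "F v = 0" using pos by simp
    qed
  qed
qed


text \<open>
  Wherever \<open>p > 0\<close>, the product of two partial derivatives of \<open>p\<close>, divided by \<open>p\<close>, is four times the
  product of those of \<open>sqrt p\<close>.  The latter are square integrable, so that the quadratic form of the
  information matrix is the integral of the squared directional derivative divided by \<open>p\<close>.
\<close>

lemma Fisher_form_eq_0:
  assumes \<theta>: "\<theta> \<in> \<Theta>"
    and z: "AE x in \<mu>. mix_density b f \<theta> x > 0 \<longrightarrow> frechet_derivative (\<lambda>\<eta>. mix_density b f \<eta> x) (at \<theta>) v = 0"
  shows "v \<bullet> (Fisher_information \<mu> (mix_density b f) \<theta> *v v) = 0"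
proof -
  let ?p = "mix_density b f"
  define d where "d i x = pderiv_at (\<lambda>\<eta>. ?p \<eta> x) \<theta> i" for i x
  define s where "s i x = sqrt_density_deriv ?p i \<theta> x" for i x
  have s: "s i \<in> borel_measurable (completion \<mu>)" "(\<integral>\<^sup>+x. ennreal ((s i x)\<^sup>2) \<partial>completion \<mu>) < \<infinity>" for i
    using sqrt_density_C1[of i] \<theta> unfolding L2_continuous_on_def s_def by auto
  have ae: "AE x in \<mu>. 4 * (s i x * s j x) = d i x * d j x / ?p \<theta> x" for i j
    using mix_density_differentiable[OF \<theta>] AE_space
  proof eventually_elim
    case (elim x)
    show ?case
    proof (cases "?p \<theta> x = 0")
      case False
      then have pos: "?p \<theta> x > 0" using mix_density_nonneg[OF \<theta> elim(2)] by simp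
      define F where "F = frechet_derivative (\<lambda>\<eta>. ?p \<eta> x) (at \<theta>)"
      have F: "((\<lambda>\<eta>. ?p \<eta> x) has_derivative F) (at \<theta>)"
        using elim(1) by (simp add: F_def frechet_derivative_works)
      have "((\<lambda>\<eta>. sqrt (?p \<eta> x)) has_derivative (\<lambda>h. F h * (inverse (sqrt (?p \<theta> x)) / 2))) (at \<theta>)"
        using has_derivative_real_sqrt[OF pos F] by simp
      from frechet_derivative_at[OF this]
      have s_eq: "s i x = d i x * (inverse (sqrt (?p \<theta> x)) / 2)" for i
        using False by (simp add: s_def sqrt_density_deriv_def pderiv_at_def d_def F_def fun_eq_iff)
      have "inverse (sqrt (?p \<theta> x)) * inverse (sqrt (?p \<theta> x)) = inverse (?p \<theta> x)"
        using pos by (simp flip: inverse_mult_distrib)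
      moreover have "4 * (s i x * s j x) = d i x * d j x * (inverse (sqrt (?p \<theta> x)) * inverse (sqrt (?p \<theta> x)))"
        unfolding s_eq by simp
      ultimately show ?thesis by (simp add: divide_inverse)
    qed (simp add: s_def sqrt_density_deriv_def)
  qed
  have int: "integrable (completion \<mu>) (\<lambda>x. d i x * d j x / ?p \<theta> x)" for i j
  proof -
    have sq: "integrable (completion \<mu>) (\<lambda>x. (s i x)\<^sup>2)" for i
      using s[of i] by (auto simp: integrable_iff_bounded)
    have "integrable (completion \<mu>) (\<lambda>x. 4 * (s i x * s j x))"
    proof (rule Bochner_Integration.integrable_bound)
      show "integrable (completion \<mu>) (\<lambda>x. 2 * ((s i x)\<^sup>2 + (s j x)\<^sup>2))" using sq by auto
      show "(\<lambda>x. 4 * (s i x * s j x)) \<in> borel_measurable (completion \<mu>)" using s by auto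
      have "\<bar>4 * (a * c)\<bar> \<le> 2 * (a\<^sup>2 + c\<^sup>2)" for a c :: real
        using zero_le_power2[of "a + c"] zero_le_power2[of "a - c"]
        by (auto simp: power2_eq_square algebra_simps abs_if)
      then show "AE x in completion \<mu>. norm (4 * (s i x * s j x)) \<le> norm (2 * ((s i x)\<^sup>2 + (s j x)\<^sup>2))"
        by simp
    qed
    then show ?thesis
      by (rule integrable_cong_AE_imp)
         (use ae AE_completion measurable_completion_AE_cong[OF _ ae] s in \<open>auto intro: AE_completion\<close>)
  qed
  have "v \<bullet> (Fisher_information \<mu> ?p \<theta> *v v)
      = (\<Sum>i\<in>UNIV. \<Sum>j\<in>UNIV. v $ i * v $ j * (\<integral>x. d i x * d j x / ?p \<theta> x \<partial>completion \<mu>))"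
    by (simp add: inner_vec_def matrix_vector_mult_def Fisher_information_def d_def sum_distrib_left mult_ac)
  also have "\<dots> = (\<Sum>i\<in>UNIV. \<Sum>j\<in>UNIV. \<integral>x. v $ i * v $ j * (d i x * d j x / ?p \<theta> x) \<partial>completion \<mu>)"
    by (simp only: integral_mult_right_zero)
  also have "\<dots> = (\<integral>x. (\<Sum>i\<in>UNIV. \<Sum>j\<in>UNIV. v $ i * v $ j * (d i x * d j x / ?p \<theta> x)) \<partial>completion \<mu>)"
    using int by (simp only: Bochner_Integration.integral_sum Bochner_Integration.integrable_sum integrable_mult_right)
  also have "\<dots> = 0"
  proof (rule integral_eq_zero_AE)
    have "AE x in \<mu>. (\<Sum>i\<in>UNIV. \<Sum>j\<in>UNIV. v $ i * v $ j * (d i x * d j x / ?p \<theta> x)) = 0"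
      using z mix_density_differentiable[OF \<theta>] AE_space
    proof eventually_elim
      case (elim x)
      show ?case
      proof (cases "?p \<theta> x = 0")
        case False
        then have pos: "?p \<theta> x > 0" using mix_density_nonneg[OF \<theta> elim(3)] by simp
        define F where "F = frechet_derivative (\<lambda>\<eta>. ?p \<eta> x) (at \<theta>)"
        have F: "((\<lambda>\<eta>. ?p \<eta> x) has_derivative F) (at \<theta>)"
          using elim(2) by (simp add: F_def frechet_derivative_works)
        interpret F: bounded_linear F using F by (rule has_derivative_bounded_linear)
        have d_eq: "d i x = F (axis i 1)" for i by (simp add: d_def pderiv_at_def F_def)
        have "F v = F (\<Sum>i\<in>UNIV. v $ i *\<^sub>R axis i 1)"
          using basis_expansion[of v] by (simp add: scalar_mult_eq_scaleR)
        also have "\<dots> = (\<Sum>i\<in>UNIV. v $ i * d i x)"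
          using d_eq by (simp add: F.sum F.scaleR)
        finally have "(\<Sum>i\<in>UNIV. v $ i * d i x) = 0" using elim(1) pos by (simp add: F_def)
        moreover have "(\<Sum>i\<in>UNIV. \<Sum>j\<in>UNIV. v $ i * v $ j * (d i x * d j x / ?p \<theta> x))
            = (\<Sum>i\<in>UNIV. v $ i * d i x) * (\<Sum>j\<in>UNIV. v $ j * d j x) / ?p \<theta> x"
          by (simp add: sum_product sum_divide_distrib mult_ac)
        ultimately show ?thesis by simp
      qed simp
    qed
    then show "AE x in completion \<mu>. (\<Sum>i\<in>UNIV. \<Sum>j\<in>UNIV. v $ i * v $ j * (d i x * d j x / ?p \<theta> x)) = 0"
      by (rule AE_completion)
  qed
  finally show ?thesis .
qed

text \<open>
  Otherwise there is a sequence of parameters tending to \<open>\<theta>\<close> along which \<open>h\<^sup>2\<close> is negligible compared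
  with the squared distance; by compactness of the sphere it may be assumed to have a limiting direction.
\<close>

lemma hellinger_local_lower_bound:
  assumes \<theta>: "\<theta> \<in> \<Theta>" and pd: "positive_definite (Fisher_information \<mu> (mix_density b f) \<theta>)"
  shows "\<exists>a>0. \<exists>c>0. \<forall>\<eta>\<in>\<Theta>. norm (\<theta> - \<eta>) < a \<longrightarrow>
    c * (norm (\<theta> - \<eta>))\<^sup>2 \<le> hellinger_sq (mix_measure \<mu> b f \<theta>) (mix_measure \<mu> b f \<eta>)"
proof (rule ccontr)
  let ?h = "\<lambda>\<eta>. hellinger_sq (mix_measure \<mu> b f \<theta>) (mix_measure \<mu> b f \<eta>)"
  assume neg: "\<not> ?thesis"
  have "\<exists>\<eta>\<in>\<Theta>. norm (\<theta> - \<eta>) < inverse (real (Suc m)) \<and> ?h \<eta> < inverse (real (Suc m)) * (norm (\<theta> - \<eta>))\<^sup>2" for m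
  proof (rule ccontr)
    assume "\<not> ?thesis"
    then have "\<forall>\<eta>\<in>\<Theta>. norm (\<theta> - \<eta>) < inverse (real (Suc m)) \<longrightarrow> inverse (real (Suc m)) * (norm (\<theta> - \<eta>))\<^sup>2 \<le> ?h \<eta>"
      by (auto simp: not_less)
    moreover have "0 < inverse (real (Suc m))" by simp
    ultimately show False using neg by blast
  qed
  then obtain y where y: "\<And>m. y m \<in> \<Theta>" "\<And>m. norm (\<theta> - y m) < inverse (real (Suc m))"
    "\<And>m. ?h (y m) < inverse (real (Suc m)) * (norm (\<theta> - y m))\<^sup>2" by metis
  have ne: "y m \<noteq> \<theta>" for m
    using y(3)[of m] hellinger_sq_nonneg[of "mix_measure \<mu> b f \<theta>" "mix_measure \<mu> b f \<theta>"] by auto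
  have lim: "y \<longlonglongrightarrow> \<theta>"
    by (rule LIMSEQ_norm_0[of "\<lambda>m. y m - \<theta>", THEN LIM_zero_cancel])
       (use y(2) in \<open>auto simp: norm_minus_commute inverse_eq_divide intro: less_imp_le\<close>)
  define u where "u m = (y m - \<theta>) /\<^sub>R norm (y m - \<theta>)" for m
  have "u m \<in> sphere 0 1" for m using ne[of m] by (simp add: u_def)
  moreover have "seq_compact (sphere (0 :: real ^ ('w + 'j)) 1)" by (simp add: compact_imp_seq_compact)
  ultimately obtain v r where v: "v \<in> sphere 0 1" "strict_mono r" "(u \<circ> r) \<longlonglongrightarrow> v"
    unfolding seq_compact_def by metis
  have "AE x in \<mu>. mix_density b f \<theta> x > 0 \<longrightarrow> frechet_derivative (\<lambda>\<eta>. mix_density b f \<eta> x) (at \<theta>) v = 0"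
  proof (rule vanishing_direction[OF \<theta>, of "y \<circ> r"])
    show "(y \<circ> r) \<longlonglongrightarrow> \<theta>" using lim v(2) by (rule LIMSEQ_subseq_LIMSEQ)
    show "(\<lambda>m. ((y \<circ> r) m - \<theta>) /\<^sub>R norm ((y \<circ> r) m - \<theta>)) \<longlonglongrightarrow> v" using v(3) by (simp add: u_def comp_def)
    have "(\<lambda>m. ?h (y m) / (norm (y m - \<theta>))\<^sup>2) \<longlonglongrightarrow> 0"
    proof (rule tendsto_sandwich[OF _ _ tendsto_const LIMSEQ_inverse_real_of_nat])
      show "\<forall>\<^sub>F m in sequentially. 0 \<le> ?h (y m) / (norm (y m - \<theta>))\<^sup>2"
        by (simp add: hellinger_sq_nonneg)
      have "?h (y m) / (norm (y m - \<theta>))\<^sup>2 \<le> inverse (real (Suc m))" for m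
        using y(3)[of m] ne[of m] by (simp add: norm_minus_commute pos_divide_le_eq less_imp_le)
      then show "\<forall>\<^sub>F m in sequentially. ?h (y m) / (norm (y m - \<theta>))\<^sup>2 \<le> inverse (real (Suc m))" by simp
    qed
    then have "((\<lambda>m. ?h (y m) / (norm (y m - \<theta>))\<^sup>2) \<circ> r) \<longlonglongrightarrow> 0" using v(2) by (rule LIMSEQ_subseq_LIMSEQ)
    then show "(\<lambda>m. ?h ((y \<circ> r) m) / (norm ((y \<circ> r) m - \<theta>))\<^sup>2) \<longlonglongrightarrow> 0" by (simp add: comp_def)
  qed (use y ne in auto)
  then have "v \<bullet> (Fisher_information \<mu> (mix_density b f) \<theta> *v v) = 0" by (rule Fisher_form_eq_0[OF \<theta>])
  moreover have "v \<noteq> 0" using v(1) by auto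
  ultimately show False using pd unfolding positive_definite_def by (metis less_irrefl)
qed

text \<open>
  The quantity estimated in the theorem, which is bounded although the parameters \<open>\<alpha>\<close> need not be.
\<close>

definition loss :: "real ^ ('w + 'j) \<Rightarrow> real ^ ('w + 'j) \<Rightarrow> real" where
  "loss \<theta> \<eta> = (norm (free_weights \<theta> - free_weights \<eta>))\<^sup>2
     + (\<Sum>k\<in>UNIV. min 1 ((norm (component b k \<theta> - component b k \<eta>))\<^sup>2))"

lemma loss_le_norm: "loss \<theta> \<eta> \<le> (1 + real CARD('w option)) * (norm (\<theta> - \<eta>))\<^sup>2"
proof -
  have "(norm (free_weights \<theta> - free_weights \<eta>))\<^sup>2 = (\<Sum>l\<in>UNIV. ((\<theta> - \<eta>) $ Inl l)\<^sup>2)"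
    by (simp add: norm_vec_def L2_set_def free_weights_def sum_nonneg)
  also have "\<dots> = (\<Sum>i\<in>range Inl. ((\<theta> - \<eta>) $ i)\<^sup>2)" by (subst sum.reindex) auto
  also have "\<dots> \<le> (\<Sum>i\<in>UNIV. ((\<theta> - \<eta>) $ i)\<^sup>2)" by (rule sum_mono2) auto
  also have "\<dots> = (norm (\<theta> - \<eta>))\<^sup>2" by (simp add: norm_vec_def L2_set_def sum_nonneg)
  finally have 1: "(norm (free_weights \<theta> - free_weights \<eta>))\<^sup>2 \<le> (norm (\<theta> - \<eta>))\<^sup>2" .
  have 2: "(norm (component b k \<theta> - component b k \<eta>))\<^sup>2 \<le> (norm (\<theta> - \<eta>))\<^sup>2" for k
  proof -
    have "(norm (component b k \<theta> - component b k \<eta>))\<^sup>2 \<le> (\<Sum>j\<in>UNIV. ((\<theta> - \<eta>) $ Inr j)\<^sup>2)"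
      by (auto simp: norm_vec_def L2_set_def component_def sum_nonneg intro!: sum_mono)
    also have "\<dots> = (\<Sum>i\<in>range Inr. ((\<theta> - \<eta>) $ i)\<^sup>2)" by (subst sum.reindex) auto
    also have "\<dots> \<le> (\<Sum>i\<in>UNIV. ((\<theta> - \<eta>) $ i)\<^sup>2)" by (rule sum_mono2) auto
    also have "\<dots> = (norm (\<theta> - \<eta>))\<^sup>2" by (simp add: norm_vec_def L2_set_def sum_nonneg)
    finally show ?thesis .
  qed
  have "(\<Sum>k\<in>UNIV. min 1 ((norm (component b k \<theta> - component b k \<eta>))\<^sup>2)) \<le> (\<Sum>k\<in>(UNIV::'w option set). (norm (\<theta> - \<eta>))\<^sup>2)"
    by (rule sum_mono) (use 2 in \<open>auto simp: min_le_iff_disj\<close>)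
  also have "\<dots> = real CARD('w option) * (norm (\<theta> - \<eta>))\<^sup>2" by (rule sum_constant)
  finally show ?thesis unfolding loss_def distrib_right using 1 by linarith
qed

lemma loss_le_const:
  assumes "\<theta> \<in> \<Theta>" "\<eta> \<in> \<Theta>"
  shows "loss \<theta> \<eta> \<le> 2 * real CARD('w option)"
proof -
  have "(norm (free_weights \<theta> - free_weights \<eta>))\<^sup>2 = (\<Sum>l\<in>UNIV. (\<theta> $ Inl l - \<eta> $ Inl l)\<^sup>2)"
    by (simp add: norm_vec_def L2_set_def free_weights_def sum_nonneg)
  also have "\<dots> \<le> (\<Sum>l\<in>(UNIV::'w set). 1)"
  proof (rule sum_mono)
    fix l
    have "free_weights \<theta> $ l \<in> {0<..<1}" "free_weights \<eta> $ l \<in> {0<..<1}" using assms \<Theta>_subset by blast+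
    then have "\<bar>\<theta> $ Inl l - \<eta> $ Inl l\<bar> \<le> 1" by (auto simp: free_weights_def)
    then show "(\<theta> $ Inl l - \<eta> $ Inl l)\<^sup>2 \<le> 1" by (simp add: abs_square_le_1)
  qed
  finally have "(norm (free_weights \<theta> - free_weights \<eta>))\<^sup>2 \<le> real CARD('w)" by simp
  moreover have "(\<Sum>k\<in>UNIV. min 1 ((norm (component b k \<theta> - component b k \<eta>))\<^sup>2)) \<le> (\<Sum>k\<in>(UNIV::'w option set). 1)"
    by (rule sum_mono) auto
  moreover have "CARD('w) \<le> CARD('w option)" by (simp add: card_UNIV_option)
  ultimately show ?thesis by (simp add: loss_def)
qed

lemma hellinger_lower_bound:
  assumes \<theta>: "\<theta> \<in> \<Theta>" and pd: "positive_definite (Fisher_information \<mu> (mix_density b f) \<theta>)"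
    and ident: "\<And>a. a > 0 \<Longrightarrow> (INF \<eta>\<in>{\<eta> \<in> \<Theta>. norm (\<theta> - \<eta>) \<ge> a}.
              ereal (hellinger_sq (mix_measure \<mu> b f \<theta>) (mix_measure \<mu> b f \<eta>))) > 0"
  shows "\<exists>c>0. \<forall>\<eta>\<in>\<Theta>. c * loss \<theta> \<eta> \<le> hellinger_sq (mix_measure \<mu> b f \<theta>) (mix_measure \<mu> b f \<eta>)"
proof -
  let ?h = "\<lambda>\<eta>. hellinger_sq (mix_measure \<mu> b f \<theta>) (mix_measure \<mu> b f \<eta>)"
  obtain a c where ac: "a > 0" "c > 0" "\<And>\<eta>. \<eta> \<in> \<Theta> \<Longrightarrow> norm (\<theta> - \<eta>) < a \<Longrightarrow> c * (norm (\<theta> - \<eta>))\<^sup>2 \<le> ?h \<eta>"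
    using hellinger_local_lower_bound[OF \<theta> pd] by blast
  obtain e where e: "0 < ereal e" "ereal e < (INF \<eta>\<in>{\<eta> \<in> \<Theta>. norm (\<theta> - \<eta>) \<ge> a}. ereal (?h \<eta>))"
    using ereal_dense2[OF ident[OF ac(1)]] by blast
  have far: "e \<le> ?h \<eta>" if "\<eta> \<in> \<Theta>" "norm (\<theta> - \<eta>) \<ge> a" for \<eta>
  proof -
    have "(INF \<eta>\<in>{\<eta> \<in> \<Theta>. norm (\<theta> - \<eta>) \<ge> a}. ereal (?h \<eta>)) \<le> ereal (?h \<eta>)"
      by (rule INF_lower) (use that in auto)
    with e(2) have "ereal e < ereal (?h \<eta>)" by (rule less_le_trans)
    then show ?thesis by simp
  qed
  define K where "K = real CARD('w option)"
  have K: "K > 0" by (simp add: K_def)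
  define C where "C = min (c / (1 + K)) (e / (2 * K))"
  have "C > 0" using ac e K by (simp add: C_def)
  moreover have "C * loss \<theta> \<eta> \<le> ?h \<eta>" if \<eta>: "\<eta> \<in> \<Theta>" for \<eta>
  proof (cases "norm (\<theta> - \<eta>) < a")
    case True
    have "C * loss \<theta> \<eta> \<le> c / (1 + K) * ((1 + K) * (norm (\<theta> - \<eta>))\<^sup>2)"
      using loss_le_norm[of \<theta> \<eta>] \<open>C > 0\<close> ac K
      by (intro mult_mono) (auto simp: C_def K_def loss_def intro!: add_nonneg_nonneg sum_nonneg)
    also have "\<dots> = c * (norm (\<theta> - \<eta>))\<^sup>2" using K by simp
    also have "\<dots> \<le> ?h \<eta>" by (rule ac(3)[OF \<eta> True])
    finally show ?thesis .
  next
    case False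
    have "C * loss \<theta> \<eta> \<le> e / (2 * K) * (2 * K)"
      using loss_le_const[OF \<theta> \<eta>] \<open>C > 0\<close> e K
      by (intro mult_mono) (auto simp: C_def K_def loss_def intro!: add_nonneg_nonneg sum_nonneg)
    also have "\<dots> = e" using K by simp
    also have "\<dots> \<le> ?h \<eta>" using far[OF \<eta>] False by simp
    finally show ?thesis .
  qed
  ultimately show ?thesis by blast
qed

end

section \<open>Covering the normalized mixtures\<close>

lemma psi_ratio_eq:
  assumes "0 \<le> a" "0 < q" shows "psi_ratio a q = 1 - 2 * sqrt q / (sqrt a + sqrt q)"
proof -
  have "sqrt a + sqrt q > 0" using assms by (simp add: add_nonneg_pos)
  then show ?thesis by (simp add: psi_ratio_def field_simps)
qed

lemma abs_sqrt_diff_le: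
  assumes "0 \<le> a" "0 \<le> c" shows "\<bar>sqrt a - sqrt c\<bar> \<le> sqrt \<bar>a - c\<bar>"
proof (rule real_le_rsqrt)
  have "\<bar>sqrt a - sqrt c\<bar>\<^sup>2 \<le> \<bar>sqrt a - sqrt c\<bar> * (sqrt a + sqrt c)"
    unfolding power2_eq_square using assms by (intro mult_left_mono) (auto simp: abs_le_iff)
  also have "\<dots> = \<bar>(sqrt a - sqrt c) * (sqrt a + sqrt c)\<bar>" using assms by (simp add: abs_mult)
  also have "(sqrt a - sqrt c) * (sqrt a + sqrt c) = a - c" using assms by (simp add: algebra_simps)
  finally show "\<bar>sqrt a - sqrt c\<bar>\<^sup>2 \<le> \<bar>a - c\<bar>" .
qed

lemma psi_ratio_diff_le:
  assumes "0 \<le> a" "0 \<le> a'" "0 < q"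
  shows "\<bar>psi_ratio a q - psi_ratio a' q\<bar> \<le> 2 * sqrt (\<bar>a - a'\<bar> / q)"
proof -
  have pos: "sqrt a + sqrt q > 0" "sqrt a' + sqrt q > 0" using assms by (auto simp: add_nonneg_pos)
  have "psi_ratio a q - psi_ratio a' q = 2 * sqrt q * (sqrt a - sqrt a') / ((sqrt a + sqrt q) * (sqrt a' + sqrt q))"
    unfolding psi_ratio_eq[OF assms(1,3)] psi_ratio_eq[OF assms(2,3)] using pos by (simp add: field_simps)
  then have "\<bar>psi_ratio a q - psi_ratio a' q\<bar> = 2 * sqrt q * \<bar>sqrt a - sqrt a'\<bar> / ((sqrt a + sqrt q) * (sqrt a' + sqrt q))"
    using pos assms by (simp add: abs_mult abs_divide)
  also have "\<dots> \<le> 2 * sqrt q * \<bar>sqrt a - sqrt a'\<bar> / (sqrt q * sqrt q)"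
    using assms pos by (intro divide_left_mono mult_mono) auto
  also have "\<dots> = 2 * (\<bar>sqrt a - sqrt a'\<bar> / sqrt q)" using assms by (simp add: field_simps)
  also have "\<dots> \<le> 2 * (sqrt \<bar>a - a'\<bar> / sqrt q)"
    using abs_sqrt_diff_le[OF assms(1,2)] assms by (intro mult_left_mono divide_right_mono) auto
  finally show ?thesis by (simp add: real_sqrt_divide)
qed

text \<open>
  The first threshold at or above \<open>r'\<close> is less than one step above \<open>r'\<close>, and it is not exceeded by \<open>r\<close>
  either.
\<close>

lemma same_thresholds_close:
  fixes r r' q :: real and m :: nat
  assumes q: "0 < q" and m: "0 < m" and r: "0 \<le> r'" "r' \<le> real m * q"
    and same: "\<And>j. j \<le> m\<^sup>2 \<Longrightarrow> (real j / real m * q < r \<longleftrightarrow> real j / real m * q < r')"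
  shows "r \<le> r' + q / real m"
proof (rule ccontr)
  assume neg: "\<not> ?thesis"
  define j where "j = nat \<lceil>r' * real m / q\<rceil>"
  have nn: "0 \<le> r' * real m / q" using r q m by simp
  have j1: "r' * real m / q \<le> real j" unfolding j_def using nn by (simp add: of_nat_ceiling)
  have j2: "real j < r' * real m / q + 1" unfolding j_def using nn by linarith
  have "r' * real m / q \<le> real (m\<^sup>2)"
    using r q m by (simp add: pos_divide_le_eq power2_eq_square mult_ac mult_left_mono)
  then have jm: "j \<le> m\<^sup>2" unfolding j_def by (simp add: nat_le_iff ceiling_le_iff)
  have "\<not> real j / real m * q < r'" using j1 q m by (simp add: field_simps)
  moreover have "real j / real m * q < r"
  proof -
    have "real j / real m * q < (r' * real m / q + 1) / real m * q"
      using j2 q m by (intro mult_strict_right_mono divide_strict_right_mono) auto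
    also have "\<dots> = r' + q / real m" using q m by (simp add: field_simps)
    finally show ?thesis using neg by linarith
  qed
  ultimately show False using same[OF jm] by blast
qed

text \<open>
  Here \<open>r k\<close> is a component density at a point and \<open>q\<close> the reference density there.  If some component
  exceeds the largest threshold \<open>m q\<close>, then so does its counterpart, both mixtures are at least
  \<open>\<delta> m q\<close> and both values of \<open>\<psi>\<close> are close to \<open>1\<close>.  Otherwise all components agree up to \<open>q/m\<close>, hence
  the mixtures up to a multiple of \<open>q/m\<close>, and \<open>\<psi>(sqrt r)\<close> is Hoelder continuous in \<open>r\<close> of exponent
  one half.  If \<open>q = 0\<close>, then \<open>\<psi>\<close> only depends on whether the mixture vanishes, which the comparison
  with the threshold \<open>0\<close> decides because the weights are positive.
\<close>

lemma mixture_psi_close: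
  fixes w w' r r' :: "'k::finite \<Rightarrow> real" and q \<delta> :: real and m :: nat
  assumes q: "0 \<le> q" and m: "0 < m" and \<delta>: "0 < \<delta>"
    and w: "\<And>k. \<delta> \<le> w k \<and> w k \<le> 1" "\<And>k. \<delta> \<le> w' k \<and> w' k \<le> 1"
    and ww: "\<And>k. \<bar>w k - w' k\<bar> \<le> 1 / (real m)\<^sup>2"
    and r: "\<And>k. 0 \<le> r k" "\<And>k. 0 \<le> r' k"
    and same: "\<And>k j. j \<le> m\<^sup>2 \<Longrightarrow> (real j / real m * q < r k \<longleftrightarrow> real j / real m * q < r' k)"
  shows "\<bar>psi_ratio (\<Sum>k\<in>UNIV. w k * r k) q - psi_ratio (\<Sum>k\<in>UNIV. w' k * r' k) q\<bar>
     \<le> 2 / sqrt (\<delta> * real m) + 2 * sqrt (2 * real CARD('k) / real m)"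
proof -
  let ?a = "\<Sum>k\<in>UNIV. w k * r k" and ?a' = "\<Sum>k\<in>UNIV. w' k * r' k"
  have w0: "0 \<le> w k" "0 \<le> w' k" for k using w \<delta> by (smt (verit))+
  have a0: "0 \<le> ?a" "0 \<le> ?a'" using w0 r by (auto intro!: sum_nonneg)
  show ?thesis
  proof (cases "q = 0")
    case True
    have wpos: "w k > 0" "w' k > 0" for k using w \<delta> by (smt (verit))+
    have "r k = 0 \<longleftrightarrow> r' k = 0" for k using same[of 0 k] True r[of k] by auto
    then have "?a = 0 \<longleftrightarrow> ?a' = 0"
      using w0 r wpos by (subst (1 2) sum_nonneg_eq_0_iff) (auto simp: less_imp_neq[symmetric])
    moreover have "psi_ratio a q = (if a = 0 then 0 else 1)" for a using True by (simp add: psi_ratio_def)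
    ultimately have "psi_ratio ?a q - psi_ratio ?a' q = 0" by simp
    then show ?thesis using \<delta> m by simp
  next
    case False
    then have q0: "q > 0" using q by simp
    show ?thesis
    proof (cases "\<exists>k. real m * q < r k")
      case True
      then obtain k where k: "real m * q < r k" by blast
      have "real (m\<^sup>2) / real m * q = real m * q" using m by (simp add: power2_eq_square)
      then have k': "real m * q < r' k" using same[of "m\<^sup>2" k] k by simp
      have big: "1 - 2 / sqrt (\<delta> * real m) \<le> psi_ratio s q \<and> psi_ratio s q \<le> 1" if s: "\<delta> * (real m * q) \<le> s" for s
      proof -
        have s0: "0 < s" using s q0 m \<delta> by (smt (verit) mult_pos_pos of_nat_0_less_iff)
        have "sqrt (\<delta> * real m) * sqrt q \<le> sqrt s"
          using s by (simp add: mult.assoc flip: real_sqrt_mult)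
        also have "\<dots> \<le> sqrt s + sqrt q" using q0 by simp
        finally have "2 * sqrt q / (sqrt s + sqrt q) \<le> 2 * sqrt q / (sqrt (\<delta> * real m) * sqrt q)"
          using q0 s0 \<delta> m by (intro divide_left_mono) (auto simp: add_pos_pos)
        also have "\<dots> = 2 / sqrt (\<delta> * real m)" using q0 by simp
        finally show ?thesis
          using s0 q0 by (simp add: psi_ratio_eq)
      qed
      have "\<delta> * (real m * q) \<le> w k * r k" using w w0 k \<delta> q0 m by (intro mult_mono) auto
      also have "\<dots> \<le> ?a" by (rule member_le_sum) (use w0 r in auto)
      finally have A: "\<delta> * (real m * q) \<le> ?a" .
      have "\<delta> * (real m * q) \<le> w' k * r' k" using w w0 k' \<delta> q0 m by (intro mult_mono) auto
      also have "\<dots> \<le> ?a'" by (rule member_le_sum) (use w0 r in auto)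
      finally have A': "\<delta> * (real m * q) \<le> ?a'" .
      have "\<bar>psi_ratio ?a q - psi_ratio ?a' q\<bar> \<le> 2 / sqrt (\<delta> * real m)"
        using big[OF A] big[OF A'] by linarith
      also have "\<dots> \<le> 2 / sqrt (\<delta> * real m) + 2 * sqrt (2 * real CARD('k) / real m)" by simp
      finally show ?thesis .
    next
      case False
      then have rk: "r k \<le> real m * q" for k by (simp add: not_less)
      have "real (m\<^sup>2) / real m * q = real m * q" using m by (simp add: power2_eq_square)
      then have rk': "r' k \<le> real m * q" for k using same[of "m\<^sup>2" k] rk[of k] by (simp add: not_less[symmetric])
      have rr: "\<bar>r k - r' k\<bar> \<le> q / real m" for k
        using same_thresholds_close[OF q0 m r(2) rk' same, of k]
          same_thresholds_close[OF q0 m r(1) rk same[symmetric], of k] by linarith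
      have "\<bar>?a - ?a'\<bar> \<le> (\<Sum>k\<in>UNIV. \<bar>w k * r k - w' k * r' k\<bar>)"
        by (simp flip: sum_subtractf)
      also have "\<dots> \<le> (\<Sum>k\<in>(UNIV::'k set). 2 * (q / real m))"
      proof (rule sum_mono)
        fix k
        have "w k * r k - w' k * r' k = (w k - w' k) * r k + w' k * (r k - r' k)" by (simp add: algebra_simps)
        then have "\<bar>w k * r k - w' k * r' k\<bar> \<le> \<bar>w k - w' k\<bar> * \<bar>r k\<bar> + \<bar>w' k\<bar> * \<bar>r k - r' k\<bar>"
          by (metis abs_mult abs_triangle_ineq)
        also have "\<dots> \<le> 1 / (real m)\<^sup>2 * (real m * q) + 1 * (q / real m)"
          using ww rk r rr w w0 q m by (intro add_mono mult_mono) auto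
        also have "\<dots> = 2 * (q / real m)" using m by (simp add: power2_eq_square field_simps)
        finally show "\<bar>w k * r k - w' k * r' k\<bar> \<le> 2 * (q / real m)" .
      qed
      also have "\<dots> = (2 * real CARD('k) / real m) * q" by simp
      finally have "\<bar>?a - ?a'\<bar> / q \<le> 2 * real CARD('k) / real m" using q0 by (simp add: pos_divide_le_eq)
      then have "2 * sqrt (\<bar>?a - ?a'\<bar> / q) \<le> 2 * sqrt (2 * real CARD('k) / real m)" by simp
      moreover have "\<bar>psi_ratio ?a q - psi_ratio ?a' q\<bar> \<le> 2 * sqrt (\<bar>?a - ?a'\<bar> / q)"
        by (rule psi_ratio_diff_le[OF a0 q0])
      moreover have "0 \<le> 2 / sqrt (\<delta> * real m)" using \<delta> by simp
      ultimately show ?thesis by linarith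
    qed
  qed
qed

context mixture_model begin

definition mix_params :: "real \<Rightarrow> (real ^ ('w + 'j)) set" where
  "mix_params \<delta> = {\<theta> \<in> \<Theta>. \<forall>k. \<delta> \<le> weight \<theta> k \<and> weight \<theta> k \<in> \<rat> \<and> component b k \<theta> \<in> B k}"

lemma mix_subclass_eq: "mix_subclass b f B \<Theta> \<delta> = mix_density b f ` mix_params \<delta>"
  unfolding mix_subclass_def mix_params_def by auto

lemma weight_le_1: "\<theta> \<in> \<Theta> \<Longrightarrow> weight \<theta> k \<le> 1"
  using weight_sum[of \<theta>] member_le_sum[of k UNIV "weight \<theta>"] weight_pos[of \<theta>] by (simp add: less_imp_le)

text \<open>
  A parameter is determined by its weights and its components, which range over countable sets.
\<close>

lemma countable_mix_params: "countable (mix_params \<delta>)"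
proof -
  let ?g = "\<lambda>\<theta>. (weight \<theta>, \<lambda>k. component b k \<theta>) :: ('w option \<Rightarrow> real) \<times> ('w option \<Rightarrow> real ^ 'j)"
  have "inj_on ?g (mix_params \<delta>)"
  proof (rule inj_onI)
    fix \<theta> \<eta> assume "?g \<theta> = ?g \<eta>"
    then have w: "weight \<theta> k = weight \<eta> k" and c: "component b k \<theta> $ j = component b k \<eta> $ j" for k j
      by (auto simp: fun_eq_iff)
    have "\<theta> $ i = \<eta> $ i" for i
    proof (cases i)
      case (Inl l) then show ?thesis using w[of "Some l"] by (simp add: weight_def)
    next
      case (Inr j) then show ?thesis using c[of "b j" j] by (simp add: component_def)
    qed
    then show "\<theta> = \<eta>" by (simp add: vec_eq_iff)
  qed
  moreover have "?g ` mix_params \<delta> \<subseteq> (UNIV \<rightarrow>\<^sub>E \<rat>) \<times> Pi\<^sub>E UNIV B"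
    by (auto simp: mix_params_def PiE_def)
  moreover have "countable ((UNIV \<rightarrow>\<^sub>E \<rat>) \<times> Pi\<^sub>E UNIV B :: (('w option \<Rightarrow> real) \<times> ('w option \<Rightarrow> real ^ 'j)) set)"
    by (intro countable_SIGMA countable_PiE B_countable countable_rat) auto
  ultimately show ?thesis by (meson countable_image_inj_on countable_subset)
qed

text \<open>
  The code of a parameter consists of the trace of each component's subgraph on the set \<open>S\<close> of sample
  points paired with multiples of the reference density, together with the rounded weights.
\<close>

lemma ex_mixture_code:
  fixes z :: "nat \<Rightarrow> 'a" and m N :: nat
  assumes m: "0 < m" and \<delta>: "0 < \<delta>" and \<theta>0: "\<theta>0 \<in> \<Theta>"
    and z: "\<And>i. i \<in> {1..N} \<Longrightarrow> z i \<in> space \<mu>"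
  shows "\<exists>code :: real ^ ('w + 'j) \<Rightarrow> ('w option \<Rightarrow> ('a \<times> real) set) \<times> ('w option \<Rightarrow> nat).
    finite (code ` mix_params \<delta>) \<and>
    card (code ` mix_params \<delta>) \<le> (N * (m\<^sup>2 + 1) + 1) ^ (\<Sum>k\<in>UNIV. V k) * (m\<^sup>2 + 1) ^ CARD('w option) \<and>
    (\<forall>\<theta>\<in>mix_params \<delta>. \<forall>\<eta>\<in>mix_params \<delta>. code \<theta> = code \<eta> \<longrightarrow> (\<forall>i\<in>{1..N}.
       \<bar>psi_ratio (mix_density b f \<theta> (z i)) (mix_density b f \<theta>0 (z i))
         - psi_ratio (mix_density b f \<eta> (z i)) (mix_density b f \<theta>0 (z i))\<bar>
       \<le> 2 / sqrt (\<delta> * real m) + 2 * sqrt (2 * real CARD('w option) / real m)))"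
proof -
  let ?q = "mix_density b f \<theta>0"
  define S where "S = (\<lambda>(i, j). (z i, real j / real m * ?q (z i))) ` ({1..N} \<times> {..m\<^sup>2})"
  have finS: "finite S" by (simp add: S_def)
  have "card S \<le> card ({1..N} \<times> {..m\<^sup>2})" unfolding S_def by (rule card_image_le) simp
  then have cardS: "card S \<le> N * (m\<^sup>2 + 1)" by (simp add: card_cartesian_product)
  have SX: "S \<subseteq> space \<mu> \<times> UNIV" using z by (auto simp: S_def)
  define code where "code \<theta> = (\<lambda>k. S \<inter> subgraph (f k (component b k \<theta>)), \<lambda>k. nat \<lfloor>weight \<theta> k * real (m\<^sup>2)\<rfloor>)" for \<theta> :: "real ^ ('w + 'j)"
  let ?Tr = "\<lambda>k. (\<lambda>g. S \<inter> subgraph g) ` f k ` A k"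
  have params: "\<theta> \<in> \<Theta>" "\<delta> \<le> weight \<theta> k" if "\<theta> \<in> mix_params \<delta>" for \<theta> k
    using that by (auto simp: mix_params_def)
  have sub: "code ` mix_params \<delta> \<subseteq> Pi\<^sub>E UNIV ?Tr \<times> (UNIV \<rightarrow>\<^sub>E {..m\<^sup>2})"
  proof (rule image_subsetI)
    fix \<theta> assume \<theta>: "\<theta> \<in> mix_params \<delta>"
    have 1: "fst (code \<theta>) \<in> Pi\<^sub>E UNIV ?Tr"
      using component_in_A[OF params(1)[OF \<theta>]] by (auto simp: code_def)
    have "\<lfloor>weight \<theta> k * real (m\<^sup>2)\<rfloor> \<le> int (m\<^sup>2)" for k
    proof -
      have "weight \<theta> k * real (m\<^sup>2) \<le> 1 * real (m\<^sup>2)"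
        by (rule mult_right_mono[OF weight_le_1[OF params(1)[OF \<theta>]]]) simp
      then show ?thesis by (simp add: floor_le_iff)
    qed
    then have "snd (code \<theta>) \<in> UNIV \<rightarrow>\<^sub>E {..m\<^sup>2}"
      by (auto simp: code_def nat_le_iff)
    with 1 show "code \<theta> \<in> Pi\<^sub>E UNIV ?Tr \<times> (UNIV \<rightarrow>\<^sub>E {..m\<^sup>2})" by (simp add: mem_Times_iff)
  qed
  have finTr: "finite (?Tr k)" for k
    by (rule finite_subset[of _ "Pow S"]) (use finS in auto)
  have finP: "finite (Pi\<^sub>E UNIV ?Tr \<times> (UNIV \<rightarrow>\<^sub>E {..m\<^sup>2}) :: (('w option \<Rightarrow> ('a \<times> real) set) \<times> ('w option \<Rightarrow> nat)) set)"
    using finTr by (intro finite_cartesian_product finite_PiE) auto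
  have "card (code ` mix_params \<delta>) \<le> card (Pi\<^sub>E UNIV ?Tr \<times> (UNIV \<rightarrow>\<^sub>E {..m\<^sup>2}) :: (('w option \<Rightarrow> ('a \<times> real) set) \<times> ('w option \<Rightarrow> nat)) set)"
    by (rule card_mono[OF finP sub])
  also have "\<dots> = (\<Prod>k\<in>UNIV. card (?Tr k)) * (m\<^sup>2 + 1) ^ CARD('w option)"
    by (simp add: card_cartesian_product card_PiE)
  also have "(\<Prod>k\<in>UNIV. card (?Tr k)) \<le> (\<Prod>k\<in>UNIV. (N * (m\<^sup>2 + 1) + 1) ^ V k)"
  proof (rule prod_mono, safe)
    fix k
    have "card (?Tr k) \<le> (card S + 1) ^ V k"
      by (rule card_subgraph_traces_le[OF VC VC_bound finS SX])
    also have "\<dots> \<le> (N * (m\<^sup>2 + 1) + 1) ^ V k" using cardS by (intro power_mono) auto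
    finally show "card (?Tr k) \<le> (N * (m\<^sup>2 + 1) + 1) ^ V k" .
  qed
  also have "(\<Prod>k\<in>UNIV. (N * (m\<^sup>2 + 1) + 1) ^ V k) = (N * (m\<^sup>2 + 1) + 1) ^ (\<Sum>k\<in>UNIV. V k)"
    by (simp add: power_sum)
  finally have card: "card (code ` mix_params \<delta>) \<le> (N * (m\<^sup>2 + 1) + 1) ^ (\<Sum>k\<in>UNIV. V k) * (m\<^sup>2 + 1) ^ CARD('w option)"
    by simp
  have close: "\<bar>psi_ratio (mix_density b f \<theta> (z i)) (?q (z i)) - psi_ratio (mix_density b f \<eta> (z i)) (?q (z i))\<bar>
       \<le> 2 / sqrt (\<delta> * real m) + 2 * sqrt (2 * real CARD('w option) / real m)"
    if \<theta>: "\<theta> \<in> mix_params \<delta>" and \<eta>: "\<eta> \<in> mix_params \<delta>" and eq: "code \<theta> = code \<eta>" and i: "i \<in> {1..N}" for \<theta> \<eta> i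
    unfolding mix_density_def[of b f \<theta>] mix_density_def[of b f \<eta>]
  proof (rule mixture_psi_close[OF _ m \<delta>])
    show "0 \<le> ?q (z i)" by (rule mix_density_nonneg[OF \<theta>0 z[OF i]])
    show "\<delta> \<le> weight \<theta> k \<and> weight \<theta> k \<le> 1" "\<delta> \<le> weight \<eta> k \<and> weight \<eta> k \<le> 1" for k
      using params \<theta> \<eta> weight_le_1 by auto
    show "0 \<le> f k (component b k \<theta>) (z i)" "0 \<le> f k (component b k \<eta>) (z i)" for k
      using params(1) \<theta> \<eta> by (auto intro!: density_nonneg component_in_A z i)
    show "\<bar>weight \<theta> k - weight \<eta> k\<bar> \<le> 1 / (real m)\<^sup>2" for k
    proof -
      have p: "0 \<le> weight \<theta> k * real (m\<^sup>2)" "0 \<le> weight \<eta> k * real (m\<^sup>2)"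
        using weight_pos params(1) \<theta> \<eta> by (auto simp: less_imp_le)
      have "nat \<lfloor>weight \<theta> k * real (m\<^sup>2)\<rfloor> = nat \<lfloor>weight \<eta> k * real (m\<^sup>2)\<rfloor>"
        using eq by (auto simp: code_def dest: fun_cong)
      then have "\<lfloor>weight \<theta> k * real (m\<^sup>2)\<rfloor> = \<lfloor>weight \<eta> k * real (m\<^sup>2)\<rfloor>" using p by (simp add: eq_nat_nat_iff)
      then have "\<bar>weight \<theta> k * real (m\<^sup>2) - weight \<eta> k * real (m\<^sup>2)\<bar> \<le> 1" by linarith
      then have "\<bar>weight \<theta> k - weight \<eta> k\<bar> * real (m\<^sup>2) \<le> 1"
        by (simp add: abs_mult flip: left_diff_distrib)
      then show ?thesis using m by (simp add: pos_le_divide_eq)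
    qed
    show "(real j / real m * ?q (z i) < f k (component b k \<theta>) (z i)) = (real j / real m * ?q (z i) < f k (component b k \<eta>) (z i))"
      if j: "j \<le> m\<^sup>2" for k j
    proof -
      have "S \<inter> subgraph (f k (component b k \<theta>)) = S \<inter> subgraph (f k (component b k \<eta>))"
        using eq by (auto simp: code_def dest: fun_cong)
      moreover have "(z i, real j / real m * ?q (z i)) \<in> S" using i j by (auto simp: S_def)
      ultimately have "(z i, real j / real m * ?q (z i)) \<in> subgraph (f k (component b k \<theta>)) \<longleftrightarrow>
          (z i, real j / real m * ?q (z i)) \<in> subgraph (f k (component b k \<eta>))" by blast
      then show ?thesis by (simp add: subgraph_def)
    qed
  qed
  show ?thesis
    by (rule exI[of _ code]) (use card close finite_subset[OF sub finP] in blast)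
qed

section \<open>Risk of the \<open>\<rho>\<close>-estimator\<close>

text \<open>
  Rational weights and elements of the sets \<open>B k\<close> can be chosen so as to converge to \<open>\<theta>\<close>.  The
  densities then converge almost everywhere, hence in \<open>L\<^sub>1(\<mu>)\<close> by Scheffe's lemma, and
  \<open>(sqrt a - sqrt b)\<^sup>2 \<le> \<bar>a - b\<bar>\<close> turns this into Hellinger convergence.
\<close>

lemma mix_params_dense:
  assumes \<theta>: "\<theta> \<in> \<Theta>" and \<epsilon>: "0 < \<epsilon>" and \<delta>: "\<And>k. \<delta> < weight \<theta> k"
  shows "\<exists>\<eta>\<in>mix_params \<delta>. hellinger_sq (mix_measure \<mu> b f \<theta>) (mix_measure \<mu> b f \<eta>) < \<epsilon>"
proof -
  have "\<exists>\<eta> :: real ^ ('w + 'j). (\<forall>i. \<bar>\<eta> $ i - \<theta> $ i\<bar> \<le> inverse (real (Suc m))) \<and>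
      (\<forall>k. weight \<eta> k \<in> \<rat> \<and> component b k \<eta> \<in> B k)" for m
  proof -
    let ?e = "inverse (real (Suc m))"
    have "\<exists>r\<in>\<rat>. \<bar>r - \<theta> $ Inl l\<bar> \<le> ?e" for l
    proof -
      have "\<theta> $ Inl l - ?e < \<theta> $ Inl l + ?e" by (simp add: add_strict_increasing)
      then obtain r where "r \<in> \<rat>" "\<theta> $ Inl l - ?e < r" "r < \<theta> $ Inl l + ?e" using Rats_dense_in_real by blast
      then show ?thesis by (intro bexI[of _ r]) auto
    qed
    then obtain \<rho> where \<rho>: "\<And>l. \<rho> l \<in> \<rat>" "\<And>l. \<bar>\<rho> l - \<theta> $ Inl l\<bar> \<le> ?e" by metis
    have "\<exists>u\<in>B k. dist u (component b k \<theta>) < ?e" for k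
      using B_dense[of k] component_in_A[OF \<theta>, of k] closure_approachable[of "component b k \<theta>" "B k"] by auto
    then obtain \<beta> where \<beta>: "\<And>k. \<beta> k \<in> B k" "\<And>k. dist (\<beta> k) (component b k \<theta>) < ?e" by metis
    define \<eta> :: "real ^ ('w + 'j)" where "\<eta> = (\<chi> i. case i of Inl l \<Rightarrow> \<rho> l | Inr j \<Rightarrow> \<beta> (b j) $ j)"
    have "component b k \<eta> = \<beta> k" for k
    proof -
      have "\<beta> k \<in> block b k" using \<beta>(1) B_subset A_subset by blast
      then show ?thesis by (auto simp: component_def \<eta>_def vec_eq_iff block_def)
    qed
    moreover have "weight \<eta> k \<in> \<rat>" for k
      using \<rho>(1) by (cases k) (auto simp: weight_def \<eta>_def intro!: Rats_diff Rats_1 Rats_sum)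
    moreover have "\<bar>\<eta> $ i - \<theta> $ i\<bar> \<le> ?e" for i
    proof (cases i)
      case (Inl l) then show ?thesis using \<rho>(2)[of l] by (simp add: \<eta>_def)
    next
      case (Inr j)
      have "\<bar>(\<beta> (b j) - component b (b j) \<theta>) $ j\<bar> \<le> dist (\<beta> (b j)) (component b (b j) \<theta>)"
        unfolding dist_norm by (rule component_le_norm_cart)
      then show ?thesis using \<beta>(2)[of "b j"] Inr by (simp add: \<eta>_def component_def)
    qed
    ultimately show ?thesis using \<beta>(1) by (intro exI[of _ \<eta>]) auto
  qed
  then obtain y0 :: "nat \<Rightarrow> real ^ ('w + 'j)" where y0: "\<And>m i. \<bar>y0 m $ i - \<theta> $ i\<bar> \<le> inverse (real (Suc m))"
    "\<And>m k. weight (y0 m) k \<in> \<rat>" "\<And>m k. component b k (y0 m) \<in> B k" by metis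
  have lim0: "y0 \<longlonglongrightarrow> \<theta>"
  proof (rule vec_tendstoI)
    fix i
    have "(\<lambda>m. y0 m $ i - \<theta> $ i) \<longlonglongrightarrow> 0"
      by (rule Lim_null_comparison[OF _ LIMSEQ_inverse_real_of_nat]) (use y0(1) in auto)
    then show "(\<lambda>m. y0 m $ i) \<longlonglongrightarrow> \<theta> $ i" by (rule LIM_zero_cancel)
  qed
  have "\<forall>\<^sub>F m in sequentially. y0 m \<in> \<Theta>" by (rule topological_tendstoD[OF lim0 \<Theta>_open \<theta>])
  moreover have "\<forall>\<^sub>F m in sequentially. \<forall>k. \<delta> \<le> weight (y0 m) k"
  proof (rule eventually_all_finite)
    fix k
    have "(\<lambda>m. weight (y0 m) k) \<longlonglongrightarrow> weight \<theta> k"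
      using continuous_within_tendsto_compose'[OF continuous_weight[of \<theta> UNIV k] _ lim0] by simp
    then have "\<forall>\<^sub>F m in sequentially. \<delta> < weight (y0 m) k" by (rule order_tendstoD(1)[OF _ \<delta>])
    then show "\<forall>\<^sub>F m in sequentially. \<delta> \<le> weight (y0 m) k" by eventually_elim simp
  qed
  ultimately have "\<forall>\<^sub>F m in sequentially. y0 m \<in> mix_params \<delta>"
    by eventually_elim (use y0 in \<open>auto simp: mix_params_def\<close>)
  then obtain m0 where m0: "\<And>m. m \<ge> m0 \<Longrightarrow> y0 m \<in> mix_params \<delta>" by (auto simp: eventually_sequentially)
  \<comment> \<open>Discarding finitely many terms, every term is an admissible parameter and has a density.\<close>
  define y where "y m = y0 (m + m0)" for m
  have y: "y m \<in> mix_params \<delta>" for m using m0 by (simp add: y_def)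
  then have yT: "y m \<in> \<Theta>" for m by (auto simp: mix_params_def)
  have lim: "y \<longlonglongrightarrow> \<theta>" unfolding y_def using lim0 by (rule LIMSEQ_ignore_initial_segment)
  let ?p = "\<lambda>\<theta> x. max 0 (mix_density b f \<theta> x)"
  have mp: "mix_measure \<mu> b f \<zeta> = density \<mu> (\<lambda>x. ennreal (?p \<zeta> x))" for \<zeta>
    by (simp add: mix_measure_def)
  have dens: "?p \<zeta> \<in> borel_measurable \<mu>" "integrable \<mu> (?p \<zeta>)" "(\<integral>\<^sup>+x. norm (?p \<zeta> x) \<partial>\<mu>) = 1" if "\<zeta> \<in> \<Theta>" for \<zeta>
  proof -
    show m: "?p \<zeta> \<in> borel_measurable \<mu>" using mix_density_measurable[OF that] by measurable
    show int: "integrable \<mu> (?p \<zeta>)"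
      using density_prob_integral(1)[OF m] prob_space_mix[OF that] unfolding mp by simp
    have "(\<integral>x. ?p \<zeta> x \<partial>\<mu>) = 1"
      using density_prob_integral(2)[OF m] prob_space_mix[OF that] unfolding mp by simp
    then show "(\<integral>\<^sup>+x. norm (?p \<zeta> x) \<partial>\<mu>) = 1"
      using nn_integral_eq_integral[OF int] by simp
  qed
  have "AE x in \<mu>. \<forall>k\<in>UNIV. continuous_on (A k) (\<lambda>\<alpha>. f k \<alpha> x)"
    using continuous by (intro AE_finite_allI) auto
  then have ae: "AE x in \<mu>. (\<lambda>m. ?p (y m) x) \<longlonglongrightarrow> ?p \<theta> x"
  proof eventually_elim
    case (elim x)
    have "(\<lambda>m. f k (component b k (y m)) x) \<longlonglongrightarrow> f k (component b k \<theta>) x" for k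
    proof (rule continuous_on_tendsto_compose[where f="\<lambda>\<alpha>. f k \<alpha> x"])
      show "continuous_on (A k) (\<lambda>\<alpha>. f k \<alpha> x)" using elim by blast
      show "(\<lambda>m. component b k (y m)) \<longlonglongrightarrow> component b k \<theta>"
        by (rule bounded_linear.tendsto[OF bounded_linear_component lim])
    qed (use component_in_A yT \<theta> in auto)
    moreover have "(\<lambda>m. weight (y m) k) \<longlonglongrightarrow> weight \<theta> k" for k
      using continuous_within_tendsto_compose'[OF continuous_weight[of \<theta> UNIV k] _ lim] by simp
    ultimately have "(\<lambda>m. max 0 (\<Sum>k\<in>UNIV. weight (y m) k * f k (component b k (y m)) x))
        \<longlonglongrightarrow> max 0 (\<Sum>k\<in>UNIV. weight \<theta> k * f k (component b k \<theta>) x)"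
      by (intro tendsto_max tendsto_const tendsto_sum tendsto_mult)
    then show ?case by (simp add: mix_density_def)
  qed
  have L1: "(\<lambda>m. \<integral>\<^sup>+x. norm (?p (y m) x - ?p \<theta> x) \<partial>\<mu>) \<longlonglongrightarrow> 0"
    by (rule Scheffe_lemma2[OF dens(1)[OF yT] dens(2)[OF \<theta>] ae]) (use dens(3) yT \<theta> in simp)
  have "\<forall>\<^sub>F m in sequentially. (\<integral>\<^sup>+x. norm (?p (y m) x - ?p \<theta> x) \<partial>\<mu>) < ennreal \<epsilon>"
    by (rule order_tendstoD(2)[OF L1]) (use \<epsilon> in simp)
  then obtain m where m: "(\<integral>\<^sup>+x. norm (?p (y m) x - ?p \<theta> x) \<partial>\<mu>) < ennreal \<epsilon>"
    using eventually_happens[of _ sequentially] by auto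
  have "hellinger_sq (mix_measure \<mu> b f \<theta>) (mix_measure \<mu> b f (y m)) = 1/2 * (\<integral>x. (sqrt (?p \<theta> x) - sqrt (?p (y m) x))\<^sup>2 \<partial>\<mu>)"
    unfolding mp by (rule hellinger_sq_density[OF sigma_finite_measure_axioms dens(1)[OF \<theta>] dens(1)[OF yT]]) auto
  also have "\<dots> \<le> 1/2 * (\<integral>x. norm (?p (y m) x - ?p \<theta> x) \<partial>\<mu>)"
  proof (intro mult_left_mono integral_mono)
    show "integrable \<mu> (\<lambda>x. (sqrt (?p \<theta> x) - sqrt (?p (y m) x))\<^sup>2)"
      by (rule integrable_sqrt_diff_sq[OF dens(2)[OF \<theta>] dens(2)[OF yT]]) auto
    show "integrable \<mu> (\<lambda>x. norm (?p (y m) x - ?p \<theta> x))"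
      by (intro integrable_norm Bochner_Integration.integrable_diff dens(2) \<theta> yT)
    fix x
    have "\<bar>sqrt (?p \<theta> x) - sqrt (?p (y m) x)\<bar>\<^sup>2 \<le> (sqrt \<bar>?p \<theta> x - ?p (y m) x\<bar>)\<^sup>2"
      by (rule power_mono[OF abs_sqrt_diff_le]) auto
    then show "(sqrt (?p \<theta> x) - sqrt (?p (y m) x))\<^sup>2 \<le> norm (?p (y m) x - ?p \<theta> x)"
      by (simp add: abs_minus_commute)
  qed simp
  also have "\<dots> < \<epsilon>"
  proof -
    have "(\<integral>\<^sup>+x. norm (?p (y m) x - ?p \<theta> x) \<partial>\<mu>) = ennreal (\<integral>x. norm (?p (y m) x - ?p \<theta> x) \<partial>\<mu>)"
      by (rule nn_integral_eq_integral)
         (auto intro!: integrable_norm Bochner_Integration.integrable_diff dens(2) \<theta> yT)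
    then have "(\<integral>x. norm (?p (y m) x - ?p \<theta> x) \<partial>\<mu>) < \<epsilon>"
      using m by (simp add: ennreal_less_iff)
    then show ?thesis using \<epsilon> by simp
  qed
  finally show ?thesis using y by blast
qed


lemma V_ge_1: "1 \<le> V k"
  using VC_index_pos[OF VC, of k] VC_bound[of k] by linarith

lemma card_le_sum_V: "CARD('w option) \<le> (\<Sum>k\<in>UNIV. V k)"
proof -
  have "(\<Sum>k\<in>(UNIV::'w option set). 1) \<le> (\<Sum>k\<in>UNIV. V k)" by (rule sum_mono) (rule V_ge_1)
  then show ?thesis by simp
qed

text \<open>
  The deviation bound is applied to \<open>g + g\<^sup>2/128\<close> instead of \<open>g = \<psi>(sqrt (q/q\<^sub>0))\<close>.  The added term
  absorbs the random part \<open>\<phi>(X\<^sub>i)\<^sup>2/512\<close> of the penalty, so that only the expectations of \<open>g\<close> and \<open>g\<^sup>2\<close>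
  remain.  The latter contributes \<open>E g\<^sup>2/64 \<le> (h\<^sup>2(P, q\<^sub>0) + h\<^sup>2(P, q))/16\<close>, which leaves \<open>3/16\<close> of the
  negative drift \<open>- h\<^sup>2(P, q)/4\<close>.
\<close>

lemma mixture_class_deviation:
  fixes P :: "nat \<Rightarrow> 'a measure"
  assumes n: "2 \<le> n" and P: "\<And>i. prob_space (P i)" "\<And>i. sets (P i) = sets \<mu>" and \<theta>0: "\<theta>0 \<in> \<Theta>"
    and \<delta>: "1 / (real CARD('w option) * real n) \<le> \<delta>"
  defines "H \<equiv> \<lambda>\<theta>. \<Sum>i=1..n. hellinger_sq (P i) (mix_measure \<mu> b f \<theta>)"
  shows "\<exists>E\<in>sets (PiM {1..n} P). measure (PiM {1..n} P) E \<ge> 1 - exp (- \<xi>) \<and>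
    (\<forall>x\<in>E. \<forall>\<theta>\<in>mix_params \<delta>.
       (\<Sum>i=1..n. psi_ratio (mix_density b f \<theta> (x i)) (mix_density b f \<theta>0 (x i)))
       \<le> 41/16 * H \<theta>0 - 3/16 * H \<theta>
         + (100 * real CARD('w option) + 512 * (17 * ((\<Sum>k\<in>UNIV. real (V k)) * ln (real n)) + \<xi>)))"
proof -
  let ?K = "real CARD('w option)"
  define v where "v = (\<Sum>k\<in>UNIV. V k)"
  define m where "m = n ^ 3"
  define g where "g \<theta> x = psi_ratio (mix_density b f \<theta> x) (mix_density b f \<theta>0 x)" for \<theta> x
  define \<phi> where "\<phi> \<theta> x = g \<theta> x + (g \<theta> x)\<^sup>2 / 128" for \<theta> x
  have K1: "?K \<ge> 1" by (simp add: card_UNIV_option)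
  have n0: "0 < n" and m0: "0 < m" using n by (auto simp: m_def)
  have \<delta>0: "0 < \<delta>" using \<delta> n0 K1 by (smt (verit) divide_pos_pos mult_pos_pos of_nat_0_less_iff)
  have sp: "space (P i) = space \<mu>" for i using P(2) by (rule sets_eq_imp_space_eq)
  have par: "\<theta> \<in> \<Theta>" if "\<theta> \<in> mix_params \<delta>" for \<theta> using that by (simp add: mix_params_def)
  have g1: "\<bar>g \<theta> x\<bar> \<le> 1" if "\<theta> \<in> mix_params \<delta>" "x \<in> space \<mu>" for \<theta> x
    unfolding g_def by (intro abs_psi_ratio_le mix_density_nonneg par \<theta>0 that)
  have gm: "g \<theta> \<in> borel_measurable \<mu>" if "\<theta> \<in> mix_params \<delta>" for \<theta>
    unfolding g_def psi_ratio_def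
    using mix_density_measurable[OF par[OF that]] mix_density_measurable[OF \<theta>0] by measurable
  have gmP: "g \<theta> \<in> borel_measurable (P i)" if "\<theta> \<in> mix_params \<delta>" for \<theta> i
    using gm[OF that] measurable_cong_sets[OF P(2) refl] by blast
  have sq1: "(g \<theta> x)\<^sup>2 \<le> 1" if "\<theta> \<in> mix_params \<delta>" "x \<in> space \<mu>" for \<theta> x
    using g1[OF that] by (simp add: abs_square_le_1)
  \<comment> \<open>With \<open>m = n\<^sup>3\<close> thresholds per unit and \<open>\<delta> \<ge> 1/(K n)\<close>, all approximation errors are of order \<open>1/n\<close>,
    so that their sum over the sample stays bounded.\<close>
  define \<eta>0 where "\<eta>0 = 5 * ?K / real n"
  have res: "2 / sqrt (\<delta> * real m) + 2 * sqrt (2 * ?K / real m) \<le> \<eta>0"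
  proof -
    have "(real n / ?K)\<^sup>2 \<le> \<delta> * real m"
    proof -
      have "(real n / ?K)\<^sup>2 \<le> (real n)\<^sup>2 / ?K"
        unfolding power_divide using K1 by (intro divide_left_mono) (auto simp: power2_eq_square)
      also have "\<dots> = 1 / (?K * real n) * real m" using n0 K1 by (simp add: m_def power2_eq_square power3_eq_cube)
      also have "\<dots> \<le> \<delta> * real m" by (rule mult_right_mono[OF \<delta>]) simp
      finally show ?thesis .
    qed
    then have "real n / ?K \<le> sqrt (\<delta> * real m)" by (rule real_le_rsqrt)
    then have "2 / sqrt (\<delta> * real m) \<le> 2 / (real n / ?K)"
      using n0 K1 \<delta>0 m0 by (intro divide_left_mono) auto
    then have 1: "2 / sqrt (\<delta> * real m) \<le> 2 * ?K / real n" using n0 K1 by simp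
    have "2 * ?K / real m \<le> (3/2 * ?K / real n)\<^sup>2"
    proof -
      have "2 * ?K * (real n)\<^sup>2 \<le> (9/4 * (?K * ?K)) * (real n)\<^sup>2"
        using mult_left_mono[OF K1, of ?K] K1 by (intro mult_right_mono zero_le_power2) linarith
      also have "\<dots> \<le> (9/4 * (?K * ?K)) * real m"
        using n0 K1 by (intro mult_left_mono) (auto simp: m_def intro: power_increasing)
      finally have le: "2 * ?K * (real n)\<^sup>2 \<le> (9/4 * (?K * ?K)) * real m" .
      have "a / s \<le> r / t" if "a * t \<le> r * s" "0 < s" "0 < t" for a r s t :: real
        using that by (simp add: field_simps)
      from this[OF le] n0 m0 have "2 * ?K / real m \<le> (9/4 * (?K * ?K)) / (real n)\<^sup>2" by simp
      also have "\<dots> = (3/2 * ?K / real n)\<^sup>2" by (simp only: power_divide power_mult_distrib) (simp add: power2_eq_square)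
      finally show ?thesis .
    qed
    then have "sqrt (2 * ?K / real m) \<le> 3/2 * ?K / real n"
      using K1 n0 by (intro real_le_lsqrt) auto
    moreover have "\<eta>0 = 2 * ?K / real n + 2 * (3/2 * ?K / real n)" 
    proof -
      have "5 * a / s = 2 * a / s + 2 * (3/2 * a / s)" for a s :: real
        unfolding times_divide_eq_right[symmetric] by linarith
      then show ?thesis unfolding \<eta>0_def .
    qed
    ultimately show ?thesis using 1 by linarith
  qed
  have count: "(2 * n * (m\<^sup>2 + 1) + 1) ^ v * (m\<^sup>2 + 1) ^ CARD('w option) \<le> n ^ (17 * v)"
  proof -
    have "1 \<le> n ^ 6" using n0 by simp
    then have a: "m\<^sup>2 + 1 \<le> n ^ 7"
    proof -
      have "m\<^sup>2 = n ^ 6" by (simp add: m_def flip: power_mult)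
      then have "m\<^sup>2 + 1 \<le> 2 * n ^ 6" using \<open>1 \<le> n ^ 6\<close> by simp
      also have "\<dots> \<le> n * n ^ 6" using n by (intro mult_right_mono) auto
      finally show ?thesis by (simp add: power_Suc[symmetric] del: power_Suc)
    qed
    have "2 * n * (m\<^sup>2 + 1) \<le> n * n * n ^ 7" using a n by (intro mult_mono) auto
    also have "\<dots> = n ^ 9" by (simp add: eval_nat_numeral)
    finally have "2 * n * (m\<^sup>2 + 1) + 1 \<le> 2 * n ^ 9" using n0 by (simp add: Suc_leI)
    also have "\<dots> \<le> n * n ^ 9" using n by (intro mult_right_mono) auto
    also have "\<dots> = n ^ 10" by (simp add: eval_nat_numeral)
    finally have c: "2 * n * (m\<^sup>2 + 1) + 1 \<le> n ^ 10" .
    have "(2 * n * (m\<^sup>2 + 1) + 1) ^ v * (m\<^sup>2 + 1) ^ CARD('w option) \<le> (n ^ 10) ^ v * (n ^ 7) ^ CARD('w option)"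
      using a c by (intro mult_mono power_mono) auto
    also have "\<dots> \<le> (n ^ 10) ^ v * (n ^ 7) ^ v"
      using n0 card_le_sum_V by (intro mult_left_mono power_increasing) (auto simp: v_def)
    also have "\<dots> = n ^ (17 * v)" by (simp flip: power_mult power_add)
    finally show ?thesis .
  qed
  have code: "\<exists>code :: real ^ ('w + 'j) \<Rightarrow> ('w option \<Rightarrow> ('a \<times> real) set) \<times> ('w option \<Rightarrow> nat).
      finite (code ` mix_params \<delta>) \<and> card (code ` mix_params \<delta>) \<le> n ^ (17 * v) \<and>
      (\<forall>\<theta>\<in>mix_params \<delta>. \<forall>\<eta>\<in>mix_params \<delta>. code \<theta> = code \<eta> \<longrightarrow> (\<forall>k\<in>{1..2*n}. \<bar>\<phi> \<theta> (z k) - \<phi> \<eta> (z k)\<bar> \<le> 2 * \<eta>0))"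
    if z: "\<And>i. i \<in> {1..n} \<Longrightarrow> z i \<in> space (P i) \<and> z (n + i) \<in> space (P i)" for z
  proof -
    have z': "z k \<in> space \<mu>" if "k \<in> {1..2*n}" for k
    proof (cases "k \<le> n")
      case True then show ?thesis using z[of k] that sp by auto
    next
      case False
      then have "k - n \<in> {1..n}" "n + (k - n) = k" using that by auto
      then show ?thesis using z[of "k - n"] sp by metis
    qed
    obtain code :: "real ^ ('w + 'j) \<Rightarrow> ('w option \<Rightarrow> ('a \<times> real) set) \<times> ('w option \<Rightarrow> nat)"
      where code: "finite (code ` mix_params \<delta>)"
        "card (code ` mix_params \<delta>) \<le> (2 * n * (m\<^sup>2 + 1) + 1) ^ v * (m\<^sup>2 + 1) ^ CARD('w option)"
        "\<And>\<theta> \<eta> i. \<theta> \<in> mix_params \<delta> \<Longrightarrow> \<eta> \<in> mix_params \<delta> \<Longrightarrow> code \<theta> = code \<eta> \<Longrightarrow> i \<in> {1..2*n} \<Longrightarrow>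
          \<bar>g \<theta> (z i) - g \<eta> (z i)\<bar> \<le> 2 / sqrt (\<delta> * real m) + 2 * sqrt (2 * ?K / real m)"
      using ex_mixture_code[OF m0 \<delta>0 \<theta>0, of "2 * n" z] z' unfolding g_def v_def by blast
    have "\<bar>\<phi> \<theta> (z k) - \<phi> \<eta> (z k)\<bar> \<le> 2 * \<eta>0"
      if t: "\<theta> \<in> mix_params \<delta>" "\<eta> \<in> mix_params \<delta>" "code \<theta> = code \<eta>" "k \<in> {1..2*n}" for \<theta> \<eta> k
    proof -
      let ?a = "g \<theta> (z k)" and ?c = "g \<eta> (z k)"
      have d: "\<bar>?a - ?c\<bar> \<le> \<eta>0" using code(3)[OF t] res by linarith
      have "\<bar>?a + ?c\<bar> \<le> 2" using g1[OF t(1) z'[OF t(4)]] g1[OF t(2) z'[OF t(4)]] by linarith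
      then have "\<bar>?a - ?c\<bar> * \<bar>?a + ?c\<bar> \<le> \<eta>0 * 2" using d by (intro mult_mono) auto
      moreover have "?a\<^sup>2 - ?c\<^sup>2 = (?a - ?c) * (?a + ?c)" by (simp add: power2_eq_square algebra_simps)
      ultimately have "\<bar>?a\<^sup>2 - ?c\<^sup>2\<bar> \<le> 2 * \<eta>0" by (simp add: abs_mult)
      moreover have "\<phi> \<theta> (z k) - \<phi> \<eta> (z k) = (?a - ?c) + (?a\<^sup>2 - ?c\<^sup>2) / 128"
        by (simp add: \<phi>_def field_simps)
      ultimately show ?thesis using d unfolding \<phi>_def by (simp add: abs_le_iff)
    qed
    then show ?thesis using code count by (intro exI[of _ code]) (auto intro: order_trans)
  qed
  have \<phi>b: "\<bar>\<phi> \<theta> x\<bar> \<le> 2" if "\<theta> \<in> mix_params \<delta>" "x \<in> space (P i)" for \<theta> x i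
  proof -
    have "x \<in> space \<mu>" using that sp by auto
    then show ?thesis
      using g1[OF that(1), of x] sq1[OF that(1), of x] zero_le_power2[of "g \<theta> x"]
      unfolding \<phi>_def abs_le_iff by linarith
  qed
  have \<phi>m: "\<phi> \<theta> \<in> borel_measurable (P i)" if "\<theta> \<in> mix_params \<delta>" for \<theta> i
    unfolding \<phi>_def using gmP[OF that] by measurable
  have "\<exists>E\<in>sets (PiM {1..n} P). measure (PiM {1..n} P) E \<ge> 1 - exp (- \<xi>) \<and>
      (\<forall>x\<in>E. \<forall>\<theta>\<in>mix_params \<delta>.
      (\<Sum>i=1..n. \<phi> \<theta> (x i) - (\<integral>y. \<phi> \<theta> y \<partial>P i) - 1/512 * ((\<phi> \<theta> (x i))\<^sup>2 + (\<integral>y. (\<phi> \<theta> y)\<^sup>2 \<partial>P i)))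
        \<le> real n * (2 * \<eta>0 * (2 + 4 * 2)) + (ln (real (n ^ (17 * v))) + \<xi>) / (1/512))"
    by (rule uniform_deviation[where P = P and \<phi> = \<phi>, OF P(1) countable_mix_params \<phi>m \<phi>b _ _ _ _ code])
       (use n0 in auto)
  then obtain E where E: "E \<in> sets (PiM {1..n} P)" "measure (PiM {1..n} P) E \<ge> 1 - exp (- \<xi>)"
    "\<And>x \<theta>. x \<in> E \<Longrightarrow> \<theta> \<in> mix_params \<delta> \<Longrightarrow>
      (\<Sum>i=1..n. \<phi> \<theta> (x i) - (\<integral>y. \<phi> \<theta> y \<partial>P i) - 1/512 * ((\<phi> \<theta> (x i))\<^sup>2 + (\<integral>y. (\<phi> \<theta> y)\<^sup>2 \<partial>P i)))
        \<le> real n * (2 * \<eta>0 * (2 + 4 * 2)) + (ln (real (n ^ (17 * v))) + \<xi>) / (1/512)"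
    by blast
  have "(\<Sum>i=1..n. g \<theta> (x i)) \<le> 41/16 * H \<theta>0 - 3/16 * H \<theta>
         + (100 * ?K + 512 * (17 * ((\<Sum>k\<in>UNIV. real (V k)) * ln (real n)) + \<xi>))"
    if x: "x \<in> E" and \<theta>: "\<theta> \<in> mix_params \<delta>" for x \<theta>
  proof -
    have "x \<in> space (PiM {1..n} P)" using sets.sets_into_space[OF E(1)] x by blast
    then have xs: "x i \<in> space \<mu>" if "i \<in> {1..n}" for i
      using that sp[of i] by (auto simp: space_PiM dest: PiE_mem)
    have sq4: "(\<phi> \<theta> y)\<^sup>2 \<le> 4 * (g \<theta> y)\<^sup>2" if "y \<in> space \<mu>" for y
    proof -
      have "\<phi> \<theta> y = g \<theta> y * (1 + g \<theta> y / 128)" by (simp add: \<phi>_def power2_eq_square algebra_simps)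
      moreover have "(1 + g \<theta> y / 128)\<^sup>2 \<le> 2\<^sup>2" using g1[OF \<theta> that] by (intro power_mono) auto
      then have "(g \<theta> y)\<^sup>2 * (1 + g \<theta> y / 128)\<^sup>2 \<le> (g \<theta> y)\<^sup>2 * 2\<^sup>2"
        by (rule mult_left_mono) simp
      ultimately show ?thesis by (simp add: power_mult_distrib)
    qed
    have pointwise: "g \<theta> (x i) \<le> (\<phi> \<theta> (x i) - (\<integral>y. \<phi> \<theta> y \<partial>P i) - 1/512 * ((\<phi> \<theta> (x i))\<^sup>2 + (\<integral>y. (\<phi> \<theta> y)\<^sup>2 \<partial>P i)))
        + (41/16 * hellinger_sq (P i) (mix_measure \<mu> b f \<theta>0) - 3/16 * hellinger_sq (P i) (mix_measure \<mu> b f \<theta>))"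
      if i: "i \<in> {1..n}" for i
    proof -
      interpret Pi: prob_space "P i" by (rule P)
      have gi: "integrable (P i) (g \<theta>)" "integrable (P i) (\<lambda>y. (g \<theta> y)\<^sup>2)"
        by (rule Pi.integrable_const_bound[of _ 1]; use g1[OF \<theta>] sq1[OF \<theta>] gmP[OF \<theta>] sp in auto)+
      have \<phi>i: "integrable (P i) (\<lambda>y. (\<phi> \<theta> y)\<^sup>2)"
      proof (rule Pi.integrable_const_bound[of _ 4])
        have "\<bar>(\<phi> \<theta> y)\<^sup>2\<bar> \<le> 4" if "y \<in> space \<mu>" for y using sq4[OF that] sq1[OF \<theta> that] by simp
        then show "AE y in P i. norm ((\<phi> \<theta> y)\<^sup>2) \<le> 4" using sp by auto
      qed (use \<phi>m[OF \<theta>] in measurable)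
      have e\<phi>: "(\<integral>y. \<phi> \<theta> y \<partial>P i) = (\<integral>y. g \<theta> y \<partial>P i) + (\<integral>y. (g \<theta> y)\<^sup>2 \<partial>P i) / 128"
        unfolding \<phi>_def using gi by simp
      have "(\<integral>y. (\<phi> \<theta> y)\<^sup>2 \<partial>P i) \<le> (\<integral>y. 4 * (g \<theta> y)\<^sup>2 \<partial>P i)"
        by (rule integral_mono[OF \<phi>i]) (use gi sq4 sp in auto)
      then have e\<phi>2: "(\<integral>y. (\<phi> \<theta> y)\<^sup>2 \<partial>P i) \<le> 4 * (\<integral>y. (g \<theta> y)\<^sup>2 \<partial>P i)" by simp
      have h: "(\<integral>y. g \<theta> y \<partial>P i) \<le> 5/2 * hellinger_sq (P i) (mix_measure \<mu> b f \<theta>0) - 1/4 * hellinger_sq (P i) (mix_measure \<mu> b f \<theta>)"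
        "(\<integral>y. (g \<theta> y)\<^sup>2 \<partial>P i) \<le> 4 * (hellinger_sq (P i) (mix_measure \<mu> b f \<theta>0) + hellinger_sq (P i) (mix_measure \<mu> b f \<theta>))"
        using psi_ratio_expectation[OF sigma_finite_measure_axioms P(1) P(2) mix_density_measurable[OF \<theta>0]
            mix_density_measurable[OF par[OF \<theta>]] mix_density_nonneg[OF \<theta>0] mix_density_nonneg[OF par[OF \<theta>]]
            prob_space_mix[OF \<theta>0, unfolded mix_measure_def] prob_space_mix[OF par[OF \<theta>], unfolded mix_measure_def]]
        unfolding g_def mix_measure_def by auto
      have "(\<phi> \<theta> (x i))\<^sup>2 \<le> 4 * (g \<theta> (x i))\<^sup>2" by (rule sq4[OF xs[OF i]])
      then have "g \<theta> (x i) \<le> \<phi> \<theta> (x i) - 1/512 * (\<phi> \<theta> (x i))\<^sup>2" by (simp add: \<phi>_def)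
      then show ?thesis using e\<phi> e\<phi>2 h by (simp add: field_simps)
    qed
    have "(\<Sum>i=1..n. g \<theta> (x i)) \<le> (\<Sum>i=1..n. (\<phi> \<theta> (x i) - (\<integral>y. \<phi> \<theta> y \<partial>P i) - 1/512 * ((\<phi> \<theta> (x i))\<^sup>2 + (\<integral>y. (\<phi> \<theta> y)\<^sup>2 \<partial>P i)))
        + (41/16 * hellinger_sq (P i) (mix_measure \<mu> b f \<theta>0) - 3/16 * hellinger_sq (P i) (mix_measure \<mu> b f \<theta>)))"
      by (rule sum_mono) (rule pointwise)
    also have "\<dots> = (\<Sum>i=1..n. \<phi> \<theta> (x i) - (\<integral>y. \<phi> \<theta> y \<partial>P i) - 1/512 * ((\<phi> \<theta> (x i))\<^sup>2 + (\<integral>y. (\<phi> \<theta> y)\<^sup>2 \<partial>P i)))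
        + (41/16 * H \<theta>0 - 3/16 * H \<theta>)"
      unfolding H_def sum.distrib[of _ "\<lambda>i. 41/16 * hellinger_sq (P i) (mix_measure \<mu> b f \<theta>0) - 3/16 * hellinger_sq (P i) (mix_measure \<mu> b f \<theta>)"]
      by (simp only: sum_subtractf sum_distrib_left)
    also have "\<dots> \<le> (real n * (2 * \<eta>0 * (2 + 4 * 2)) + (ln (real (n ^ (17 * v))) + \<xi>) / (1/512)) + (41/16 * H \<theta>0 - 3/16 * H \<theta>)"
      by (rule add_right_mono[OF E(3)[OF x \<theta>]])
    also have "real n * (2 * \<eta>0 * (2 + 4 * 2)) = 100 * ?K" using n0 by (simp add: \<eta>0_def)
    also have "ln (real (n ^ (17 * v))) = 17 * ((\<Sum>k\<in>UNIV. real (V k)) * ln (real n))"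
      using n0 by (simp add: ln_realpow v_def)
    finally show ?thesis by simp
  qed
  then show ?thesis using E(1,2) unfolding g_def by blast
qed

text \<open>
  The terms of constant order that arise in the risk bound are absorbed into \<open>V log n\<close>.
\<close>

lemma sum_V_ln_lower_bounds:
  assumes "2 \<le> n"
  shows "real CARD('w option) \<le> 2 * ((\<Sum>k\<in>UNIV. real (V k)) * ln (real n))"
    and "1 \<le> 2 * ((\<Sum>k\<in>UNIV. real (V k)) * ln (real n))"
proof -
  have VK: "real CARD('w option) \<le> (\<Sum>k\<in>UNIV. real (V k))"
    using card_le_sum_V by (metis of_nat_le_iff of_nat_sum)
  have K1: "1 \<le> real CARD('w option)" by (simp add: card_UNIV_option)
  have "ln 2 \<le> ln (real n)" using assms by (subst ln_le_cancel_iff) auto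
  then have "1/2 \<le> ln (real n)" using ln2_ge_two_thirds by linarith
  then have "(\<Sum>k\<in>UNIV. real (V k)) * (1/2) \<le> (\<Sum>k\<in>UNIV. real (V k)) * ln (real n)"
    using VK K1 by (intro mult_left_mono) auto
  then show "real CARD('w option) \<le> 2 * ((\<Sum>k\<in>UNIV. real (V k)) * ln (real n))"
    "1 \<le> 2 * ((\<Sum>k\<in>UNIV. real (V k)) * ln (real n))" using VK K1 by linarith+
qed

text \<open>
  The deviation bound gives \<open>T(X, q\<^sub>0, q) \<le> a - 3/16 h\<^sup>2(P, q)\<close> for all \<open>q\<close> of the class at once, so the
  selection bound applies to every near-minimizer of \<open>\<Upsilon>\<close>, in particular to one that approximates the
  estimator to within \<open>1/n\<close>.  The rest is the triangle inequality; the numerical constant is a convenient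
  upper bound for the one it produces.
\<close>

lemma rho_estimator_hellinger_risk:
  fixes P :: "nat \<Rightarrow> 'a measure"
  assumes n: "2 \<le> n" and P: "\<And>i. i \<in> {1..n} \<Longrightarrow> P i \<in> space (prob_algebra \<mu>)"
    and est: "rho_estimator \<mu> (mix_subclass b f B \<Theta> \<delta>) n Phat"
    and \<delta>_ge: "1 / (real CARD('w option) * real n) \<le> \<delta>"
    and \<zeta>: "\<zeta> \<in> \<Theta>" and \<theta>0: "\<theta>0 \<in> mix_params \<delta>" "hellinger_sq (mix_measure \<mu> b f \<zeta>) (mix_measure \<mu> b f \<theta>0) < 1 / real n"
    and \<xi>: "0 < \<xi>"
  shows "\<exists>E\<in>sets (PiM {1..n} P). measure (PiM {1..n} P) E \<ge> 1 - exp (- \<xi>) \<and>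
    (\<forall>x\<in>E. real n * hellinger_sq (mix_measure \<mu> b f \<zeta>) (Phat x)
      \<le> 1000000 * ((\<Sum>i=1..n. hellinger_sq (P i) (mix_measure \<mu> b f \<zeta>)) + (\<Sum>k\<in>UNIV. real (V k)) * ln (real n) + \<xi>))"
proof -
  let ?mix = "mix_measure \<mu> b f" and ?K = "real CARD('w option)"
  define L where "L = (\<Sum>k\<in>UNIV. real (V k)) * ln (real n)"
  define Hs where "Hs = (\<Sum>i=1..n. hellinger_sq (P i) (?mix \<zeta>))"
  have Hs0: "0 \<le> Hs" unfolding Hs_def by (intro sum_nonneg hellinger_sq_nonneg)
  have L: "?K \<le> 2 * L" "1 \<le> 2 * L" unfolding L_def using sum_V_ln_lower_bounds[OF n] by simp_all
  have P: "prob_space (P i)" "sets (P i) = sets \<mu>" if "i \<in> {1..n}" for i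
    using P[OF that] by (auto simp: space_prob_algebra)
  have spP: "space (PiM {1..n} P) = space (PiM {1..n} (\<lambda>_. \<mu>))"
    by (rule sets_eq_imp_space_eq, rule sets_PiM_cong) (use P in auto)
  have par: "\<theta> \<in> \<Theta>" if "\<theta> \<in> mix_params \<delta>" for \<theta> using that by (simp add: mix_params_def)
  have mixp: "prob_space (?mix \<theta>)" "sets (?mix \<theta>) = sets \<mu>" if "\<theta> \<in> \<Theta>" for \<theta>
    using prob_space_mix[OF that] by (auto simp: mix_measure_def)
  \<comment> \<open>The deviation bound asks for a whole sequence of laws; a member of the model continues the given ones.\<close>
  define P' where "P' i = (if i \<in> {1..n} then P i else ?mix \<theta>0)" for i
  have P': "prob_space (P' i)" "sets (P' i) = sets \<mu>" for i
    using P mixp[OF par[OF \<theta>0(1)]] by (auto simp: P'_def)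
  have PiP': "PiM {1..n} P' = PiM {1..n} P" by (rule PiM_cong) (auto simp: P'_def)
  define H where "H M = (\<Sum>i=1..n. hellinger_sq (P i) M)" for M
  have HP': "(\<Sum>i=1..n. hellinger_sq (P' i) M) = H M" for M
    unfolding H_def by (rule sum.cong) (auto simp: P'_def)
  define a where "a = 41/16 * H (?mix \<theta>0) + (100 * ?K + 512 * (17 * L + \<xi>))"
  obtain E where E: "E \<in> sets (PiM {1..n} P)" "measure (PiM {1..n} P) E \<ge> 1 - exp (- \<xi>)"
    "\<And>x \<theta>. x \<in> E \<Longrightarrow> \<theta> \<in> mix_params \<delta> \<Longrightarrow>
      (\<Sum>i=1..n. psi_ratio (mix_density b f \<theta> (x i)) (mix_density b f \<theta>0 (x i))) \<le> a - 3/16 * H (?mix \<theta>)"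
  proof -
    obtain E where "E \<in> sets (PiM {1..n} P)" "measure (PiM {1..n} P) E \<ge> 1 - exp (- \<xi>)"
      "\<forall>x\<in>E. \<forall>\<theta>\<in>mix_params \<delta>. (\<Sum>i=1..n. psi_ratio (mix_density b f \<theta> (x i)) (mix_density b f \<theta>0 (x i)))
        \<le> 41/16 * H (?mix \<theta>0) - 3/16 * H (?mix \<theta>) + (100 * ?K + 512 * (17 * L + \<xi>))"
      using mixture_class_deviation[where P = P' and \<xi> = \<xi>, OF n P' par[OF \<theta>0(1)] \<delta>_ge]
      unfolding PiP' HP' L_def by blast
    then show thesis by (intro that[of E]) (auto simp: a_def algebra_simps)
  qed
  have H0: "H (?mix \<theta>0) \<le> 2 * Hs + 2"
  proof -
    have "H (?mix \<theta>0) \<le> (\<Sum>i=1..n. 2 * hellinger_sq (P i) (?mix \<zeta>) + 2 * (1 / real n))"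
      unfolding H_def
    proof (rule sum_mono)
      fix i assume i: "i \<in> {1..n}"
      have "hellinger_sq (P i) (?mix \<theta>0) \<le> 2 * hellinger_sq (P i) (?mix \<zeta>) + 2 * hellinger_sq (?mix \<zeta>) (?mix \<theta>0)"
        by (rule hellinger_sq_triangle) (use P[OF i] mixp[OF \<zeta>] mixp[OF par[OF \<theta>0(1)]] in auto)
      with \<theta>0(2) show "hellinger_sq (P i) (?mix \<theta>0) \<le> 2 * hellinger_sq (P i) (?mix \<zeta>) + 2 * (1 / real n)" by linarith
    qed
    also have "\<dots> = 2 * Hs + 2" using n by (simp add: sum.distrib Hs_def sum_distrib_left)
    finally show ?thesis .
  qed
  have "real n * hellinger_sq (?mix \<zeta>) (Phat x) \<le> 1000000 * (Hs + L + \<xi>)" if x: "x \<in> E" for x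
  proof -
    have xs: "x \<in> space (PiM {1..n} P)" using E(1) x sets.sets_into_space by blast
    then have xi: "x i \<in> space \<mu>" if "i \<in> {1..n}" for i using that unfolding spP by (auto simp: space_PiM)
    let ?Q = "mix_density b f ` mix_params \<delta>"
    have "Phat x \<in> hellinger_closure \<mu> {density \<mu> (\<lambda>y. ennreal (q y)) | q.
         q \<in> ?Q \<and> rho_Upsilon ?Q n x q < (INF q'\<in>?Q. rho_Upsilon ?Q n x q') + 8.24}"
      using est xs unfolding rho_estimator_def mix_subclass_eq spP by blast
    moreover have "0 < 1 / real n" using n by simp
    ultimately obtain \<theta>h where \<theta>h: "\<theta>h \<in> mix_params \<delta>"
      "rho_Upsilon ?Q n x (mix_density b f \<theta>h) < (INF q'\<in>?Q. rho_Upsilon ?Q n x q') + 8.24"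
      "hellinger_sq (Phat x) (?mix \<theta>h) < 1 / real n"
      unfolding hellinger_closure_def mix_measure_def by blast
    have hx: "prob_space (Phat x)" "sets (Phat x) = sets \<mu>"
      using est xs unfolding rho_estimator_def spP hellinger_closure_def by (auto simp: space_prob_algebra)
    have sel: "3/16 * H (?mix \<theta>h) \<le> 2 * a + 8.24"
    proof -
      have nn: "0 \<le> q (x i)" if "q \<in> ?Q" "i \<in> {1..n}" for q i
        using that par mix_density_nonneg xi by auto
      have up: "rho_T n x (mix_density b f \<theta>0) q \<le> a - 3/16 * H (density \<mu> (\<lambda>y. ennreal (q y)))" if q: "q \<in> ?Q" for q
      proof -
        obtain \<theta> where \<theta>: "\<theta> \<in> mix_params \<delta>" "q = mix_density b f \<theta>" using q by blast
        show ?thesis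
          using E(3)[OF x \<theta>(1)] nn q \<theta>0(1) unfolding \<theta>(2) mix_measure_def
          by (subst rho_T_eq) auto
      qed
      have "0 \<le> 3/16 * H M" for M unfolding H_def by (simp add: sum_nonneg hellinger_sq_nonneg)
      then have "3/16 * H (density \<mu> (\<lambda>y. ennreal (mix_density b f \<theta>h y))) \<le> 2 * a + 8.24"
      proof (intro rho_selection_bound[where w = "\<lambda>q. 3/16 * H (density \<mu> (\<lambda>y. ennreal (q y)))" and \<Q> = ?Q
            and n = n and x = x and qb = "mix_density b f \<theta>0"])
        show "rho_Upsilon ?Q n x (mix_density b f \<theta>h) < (INF q'\<in>?Q. rho_Upsilon ?Q n x q') + 8.24"
          by (rule \<theta>h(2))
      qed (use \<theta>0(1) \<theta>h(1) nn up in auto)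
      then show ?thesis by (simp only: mix_measure_def)
    qed
    have "real n * hellinger_sq (?mix \<zeta>) (Phat x) = (\<Sum>i=1..n. hellinger_sq (?mix \<zeta>) (Phat x))" by simp
    also have "\<dots> \<le> (\<Sum>i=1..n. 2 * hellinger_sq (P i) (?mix \<zeta>) + 4 * hellinger_sq (P i) (?mix \<theta>h) + 4 * (1 / real n))"
    proof (rule sum_mono)
      fix i assume i: "i \<in> {1..n}"
      note m = P[OF i] mixp[OF \<zeta>] hx mixp[OF par[OF \<theta>h(1)]]
      have "hellinger_sq (?mix \<zeta>) (Phat x) \<le> 2 * hellinger_sq (?mix \<zeta>) (P i) + 2 * hellinger_sq (P i) (Phat x)"
        by (rule hellinger_sq_triangle) (use m in auto)
      moreover have "hellinger_sq (?mix \<zeta>) (P i) = hellinger_sq (P i) (?mix \<zeta>)"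
        by (rule hellinger_sq_commute) (use m in auto)
      moreover have "hellinger_sq (P i) (Phat x) \<le> 2 * hellinger_sq (P i) (?mix \<theta>h) + 2 * hellinger_sq (?mix \<theta>h) (Phat x)"
        by (rule hellinger_sq_triangle) (use m in auto)
      moreover have "hellinger_sq (?mix \<theta>h) (Phat x) = hellinger_sq (Phat x) (?mix \<theta>h)"
        by (rule hellinger_sq_commute) (use m in auto)
      ultimately show "hellinger_sq (?mix \<zeta>) (Phat x)
          \<le> 2 * hellinger_sq (P i) (?mix \<zeta>) + 4 * hellinger_sq (P i) (?mix \<theta>h) + 4 * (1 / real n)"
        using \<theta>h(3) by linarith
    qed
    also have "\<dots> = 2 * Hs + 4 * H (?mix \<theta>h) + 4"
      using n by (simp add: sum.distrib Hs_def H_def sum_distrib_left)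
    also have "\<dots> \<le> 1000000 * (Hs + L + \<xi>)"
    proof -
      have "(8.24 :: real) \<le> 9" by simp
      with sel have "3/16 * H (?mix \<theta>h) \<le> 2 * a + 9" by (rule order_trans[OF _ add_left_mono])
      then show ?thesis using H0 L Hs0 \<xi> unfolding a_def by argo
    qed
    finally show ?thesis .
  qed
  then show ?thesis using E(1,2) unfolding Hs_def L_def by blast
qed

end

theorem theorem4:
  fixes \<mu> :: "'a measure"
    and b :: "'j::finite \<Rightarrow> 'w::finite option"
    and f :: "'w option \<Rightarrow> real ^ 'j \<Rightarrow> 'a \<Rightarrow> real"
    and A B :: "'w option \<Rightarrow> (real ^ 'j) set"
    and V :: "'w option \<Rightarrow> nat"
    and \<Theta> :: "(real ^ ('w + 'j)) set"
    and \<theta>bar :: "real ^ ('w + 'j)"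
    and Vbar :: real
  assumes "mixture_model \<mu> b f A B V \<Theta>"
    and "Vbar = (\<Sum>k\<in>UNIV. real (V k))"
    and "\<theta>bar \<in> \<Theta>"
    and "positive_definite (Fisher_information \<mu> (mix_density b f) \<theta>bar)"
    and "\<And>a. a > 0 \<Longrightarrow>
           (INF \<theta>\<in>{\<theta> \<in> \<Theta>. norm (\<theta>bar - \<theta>) \<ge> a}.
              ereal (hellinger_sq (mix_measure \<mu> b f \<theta>bar) (mix_measure \<mu> b f \<theta>))) > 0"
  shows "\<exists>C>0. \<forall>(n::nat) (P :: nat \<Rightarrow> 'a measure)
             (Phat :: (nat \<Rightarrow> 'a) \<Rightarrow> 'a measure) (\<theta>hat :: (nat \<Rightarrow> 'a) \<Rightarrow> real ^ ('w + 'j)).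
           n \<ge> 2 \<longrightarrow>
           (\<forall>i\<in>{1..n}. P i \<in> space (prob_algebra \<mu>)) \<longrightarrow>
           rho_estimator \<mu>
             (mix_subclass b f B \<Theta> (min (Vbar / (real n * real CARD('w))) (1 / real CARD('w option))))
             n Phat \<longrightarrow>
           (\<forall>x\<in>space (PiM {1..n} P). \<theta>hat x \<in> \<Theta> \<and> Phat x = mix_measure \<mu> b f (\<theta>hat x)) \<longrightarrow>
           (\<forall>\<xi>>0.
              (\<exists>E\<in>sets (PiM {1..n} P).
                 measure (PiM {1..n} P) E \<ge> 1 - exp (- \<xi>) \<and>
                 (\<forall>x\<in>E.
                    C * ((norm (free_weights \<theta>bar - free_weights (\<theta>hat x)))\<^sup>2 +
                         (\<Sum>k\<in>UNIV. min 1 ((norm (component b k \<theta>bar - component b k (\<theta>hat x)))\<^sup>2)))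
                    \<le> 1 / real n * ((\<Sum>i=1..n. hellinger_sq (P i) (mix_measure \<mu> b f \<theta>bar))
                                     + Vbar * ln (real n) + \<xi>))) \<and>
              ((\<forall>i\<in>{1..n}. P i = mix_measure \<mu> b f \<theta>bar) \<longrightarrow>
                 1 / real n * ((\<Sum>i=1..n. hellinger_sq (P i) (mix_measure \<mu> b f \<theta>bar))
                                + Vbar * ln (real n) + \<xi>)
                 = (Vbar * ln (real n) + \<xi>) / real n))"
proof -
  interpret mixture_model \<mu> b f A B V \<Theta> by fact
  note Vbar = assms(2) and \<theta>bar = assms(3)
  let ?mix = "mix_measure \<mu> b f" and ?K = "real CARD('w option)"
  have K1: "1 \<le> ?K" by (simp add: card_UNIV_option)
  have VK: "?K \<le> Vbar"
    unfolding Vbar using card_le_sum_V by (metis of_nat_le_iff of_nat_sum)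
  obtain c where c: "c > 0" "\<And>\<eta>. \<eta> \<in> \<Theta> \<Longrightarrow> c * loss \<theta>bar \<eta> \<le> hellinger_sq (?mix \<theta>bar) (?mix \<eta>)"
    using hellinger_lower_bound[OF \<theta>bar assms(4,5)] by blast
  define wmin where "wmin = Min (range (weight \<theta>bar))"
  have wmin: "0 < wmin" "\<And>k. wmin \<le> weight \<theta>bar k"
    unfolding wmin_def using weight_pos[OF \<theta>bar] by (auto simp: Min_gr_iff)
  \<comment> \<open>From \<open>n0\<close> on, the lower bound \<open>\<delta> \<le> Vbar/n\<close> on the weights is below all weights of \<open>\<theta>bar\<close>; before,
    the approximating class may even be empty.\<close>
  obtain n0 :: nat where n0: "Vbar / wmin < real n0" using reals_Archimedean2 by blast
  have n0_pos: "0 < n0" using n0 VK K1 wmin(1) by (smt (verit) divide_nonneg_pos of_nat_0_less_iff of_nat_less_0_iff)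
  define C where "C = min (c / 1000000) (1 / (4 * ?K * real n0))"
  have C: "C > 0" using c(1) K1 n0_pos by (simp add: C_def)
  have self: "hellinger_sq M M = 0" for M :: "'a measure" by (simp add: hellinger_sq_def Let_def)
  have claim: "\<exists>E\<in>sets (PiM {1..n} P).
                 measure (PiM {1..n} P) E \<ge> 1 - exp (- \<xi>) \<and>
                 (\<forall>x\<in>E. C * loss \<theta>bar (\<theta>hat x)
                    \<le> 1 / real n * ((\<Sum>i=1..n. hellinger_sq (P i) (?mix \<theta>bar)) + Vbar * ln (real n) + \<xi>))"
    if n: "n \<ge> 2" and Pa: "\<forall>i\<in>{1..n}. P i \<in> space (prob_algebra \<mu>)"
      and est: "rho_estimator \<mu> (mix_subclass b f B \<Theta>
           (min (Vbar / (real n * real CARD('w))) (1 / ?K))) n Phat"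
      and hat: "\<forall>x\<in>space (PiM {1..n} P). \<theta>hat x \<in> \<Theta> \<and> Phat x = ?mix (\<theta>hat x)"
      and \<xi>: "\<xi> > 0" for n :: nat and P Phat \<theta>hat \<xi>
  proof -
    define \<delta> where "\<delta> = min (Vbar / (real n * real CARD('w))) (1 / ?K)"
    define L where "L = Vbar * ln (real n)"
    define Hs where "Hs = (\<Sum>i=1..n. hellinger_sq (P i) (?mix \<theta>bar))"
    have Hs0: "0 \<le> Hs" unfolding Hs_def by (intro sum_nonneg hellinger_sq_nonneg)
    have L: "1 \<le> 2 * L" unfolding L_def Vbar by (rule sum_V_ln_lower_bounds(2)[OF n])
    interpret PP: prob_space "PiM {1..n} P" by (rule prob_space_PiM) (use Pa in \<open>auto simp: space_prob_algebra\<close>)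
    show ?thesis
    proof (cases "n < n0")
      case True
      have "C * loss \<theta>bar (\<theta>hat x) \<le> 1 / real n * (Hs + L + \<xi>)" if x: "x \<in> space (PiM {1..n} P)" for x
      proof -
        have "C * loss \<theta>bar (\<theta>hat x) \<le> 1 / (4 * ?K * real n0) * (2 * ?K)"
          using loss_le_const[OF \<theta>bar, of "\<theta>hat x"] hat x C K1 n0_pos
          by (intro mult_mono) (auto simp: C_def loss_def intro!: add_nonneg_nonneg sum_nonneg)
        also have "\<dots> = 1 / real n0 * (1/2)"
        proof -
          have "1 / (4 * a * s) * (2 * a) = 1 / s * (1/2)" if "a \<noteq> 0" "s \<noteq> 0" for a s :: real
            using that by (simp add: field_simps)
          from this[of ?K "real n0"] show ?thesis using K1 n0_pos by linarith
        qed
        also have "\<dots> \<le> 1 / real n * (Hs + L + \<xi>)"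
          using True n Hs0 L \<xi> by (intro mult_mono divide_left_mono) auto
        finally show ?thesis .
      qed
      then have "\<forall>x\<in>space (PiM {1..n} P). C * loss \<theta>bar (\<theta>hat x) \<le> 1 / real n * (Hs + L + \<xi>)" by blast
      moreover have "1 - exp (- \<xi>) \<le> measure (PiM {1..n} P) (space (PiM {1..n} P))"
        unfolding PP.prob_space by simp
      ultimately show ?thesis unfolding Hs_def L_def by blast
    next
      case False
      have W: "1 \<le> real CARD('w)" "real CARD('w) \<le> ?K" by (simp_all add: card_UNIV_option Suc_leI)
      have \<delta>_ge: "1 / (?K * real n) \<le> \<delta>"
      proof -
        have "1 / (?K * real n) \<le> Vbar / (real n * real CARD('w))"
          using W VK K1 n by (intro frac_le) (auto simp: mult.commute)
        moreover have "1 / (?K * real n) \<le> 1 / ?K" using K1 n by (intro divide_left_mono) auto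
        ultimately show ?thesis by (simp add: \<delta>_def)
      qed
      have "\<delta> < weight \<theta>bar k" for k
      proof -
        have "\<delta> \<le> Vbar / (real n * real CARD('w))" by (simp add: \<delta>_def)
        also have "\<dots> \<le> Vbar / real n"
          using W n VK K1 by (intro divide_left_mono) auto
        also have "\<dots> < wmin"
        proof -
          have "Vbar / wmin < real n" using n0 False by simp
          then show ?thesis using wmin(1) n by (simp add: field_simps)
        qed
        also have "\<dots> \<le> weight \<theta>bar k" by (rule wmin)
        finally show ?thesis .
      qed
      with mix_params_dense[OF \<theta>bar, of "1 / real n" \<delta>] n obtain \<theta>0 where
        \<theta>0: "\<theta>0 \<in> mix_params \<delta>" "hellinger_sq (?mix \<theta>bar) (?mix \<theta>0) < 1 / real n" by auto
      obtain E where E: "E \<in> sets (PiM {1..n} P)" "measure (PiM {1..n} P) E \<ge> 1 - exp (- \<xi>)"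
        "\<And>x. x \<in> E \<Longrightarrow> real n * hellinger_sq (?mix \<theta>bar) (Phat x) \<le> 1000000 * (Hs + L + \<xi>)"
        using rho_estimator_hellinger_risk[OF n _ est[folded \<delta>_def] \<delta>_ge \<theta>bar \<theta>0 \<xi>, of P] Pa
        unfolding Hs_def L_def Vbar by blast
      have "C * loss \<theta>bar (\<theta>hat x) \<le> 1 / real n * (Hs + L + \<xi>)" if x: "x \<in> E" for x
      proof -
        have "x \<in> space (PiM {1..n} P)" using E(1) x sets.sets_into_space by blast
        then have hx: "\<theta>hat x \<in> \<Theta>" "Phat x = ?mix (\<theta>hat x)" using hat by auto
        note D = E(3)[OF x, unfolded hx(2)]
        have "0 \<le> loss \<theta>bar (\<theta>hat x)" unfolding loss_def by (intro add_nonneg_nonneg sum_nonneg) auto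
        then have "C * loss \<theta>bar (\<theta>hat x) \<le> c / 1000000 * loss \<theta>bar (\<theta>hat x)"
          by (intro mult_right_mono) (simp_all add: C_def)
        also have "\<dots> \<le> hellinger_sq (?mix \<theta>bar) (?mix (\<theta>hat x)) / 1000000"
          using c(2)[OF hx(1)] by simp
        also have "\<dots> \<le> 1 / real n * (Hs + L + \<xi>)"
          using D n by (simp add: field_simps)
        finally show ?thesis .
      qed
      then show ?thesis using E(1,2) unfolding Hs_def L_def by blast
    qed
  qed
  show ?thesis
  proof (intro exI[of _ C] conjI C allI impI)
    fix n :: nat and P Phat \<theta>hat and \<xi> :: real
    assume "n \<ge> 2" "\<forall>i\<in>{1..n}. P i \<in> space (prob_algebra \<mu>)"
      "rho_estimator \<mu> (mix_subclass b f B \<Theta> (min (Vbar / (real n * real CARD('w))) (1 / ?K))) n Phat"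
      "\<forall>x\<in>space (PiM {1..n} P). \<theta>hat x \<in> \<Theta> \<and> Phat x = ?mix (\<theta>hat x)" "\<xi> > 0"
    from claim[OF this] show "\<exists>E\<in>sets (PiM {1..n} P).
                 measure (PiM {1..n} P) E \<ge> 1 - exp (- \<xi>) \<and>
                 (\<forall>x\<in>E.
                    C * ((norm (free_weights \<theta>bar - free_weights (\<theta>hat x)))\<^sup>2 +
                         (\<Sum>k\<in>UNIV. min 1 ((norm (component b k \<theta>bar - component b k (\<theta>hat x)))\<^sup>2)))
                    \<le> 1 / real n * ((\<Sum>i=1..n. hellinger_sq (P i) (?mix \<theta>bar))
                                     + Vbar * ln (real n) + \<xi>))"
      unfolding loss_def .
  next
    fix n :: nat and P :: "nat \<Rightarrow> 'a measure" and \<xi> :: real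
    assume "\<forall>i\<in>{1..n}. P i = ?mix \<theta>bar"
    then have "(\<Sum>i=1..n. hellinger_sq (P i) (?mix \<theta>bar)) = 0" by (simp add: self)
    then show "1 / real n * ((\<Sum>i=1..n. hellinger_sq (P i) (?mix \<theta>bar)) + Vbar * ln (real n) + \<xi>)
                 = (Vbar * ln (real n) + \<xi>) / real n" by simp
  qed
qed

end
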